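(* Let $S\subset[0,\pi/2)$. Then $S$ is an $R$-set if and only if $S$ is a $G_\delta$-set, i.e. $S=\big(\bigcap_{k=1}^\infty G_k\big)\cap[0,\pi/2)$ for some open sets $G_k\subset\mathbb{R}$, $k=1,2,\dots$.
   Context: For $s\in[0,\pi/2)$ let $\mathcal{R}_s$ be the family of all open rectangles $R$ in $\mathbb{R}^2$ having slope $s$, i.e. having a side that forms angle $s$ with the abscissa ($x_1$-axis). Let $d(R)$ be the diameter of $R$ and $|\cdot|$ planar Lebesgue measure. For $f\in L^1(\mathbb{R}^2)$, the basis $\mathcal{R}_s$ is said to differentiate the integral of $f$ (written: differentiates $\int f$) if $$\lim_{d(R)\to 0,\ x\in R\in\mathcal{R}_s}\frac{1}{|R|}\int_R f=f(x)$$ for almost every $x\in\mathbb{R}^2$. The upper derivative is $$\overline D_sf(x)=\limsup_{d(R)\to 0,\ x\in R\in\mathcal{R}_s}\frac{1}{|R|}\int_R f .$$ A set $S\subset[0,\pi/2)$ is called an $R$-set if there exists a function $f\in L^1(\mathbb{R}^2)$ such that $\mathcal{R}_s$ differentiates $\int f$ for every $s\in[0,\pi/2)\setminus S$, and, for every $s\in S$, $\overline D_sf(x)=\infty$ for almost every $x\in\mathbb{R}^2$. *)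

theory Defs
  imports "HOL-Analysis.Analysis"
begin

definition dir :: "real \<Rightarrow> real ^ 2" where
  "dir s = vector [cos s, sin s]"

definition open_rect :: "real \<Rightarrow> real ^ 2 \<Rightarrow> real \<Rightarrow> real \<Rightarrow> (real ^ 2) set" where
  "open_rect s p a b =
     {p + u *\<^sub>R dir s + v *\<^sub>R dir (s + pi / 2) | u v. 0 < u \<and> u < a \<and> 0 < v \<and> v < b}"

definition rects :: "real \<Rightarrow> (real ^ 2) set set" where
  "rects s = {open_rect s p a b | p a b. 0 < a \<and> 0 < b}"

(* The filter of the limit "d(R) \<rightarrow> 0 with x \<in> R \<in> rects s"; x is any point of R, not its centre. *)
definition shrinking_rects :: "real \<Rightarrow> real ^ 2 \<Rightarrow> (real ^ 2) set filter" where
  "shrinking_rects s x =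
     inf (filtercomap diameter (nhds 0)) (principal {R \<in> rects s. x \<in> R})"

definition average :: "(real ^ 2 \<Rightarrow> real) \<Rightarrow> (real ^ 2) set \<Rightarrow> real" where
  "average f R = (LINT y:R|lebesgue. f y) / measure lebesgue R"

definition differentiates :: "real \<Rightarrow> (real ^ 2 \<Rightarrow> real) \<Rightarrow> bool" where
  "differentiates s f \<longleftrightarrow>
     (AE x in lebesgue. (average f \<longlongrightarrow> f x) (shrinking_rects s x))"

definition upper_derivative :: "real \<Rightarrow> (real ^ 2 \<Rightarrow> real) \<Rightarrow> real ^ 2 \<Rightarrow> ereal" where
  "upper_derivative s f x = Limsup (shrinking_rects s x) (\<lambda>R. ereal (average f R))"

definition R_set :: "real set \<Rightarrow> bool" where
  "R_set S \<longleftrightarrow> S \<subseteq> {0..<pi / 2} \<and>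
     (\<exists>f :: real ^ 2 \<Rightarrow> real. integrable lebesgue f \<and>
        (\<forall>s \<in> {0..<pi / 2} - S. differentiates s f) \<and>
        (\<forall>s \<in> S. AE x in lebesgue. upper_derivative s f x = \<infinity>))"

(* Without this, every convergence along the filter would hold vacuously. *)
lemma shrinking_rects_neq_bot: "shrinking_rects s x \<noteq> bot"
proof
  assume "shrinking_rects s x = bot"
  then have "eventually (\<lambda>R. False) (inf (filtercomap diameter (nhds (0::real))) (principal {R \<in> rects s. x \<in> R}))"
    unfolding shrinking_rects_def by simp
  then have "eventually (\<lambda>R. \<not> (R \<in> rects s \<and> x \<in> R)) (filtercomap diameter (nhds (0::real)))"
    by (simp add: eventually_inf_principal)
  then obtain e :: real where e: "e > 0"
    and imp: "\<And>R :: (real ^ 2) set. \<bar>diameter R\<bar> < e \<Longrightarrow> \<not> (R \<in> rects s \<and> x \<in> R)"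
    unfolding eventually_filtercomap eventually_nhds_metric dist_real_def
    by (metis diff_0_right)
  have imp: False if "R \<in> rects s" "x \<in> R" "\<bar>diameter R\<bar> < e" for R
    using imp that by blast
  define t where "t = e / 8"
  have t: "t > 0" using e by (simp add: t_def)
  define p where "p = x - t *\<^sub>R dir s - t *\<^sub>R dir (s + pi / 2)"
  define R where "R = open_rect s p (2 * t) (2 * t)"
  have norm1: "norm (dir a) = 1" for a
    by (simp add: dir_def norm_vec_def L2_set_def sum_2)
  have "0 < 2 * t" using t by simp
  then have "R \<in> rects s" unfolding R_def rects_def by blast
  moreover have "x \<in> R"
    unfolding R_def open_rect_def p_def
    using t by (intro CollectI exI[of _ t]) (auto simp: algebra_simps)
  moreover have "diameter R \<le> 2 * (2 * t) + 0"
  proof (rule diameter_le)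
    show "R \<noteq> {} \<or> 0 \<le> 2 * (2 * t) + 0" using t by simp
    fix y z assume "y \<in> R" "z \<in> R"
    then obtain u v u' v' where
      y: "y = p + u *\<^sub>R dir s + v *\<^sub>R dir (s + pi / 2)" and
      z: "z = p + u' *\<^sub>R dir s + v' *\<^sub>R dir (s + pi / 2)" and
      b: "0 < u" "u < 2 * t" "0 < v" "v < 2 * t" "0 < u'" "u' < 2 * t" "0 < v'" "v' < 2 * t"
      unfolding R_def open_rect_def by blast
    have "norm (y - z) = norm ((u - u') *\<^sub>R dir s + (v - v') *\<^sub>R dir (s + pi / 2))"
      unfolding y z by (simp add: algebra_simps)
    also have "\<dots> \<le> \<bar>u - u'\<bar> + \<bar>v - v'\<bar>"
      by (rule order_trans[OF norm_triangle_ineq]) (simp add: norm1)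
    finally show "norm (y - z) \<le> 2 * (2 * t) + 0" using b by linarith
  qed
  moreover have "diameter R \<ge> 0"
  proof (rule diameter_ge_0)
    show "bounded R"
      unfolding bounded_iff
    proof (intro exI ballI)
      fix y assume "y \<in> R"
      then obtain u v where y: "y = p + (u *\<^sub>R dir s + v *\<^sub>R dir (s + pi / 2))"
        and b: "0 < u" "u < 2 * t" "0 < v" "v < 2 * t"
        unfolding R_def open_rect_def by (auto simp: add.assoc)
      have "norm y \<le> norm p + norm (u *\<^sub>R dir s + v *\<^sub>R dir (s + pi / 2))"
        unfolding y by (rule norm_triangle_ineq)
      also have "norm (u *\<^sub>R dir s + v *\<^sub>R dir (s + pi / 2)) \<le> \<bar>u\<bar> + \<bar>v\<bar>"
        by (rule order_trans[OF norm_triangle_ineq]) (simp add: norm1)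
      finally show "norm y \<le> norm p + 4 * t" using b by linarith
    qed
  qed
  ultimately show False
    using imp[of R] t by (auto simp: t_def)
qed

end

theory Submission
  imports Defs
begin

text \<open>
For fixed bounds, the pairs of a slope \<open>s\<close> and a point lying in a small rectangle of slope \<open>s\<close> over which
\<open>f\<close> has a large average form an open set. Hence the slopes for which these points fill more than half
of the unit disc form an open set, and a bad set \<open>S\<close> is the intersection of countably many such sets.

For the converse it suffices to construct, for a short arc of slopes \<open>I\<close> inside a larger arc \<open>J\<close>, a
function \<open>F \<ge> 0\<close> of small integral whose averages are huge on most of a large disc for slopes in \<open>I\<close>
and are small off a small set for slopes outside \<open>J\<close>; such functions for a locally finite cover of each
\<open>G k\<close> are summed with the help of the Borel-Cantelli lemma. The function \<open>F\<close> is made of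
``Venetian blinds'': mass is put on the graph of the sawtooth \<open>\<xi> x = (\<Sum>j=1..n. 4 / n * frac (2 ^ j * x) / 2 ^ j)\<close>,
whose approximation of generation \<open>k\<close> has slope \<open>4 * k / n\<close>. In oblique coordinates adapted to \<open>I\<close>, a line
with slope outside \<open>J\<close> crosses the graph transversally and only once, so averages in such directions are
dominated by averages over discs, for which the weak type (1,1) inequality holds. A line with slope in \<open>I\<close> is almost
parallel to the teeth of some generation; at height \<open>z\<close> above the graph, disjoint
rectangles through the teeth of a suitable coarser generation cover a proportion of about \<open>1 / z\<close>, with averages bounded below.
Integrating over \<open>1 \<le> z \<le> n / 4\<close> gains a factor \<open>ln n\<close>, which makes the required mass as small as
desired. Finely rescaled periodic copies behave like independent events and so fill the disc.
\<close>

section \<open>Rectangles\<close>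

text \<open>The count behind the logarithm: one layer has mean density \<open>1 / n\<close>, since
  its cells have area \<open>n * d\<close> and carry mass \<open>d\<close>, but it is heavy on a
  fraction of order (ln n) / n of each cell. Filling a disc up to a fixed error takes about n / ln n
  layers, of total mass of order 1 / ln n; the level of the averages and the errors are fixed
  beforehand and \<open>n\<close> is chosen last. For slopes outside the outer arc the comparison of
  a rectangle with a disc is linear in the density, with a constant independent of \<open>n\<close>
  and of the scales. So the weak type inequality is applied once to the sum of all layers, and
  exceptional sets of the layers never add up. Three obstacles shape the rest. One function must
  serve all slopes of an arc, which the tube lemma reduces to finitely many compact sets. A
  rectangle of slope \<open>s\<close> has sides along \<open>s\<close> and
  \<open>s + pi / 2\<close>, so arcs must be avoided modulo \<open>pi / 2\<close>. A slope outside
  \<open>S\<close> can still lie in finitely many outer arcs, where no small averages are available;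
  there each block is harmless because it is continuous almost everywhere.\<close>

lemma norm_dir [simp]: "norm (dir s) = 1"
  by (simp add: dir_def norm_vec_def L2_set_def sum_2)

lemma inner_dir_dir: "dir s \<bullet> dir t = cos (s - t)"
  by (simp add: dir_def inner_vec_def sum_2 cos_diff)

lemma inner_dir_perp: "dir t \<bullet> dir (s + pi / 2) = sin (t - s)"
  by (simp add: inner_dir_dir flip: sin_cos_eq) (simp add: cos_diff sin_diff cos_add sin_add)

lemma dir_add_pi: "dir (s + pi) = - dir s"
  by (simp add: dir_def vec_eq_iff forall_2)

lemma dir_decomp: "x = (x \<bullet> dir s) *\<^sub>R dir s + (x \<bullet> dir (s + pi / 2)) *\<^sub>R dir (s + pi / 2)"
proof -
  have "cos s * (cos s * y) + sin s * (sin s * y) = y" for y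
    using sin_cos_squared_add3[of s] by (metis (no_types) distrib_right mult.assoc mult_1)
  note * = this[of "x $ 1"] this[of "x $ 2"]
  show ?thesis
    by (simp add: dir_def vec_eq_iff forall_2 inner_vec_def sum_2 cos_add sin_add algebra_simps) (use * in argo)
qed

lemma mem_open_rect_iff:
  "x \<in> open_rect s p a b \<longleftrightarrow>
     0 < (x - p) \<bullet> dir s \<and> (x - p) \<bullet> dir s < a \<and>
     0 < (x - p) \<bullet> dir (s + pi / 2) \<and> (x - p) \<bullet> dir (s + pi / 2) < b"
proof
  assume "x \<in> open_rect s p a b"
  then obtain u v where x: "x = p + u *\<^sub>R dir s + v *\<^sub>R dir (s + pi / 2)"
    and b: "0 < u" "u < a" "0 < v" "v < b"
    unfolding open_rect_def by blast
  have "(x - p) \<bullet> dir s = u" "(x - p) \<bullet> dir (s + pi / 2) = v"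
    by (simp_all add: x inner_add_left inner_dir_dir)
  then show "0 < (x - p) \<bullet> dir s \<and> (x - p) \<bullet> dir s < a \<and>
     0 < (x - p) \<bullet> dir (s + pi / 2) \<and> (x - p) \<bullet> dir (s + pi / 2) < b"
    using b by simp
next
  assume *: "0 < (x - p) \<bullet> dir s \<and> (x - p) \<bullet> dir s < a \<and>
     0 < (x - p) \<bullet> dir (s + pi / 2) \<and> (x - p) \<bullet> dir (s + pi / 2) < b"
  have "x = p + ((x - p) \<bullet> dir s) *\<^sub>R dir s + ((x - p) \<bullet> dir (s + pi / 2)) *\<^sub>R dir (s + pi / 2)"
    using dir_decomp[of "x - p" s] by (simp add: algebra_simps)
  then show "x \<in> open_rect s p a b"
    unfolding open_rect_def using * by blast
qed

lemma continuous_dir [continuous_intros]: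
  fixes f :: "'a::t2_space \<Rightarrow> real"
  assumes "continuous_on A f" shows "continuous_on A (\<lambda>x. dir (f x))"
proof -
  have eq: "dir t = cos t *\<^sub>R axis 1 1 + sin t *\<^sub>R axis 2 1" for t
    by (simp add: dir_def vec_eq_iff forall_2 axis_def)
  show ?thesis unfolding eq
    by (intro continuous_on_add continuous_on_scaleR continuous_on_const continuous_on_cos continuous_on_sin assms)
qed

lemma open_open_rect: "open (open_rect s p a b)"
proof -
  have "open_rect s p a b = {x. 0 < (x - p) \<bullet> dir s} \<inter> {x. (x - p) \<bullet> dir s < a} \<inter>
     {x. 0 < (x - p) \<bullet> dir (s + pi / 2)} \<inter> {x. (x - p) \<bullet> dir (s + pi / 2) < b}"
    by (auto simp: mem_open_rect_iff)
  then show ?thesis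
    by (simp only:) (intro open_Int open_Collect_less continuous_intros)
qed

lemma open_rect_borel [measurable, simp]: "open_rect s p a b \<in> sets borel"
  by (simp add: open_open_rect)

lemma open_rect_lebesgue [measurable, simp]: "open_rect s p a b \<in> sets lebesgue"
  by (simp add: open_open_rect)

lemma norm_le_dir_coords: "norm x \<le> \<bar>x \<bullet> dir s\<bar> + \<bar>x \<bullet> dir (s + pi / 2)\<bar>"
  by (subst dir_decomp[of x s]) (rule order_trans[OF norm_triangle_ineq], simp)

lemma abs_inner_dir_le: "\<bar>x \<bullet> dir s\<bar> \<le> norm x"
  using Cauchy_Schwarz_ineq2[of x "dir s"] by simp

lemma dist_open_rect_less:
  assumes "x \<in> open_rect s p a b" "y \<in> open_rect s p a b"
  shows "dist x y < a + b"
proof -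
  have "norm (x - y) \<le> \<bar>(x - y) \<bullet> dir s\<bar> + \<bar>(x - y) \<bullet> dir (s + pi / 2)\<bar>"
    by (rule norm_le_dir_coords)
  also have "(x - y) \<bullet> dir s = (x - p) \<bullet> dir s - (y - p) \<bullet> dir s" by (simp add: inner_diff_left)
  also have "(x - y) \<bullet> dir (s + pi / 2) = (x - p) \<bullet> dir (s + pi / 2) - (y - p) \<bullet> dir (s + pi / 2)"
    by (simp add: inner_diff_left)
  finally show ?thesis
    using assms unfolding mem_open_rect_iff dist_norm by linarith
qed

lemma bounded_open_rect: "bounded (open_rect s p a b)"
proof (cases "open_rect s p a b = {}")
  case False
  then obtain x where "x \<in> open_rect s p a b" by blast
  then show ?thesis
    unfolding bounded_def using dist_open_rect_less less_imp_le by blast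
qed simp

lemma open_rect_lmeasurable: "open_rect s p a b \<in> lmeasurable"
  by (simp add: lmeasurable_open bounded_open_rect open_open_rect)

lemma mem_open_rect_coords:
  "p + u *\<^sub>R dir s + v *\<^sub>R dir (s + pi / 2) \<in> open_rect s p a b \<longleftrightarrow> 0 < u \<and> u < a \<and> 0 < v \<and> v < b"
  by (simp add: mem_open_rect_iff inner_add_left inner_dir_dir)

lemma sides_le_diameter:
  assumes "0 < a" "0 < b"
  shows "a \<le> diameter (open_rect s p a b)" "b \<le> diameter (open_rect s p a b)"
proof -
  show "a \<le> diameter (open_rect s p a b)"
  proof (rule dense_le)
    fix t assume t: "t < a"
    define e where "e = min (a/3) ((a - t) / 2)"
    have e: "0 < e" "e \<le> a/3" "2 * e \<le> a - t" using assms t unfolding e_def min_def by (auto split: if_splits)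
    have "p + e *\<^sub>R dir s + (b/2) *\<^sub>R dir (s + pi / 2) \<in> open_rect s p a b" (is "?x \<in> _")
      unfolding mem_open_rect_coords using e assms by linarith
    moreover have "p + (a - e) *\<^sub>R dir s + (b/2) *\<^sub>R dir (s + pi / 2) \<in> open_rect s p a b" (is "?y \<in> _")
      unfolding mem_open_rect_coords using e assms by linarith
    moreover have "dist ?y ?x = norm ((a - e - e) *\<^sub>R dir s)"
      unfolding dist_norm by (rule arg_cong[where f = norm]) (simp add: vec_eq_iff algebra_simps)
    moreover have "\<dots> = a - e - e" using e assms by simp
    ultimately show "t \<le> diameter (open_rect s p a b)"
      using diameter_bounded_bound[OF bounded_open_rect, of ?y s p a b ?x] e by linarith
  qed
  show "b \<le> diameter (open_rect s p a b)"
  proof (rule dense_le)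
    fix t assume t: "t < b"
    define e where "e = min (b/3) ((b - t) / 2)"
    have e: "0 < e" "e \<le> b/3" "2 * e \<le> b - t" using assms t unfolding e_def min_def by (auto split: if_splits)
    have "p + (a/2) *\<^sub>R dir s + e *\<^sub>R dir (s + pi / 2) \<in> open_rect s p a b" (is "?x \<in> _")
      unfolding mem_open_rect_coords using e assms by linarith
    moreover have "p + (a/2) *\<^sub>R dir s + (b - e) *\<^sub>R dir (s + pi / 2) \<in> open_rect s p a b" (is "?y \<in> _")
      unfolding mem_open_rect_coords using e assms by linarith
    moreover have "dist ?y ?x = norm ((b - e - e) *\<^sub>R dir (s + pi / 2))"
      unfolding dist_norm by (rule arg_cong[where f = norm]) (simp add: vec_eq_iff algebra_simps)
    moreover have "\<dots> = b - e - e" using e assms by simp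
    ultimately show "t \<le> diameter (open_rect s p a b)"
      using diameter_bounded_bound[OF bounded_open_rect, of ?y s p a b ?x] e by linarith
  qed
qed

lemma diameter_open_rect_le:
  assumes "0 < a" "0 < b"
  shows "diameter (open_rect s p a b) \<le> a + b"
  by (rule diameter_le) (use assms dist_open_rect_less[of _ s p a b] in \<open>auto simp: dist_norm less_imp_le\<close>)

text \<open>The diameter lies between the longer side and the sum of the sides, so
  \<open>a + b\<close> describes the same filter. From here on the size of a rectangle is measured
  by \<open>a + b\<close> and diameters disappear.\<close>

lemma eventually_shrinking_rects:
  "eventually P (shrinking_rects s x) \<longleftrightarrow>
     (\<exists>e>0. \<forall>p a b. 0 < a \<longrightarrow> 0 < b \<longrightarrow> a + b < e \<longrightarrow> x \<in> open_rect s p a b \<longrightarrow> P (open_rect s p a b))"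
  (is "?L \<longleftrightarrow> ?R")
proof
  assume ?L
  then have "eventually (\<lambda>R. R \<in> {R \<in> rects s. x \<in> R} \<longrightarrow> P R) (filtercomap diameter (nhds 0))"
    by (simp add: shrinking_rects_def eventually_inf_principal)
  then obtain e where e: "e > 0"
    and imp: "\<And>R :: (real^2) set. \<bar>diameter R\<bar> < e \<Longrightarrow> R \<in> rects s \<Longrightarrow> x \<in> R \<Longrightarrow> P R"
    unfolding eventually_filtercomap eventually_nhds_metric dist_real_def
    by (metis (no_types, lifting) diff_0_right mem_Collect_eq)
  show ?R
  proof (intro exI[of _ e] conjI allI impI)
    fix p a b assume *: "0 < a" "0 < b" "a + b < e" "x \<in> open_rect s p a b"
    show "P (open_rect s p a b)"
    proof (rule imp)
      show "\<bar>diameter (open_rect s p a b)\<bar> < e"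
        using diameter_open_rect_le[of a b s p] sides_le_diameter[of a b s p] * by linarith
    qed (use * in \<open>auto simp: rects_def\<close>)
  qed (rule e)
next
  assume ?R
  then obtain e where e: "e > 0" and
    imp: "\<And>p a b. 0 < a \<Longrightarrow> 0 < b \<Longrightarrow> a + b < e \<Longrightarrow> x \<in> open_rect s p a b \<Longrightarrow> P (open_rect s p a b)"
    by blast
  \<comment> \<open>Each of the two sides is at most the diameter, hence half of
    \<open>e\<close>.\<close>
  have "P R" if R: "R \<in> rects s" "x \<in> R" "\<bar>diameter R\<bar> < e/2" for R
  proof -
    obtain p a b where *: "R = open_rect s p a b" "0 < a" "0 < b" using R unfolding rects_def by blast
    have "a + b < e" using sides_le_diameter[OF *(2,3), of s p] R(3) unfolding *(1) by linarith
    then show ?thesis using imp * R by blast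
  qed
  moreover have "eventually (\<lambda>d::real. \<bar>d\<bar> < e/2) (nhds 0)"
    using e unfolding eventually_nhds_metric dist_real_def by (intro exI[of _ "e/2"]) auto
  ultimately show ?L
    unfolding shrinking_rects_def eventually_inf_principal eventually_filtercomap by blast
qed

text \<open>A quantitative form of a large upper derivative, with scale \<open>e\<close> and level
  \<open>l\<close> explicit. Only strict inequalities occur, so that the condition is open in the
  pair of slope and point.\<close>

definition heavy :: "(real ^ 2 \<Rightarrow> real) \<Rightarrow> real \<Rightarrow> real \<Rightarrow> real \<Rightarrow> real ^ 2 \<Rightarrow> bool" where
  "heavy f e l s x \<longleftrightarrow>
     (\<exists>p a b. 0 < a \<and> 0 < b \<and> a + b < e \<and> x \<in> open_rect s p a b \<and> l < average f (open_rect s p a b))"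

lemma heavy_mono: "heavy f e l s x \<Longrightarrow> e \<le> e' \<Longrightarrow> l' \<le> l \<Longrightarrow> heavy f e' l' s x"
  unfolding heavy_def by (meson less_le_trans le_less_trans)

text \<open>One index can govern both scale and level because \<open>heavy\<close> is monotone in
  both. This turns the infinite upper derivative into a countable decreasing intersection.\<close>

lemma upper_derivative_eq_PInf_iff:
  "upper_derivative s f x = \<infinity> \<longleftrightarrow> (\<forall>n::nat. heavy f (1 / Suc n) n s x)"
proof
  assume inf: "upper_derivative s f x = \<infinity>"
  show "\<forall>n::nat. heavy f (1 / Suc n) n s x"
  proof (rule ccontr)
    assume "\<not> ?thesis"
    then obtain n :: nat where n: "\<not> heavy f (1 / Suc n) n s x" by blast
    have "eventually (\<lambda>R. ereal (average f R) \<le> ereal n) (shrinking_rects s x)"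
      unfolding eventually_shrinking_rects ereal_less_eq
      by (intro exI[of _ "1 / Suc n"] conjI) (use n in \<open>simp, meson heavy_def not_le\<close>)
    then have "upper_derivative s f x \<le> ereal n"
      unfolding upper_derivative_def by (rule Limsup_bounded)
    with inf show False by simp
  qed
next
  assume h: "\<forall>n::nat. heavy f (1 / Suc n) n s x"
  show "upper_derivative s f x = \<infinity>"
  proof (rule ccontr)
    assume ni: "upper_derivative s f x \<noteq> \<infinity>"
    then obtain n :: nat where "upper_derivative s f x < ereal n"
      using less_PInf_Ex_of_nat[of "upper_derivative s f x"] by auto
    then have "eventually (\<lambda>R. ereal (average f R) < ereal n) (shrinking_rects s x)"
      unfolding upper_derivative_def by (rule Limsup_lessD)
    then obtain e where e: "e > 0" and imp: "\<And>p a b. 0 < a \<Longrightarrow> 0 < b \<Longrightarrow> a + b < e \<Longrightarrow>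
        x \<in> open_rect s p a b \<Longrightarrow> average f (open_rect s p a b) < n"
      unfolding eventually_shrinking_rects by auto
    obtain k :: nat where k: "1 / Suc k < e" using e nat_approx_posE by blast
    have "heavy f (1 / Suc (max n k)) (max n k) s x" using h by blast
    moreover have "1 / Suc (max n k) \<le> 1 / Suc k" by (simp add: frac_le)
    then have "1 / Suc (max n k) \<le> e" using k by linarith
    ultimately have "heavy f e n s x"
      by (rule heavy_mono) simp
    then show False unfolding heavy_def using imp by force
  qed
qed

section \<open>Linear coordinates and rectangles\<close>

definition vec2 :: "real \<times> real \<Rightarrow> real ^ 2" where
  "vec2 z = vector [fst z, snd z]"

lemma vec2_nth [simp]: "vec2 z $ 1 = fst z" "vec2 z $ 2 = snd z"
  by (simp_all add: vec2_def)

lemma Basis_real2: "(Basis :: (real ^ 2) set) = {axis 1 1, axis 2 1}"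
  by (auto simp: Basis_vec_def) (metis exhaust_2)

lemma prod_Basis_real2: "(\<Prod>b\<in>Basis. f b) = f (axis 1 1 :: real ^ 2) * f (axis 2 1)"
  by (simp add: Basis_real2 axis_eq_axis)

lemma measurable_vec2 [measurable]: "vec2 \<in> borel_measurable (lborel \<Otimes>\<^sub>M lborel)"
proof -
  have eq: "vec2 = (\<lambda>z. fst z *\<^sub>R axis 1 1 + snd z *\<^sub>R axis 2 1)"
    by (auto simp: fun_eq_iff vec_eq_iff forall_2 axis_def)
  show ?thesis unfolding eq by measurable
qed

lemma distr_vec2: "distr (lborel \<Otimes>\<^sub>M lborel) borel vec2 = lborel"
proof (rule lborel_eqI[symmetric])
  fix l u :: "real ^ 2" assume le: "\<And>b. b \<in> Basis \<Longrightarrow> l \<bullet> b \<le> u \<bullet> b"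
  have "vec2 -` box l u = {l $ 1<..<u $ 1} \<times> {l $ 2<..<u $ 2}"
    by (auto simp: box_def Basis_real2 inner_axis)
  moreover have "l $ 1 \<le> u $ 1" "l $ 2 \<le> u $ 2"
    using le[of "axis 1 1"] le[of "axis 2 1"] by (auto simp: Basis_real2 inner_axis)
  ultimately show "emeasure (distr (lborel \<Otimes>\<^sub>M lborel) borel vec2) (box l u) = (\<Prod>b\<in>Basis. (u - l) \<bullet> b)"
    by (simp add: emeasure_distr lborel.emeasure_pair_measure_Times space_pair_measure prod_Basis_real2 inner_axis
        ennreal_mult)
qed simp

definition det2 :: "real ^ 2 \<Rightarrow> real ^ 2 \<Rightarrow> real" where
  "det2 a b = a $ 1 * b $ 2 - a $ 2 * b $ 1"

lemma abs_det2_le: "\<bar>det2 p q\<bar> \<le> 2 * (norm p * norm q)"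
proof -
  have "\<bar>det2 p q\<bar> \<le> \<bar>p $ 1\<bar> * \<bar>q $ 2\<bar> + \<bar>p $ 2\<bar> * \<bar>q $ 1\<bar>"
    unfolding det2_def by (metis abs_mult abs_triangle_ineq4)
  also have "\<dots> \<le> norm p * norm q + norm p * norm q"
    by (intro add_mono mult_mono component_le_norm_cart) auto
  finally show ?thesis by simp
qed

text \<open>Tonelli in oblique coordinates. The linear map taking the unit vectors to
  \<open>b1\<close> and \<open>b2\<close> scales areas by the determinant; this is checked on boxes,
  which determine \<open>lborel\<close>.\<close>

lemma nn_integral_coords:
  fixes b1 b2 :: "real ^ 2" and g :: "real ^ 2 \<Rightarrow> ennreal"
  assumes d: "det2 b1 b2 \<noteq> 0" and g: "g \<in> borel_measurable borel"
  shows "(\<integral>\<^sup>+p. g p \<partial>lborel) =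
    ennreal \<bar>det2 b1 b2\<bar> * (\<integral>\<^sup>+x. \<integral>\<^sup>+z. g (x *\<^sub>R b1 + z *\<^sub>R b2) \<partial>lborel \<partial>lborel)"
proof -
  define T where "T = (\<lambda>p :: real ^ 2. p $ 1 *\<^sub>R b1 + p $ 2 *\<^sub>R b2)"
  have lin: "linear T"
    by (rule linearI) (simp_all add: T_def algebra_simps)
  have mT: "T \<in> borel_measurable borel"
    using lin by (intro borel_measurable_continuous_onI linear_continuous_on) (simp add: linear_conv_bounded_linear)
  have detT: "det (matrix T) = det2 b1 b2"
    by (simp add: det_2 matrix_def T_def axis_def det2_def)
  \<comment> \<open>The inverse of \<open>T\<close>, given by Cramer's rule.\<close>
  define T' where "T' = (\<lambda>q :: real ^ 2. (det2 q b2 / det2 b1 b2) *\<^sub>R (axis 1 1 :: real ^ 2) + (det2 b1 q / det2 b1 b2) *\<^sub>R axis 2 1)"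
  have lin': "linear T'"
    by (rule linearI) (simp_all add: T'_def det2_def algebra_simps add_divide_distrib diff_divide_distrib)
  have inv1: "T' (T x) = x" for x
    using d by (simp add: T'_def T_def vec_eq_iff forall_2 axis_def det2_def divide_simps) (simp add: algebra_simps)
  have inv2: "T (T' x) = x" for x
    using d by (simp add: T'_def T_def vec_eq_iff forall_2 axis_def det2_def divide_simps) (simp add: algebra_simps)
  have lb: "lborel = density (distr lborel borel T) (\<lambda>_. ennreal \<bar>det2 b1 b2\<bar>)"
  proof (rule lborel_eqI)
    fix l u :: "real ^ 2" assume le: "\<And>b. b \<in> Basis \<Longrightarrow> l \<bullet> b \<le> u \<bullet> b"
    have S: "T -` box l u = T' ` box l u" using inv1 inv2 by (auto simp: image_iff) metis
    have S2: "T' ` box l u \<in> lmeasurable" by (rule measurable_linear_image[OF lin']) simp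
    have TS: "T ` T' ` box l u = box l u" by (simp add: image_image inv2)
    have "measure lebesgue (box l u) = \<bar>det2 b1 b2\<bar> * measure lebesgue (T -` box l u)"
      using measure_linear_image[OF lin S2] unfolding TS S detT .
    moreover have bm: "T -` box l u \<in> sets borel" using mT by (metis borel_open measurable_sets_borel open_box)
    moreover have "emeasure lborel (T -` box l u) = ennreal (measure lebesgue (T -` box l u))"
    proof -
      have "emeasure lborel (T -` box l u) = emeasure lebesgue (T -` box l u)" using bm by simp
      also have "\<dots> = ennreal (measure lebesgue (T -` box l u))"
        unfolding S using S2 by (rule emeasure_eq_measure2)
      finally show ?thesis .
    qed
    ultimately show "emeasure (density (distr lborel borel T) (\<lambda>_. ennreal \<bar>det2 b1 b2\<bar>)) (box l u)
        = ennreal (\<Prod>b\<in>Basis. (u - l) \<bullet> b)"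
      using mT le
      by (simp add: emeasure_density nn_integral_cmult_indicator emeasure_distr  flip: ennreal_mult'')
  qed simp
  have "(\<integral>\<^sup>+p. g p \<partial>lborel) = (\<integral>\<^sup>+p. ennreal \<bar>det2 b1 b2\<bar> * g (T p) \<partial>lborel)"
    by (subst lb) (use g mT in \<open>simp add: nn_integral_density nn_integral_distr\<close>)
  also have "\<dots> = ennreal \<bar>det2 b1 b2\<bar> * (\<integral>\<^sup>+p. g (T p) \<partial>lborel)"
    using g mT by (intro nn_integral_cmult) simp
  also have "(\<integral>\<^sup>+p. g (T p) \<partial>lborel) = (\<integral>\<^sup>+p. g (T p) \<partial>distr (lborel \<Otimes>\<^sub>M lborel) borel vec2)"
    by (simp add: distr_vec2)
  also have "\<dots> = (\<integral>\<^sup>+z. g (T (vec2 z)) \<partial>(lborel \<Otimes>\<^sub>M lborel))"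
    using g mT by (intro nn_integral_distr) simp_all
  also have "\<dots> = (\<integral>\<^sup>+x. \<integral>\<^sup>+z. g (T (vec2 (x, z))) \<partial>lborel \<partial>lborel)"
    using g mT by (intro lborel.nn_integral_fst[symmetric]) simp
  finally show ?thesis by (simp add: T_def)
qed

lemma det2_dir: "det2 (dir s) (dir t) = sin (t - s)"
  by (simp add: det2_def dir_def sin_diff mult.commute)

lemma emeasure_open_rect:
  assumes "0 < a" "0 < b"
  shows "emeasure lborel (open_rect s p a b) = ennreal (a * b)"
proof -
  have d: "det2 (dir s) (dir (s + pi / 2)) = 1" by (simp add: det2_dir)
  have "emeasure lborel (open_rect s p a b) = (\<integral>\<^sup>+x. indicator (open_rect s p a b) x \<partial>lborel)" by simp
  also have "\<dots> = (\<integral>\<^sup>+x. \<integral>\<^sup>+z. indicator (open_rect s p a b) (x *\<^sub>R dir s + z *\<^sub>R dir (s + pi / 2)) \<partial>lborel \<partial>lborel)"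
    by (subst nn_integral_coords[where ?b1.0 = "dir s" and ?b2.0 = "dir (s + pi / 2)"]) (simp_all add: d)
  also have "\<dots> = (\<integral>\<^sup>+x. \<integral>\<^sup>+z. indicator {p \<bullet> dir s<..<p \<bullet> dir s + a} x *
      indicator {p \<bullet> dir (s + pi / 2)<..<p \<bullet> dir (s + pi / 2) + b} z \<partial>lborel \<partial>lborel)"
    by (intro nn_integral_cong)
      (simp add: indicator_def mem_open_rect_iff inner_diff_left inner_add_left inner_dir_dir diff_less_eq add.commute)
  also have "\<dots> = ennreal (a * b)"
    using assms by (simp add: nn_integral_cmult nn_integral_multc ennreal_mult)
  finally show ?thesis .
qed

lemma measure_open_rect:
  assumes "0 < a" "0 < b"
  shows "measure lebesgue (open_rect s p a b) = a * b"
proof -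
  have "emeasure lebesgue (open_rect s p a b) = ennreal (a * b)"
    using emeasure_open_rect[OF assms, of s p] by simp
  then show ?thesis using assms by (simp add: measure_def)
qed

abbreviation mass :: "(real ^ 2) set \<Rightarrow> (real ^ 2 \<Rightarrow> real) \<Rightarrow> ennreal" where
  "mass S f \<equiv> \<integral>\<^sup>+x. indicator S x * ennreal (f x) \<partial>lborel"

text \<open>Finiteness of the mass is not assumed: for an infinite mass both sides take the default
  value 0, of the Bochner integral and of \<open>enn2real\<close>. Hence lower bounds on averages
  later come with a proof that the mass is finite.\<close>

lemma average_eq_nn:
  assumes f: "f \<in> borel_measurable borel" "\<And>x. 0 \<le> f x" and ab: "0 < a" "0 < b"
  shows "average f (open_rect s p a b) =
    enn2real (mass (open_rect s p a b) f) / (a * b)"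
proof -
  have "(LINT y:open_rect s p a b|lebesgue. f y) = (\<integral>y. indicator (open_rect s p a b) y *\<^sub>R f y \<partial>lborel)"
    unfolding set_lebesgue_integral_def using f by (intro integral_completion) simp
  also have "\<dots> = enn2real (\<integral>\<^sup>+y. ennreal (indicator (open_rect s p a b) y *\<^sub>R f y) \<partial>lborel)"
    using f by (intro integral_eq_nn_integral) auto
  also have "(\<integral>\<^sup>+y. ennreal (indicator (open_rect s p a b) y *\<^sub>R f y) \<partial>lborel) =
     (mass (open_rect s p a b) f)"
    by (intro nn_integral_cong) (auto split: split_indicator)
  finally show ?thesis
    unfolding average_def measure_open_rect[OF ab] by simp
qed

section \<open>The set of bad slopes is a countable intersection of open sets\<close>

lemma inner_compact:
  fixes S :: "'a::euclidean_space set"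
  assumes S: "S \<in> sets lebesgue" "bounded S" and e: "e > 0"
  obtains K where "compact K" "K \<subseteq> S" "measure lebesgue S - e < measure lebesgue K"
proof -
  obtain T where T: "closed T" "T \<subseteq> S" "S - T \<in> lmeasurable" "emeasure lebesgue (S - T) < ennreal e"
    using sets_lebesgue_inner_closed[OF S(1) e] .
  have cT: "compact T" using T S bounded_subset compact_eq_bounded_closed by blast
  have Sl: "S \<in> lmeasurable" using S by (rule bounded_set_imp_lmeasurable[rotated])
  have "measure lebesgue (S - T) < e"
    using T(3,4) e by (simp add: emeasure_eq_measure2 ennreal_less_iff)
  moreover have "measure lebesgue (S - T) = measure lebesgue S - measure lebesgue T"
    using T Sl cT by (intro measurable_measure_Diff) auto
  ultimately show ?thesis using that[OF cT T(2)] by linarith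
qed

lemma open_rect_subset_cball:
  assumes "0 < a" "0 < b"
  shows "open_rect s p a b \<subseteq> cball p (a + b)"
proof
  fix x assume "x \<in> open_rect s p a b"
  then show "x \<in> cball p (a + b)"
    using norm_le_dir_coords[of "x - p" s] unfolding mem_open_rect_iff
    by (simp add: dist_norm norm_minus_commute)
qed

lemma AE_not_hyperplane:
  fixes v :: "real ^ 2"
  assumes "v \<noteq> 0"
  shows "AE y in lebesgue. (y - p) \<bullet> v \<noteq> c"
proof -
  have "negligible {y. v \<bullet> y = c + p \<bullet> v}" using assms by (intro negligible_hyperplane) simp
  then have "{y. v \<bullet> y = c + p \<bullet> v} \<in> null_sets lebesgue" by (simp add: negligible_iff_null_sets)
  then show ?thesis
    by (rule AE_I') (auto simp: inner_commute[of _ v] inner_diff_right)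
qed

lemma dir_neq_0: "dir s \<noteq> 0"
  using norm_dir[of s] by (metis norm_zero zero_neq_one)

text \<open>Dominated convergence: for a fixed corner and fixed sides all rotated rectangles lie in
  one ball, and the indicators converge at each point off the four lines that carry the sides of the
  limit rectangle.\<close>

lemma isCont_average:
  assumes f: "\<And>r. set_integrable lebesgue (cball 0 r) f" and ab: "0 < a" "0 < b"
  shows "isCont (\<lambda>s. average f (open_rect s p a b)) s"
proof -
  let ?r = "norm p + (a + b)"
  have sub: "open_rect s p a b \<subseteq> cball 0 ?r" for s
  proof
    fix x assume "x \<in> open_rect s p a b"
    then have "dist p x \<le> a + b" using open_rect_subset_cball[OF ab, of s p] by auto
    then show "x \<in> cball 0 ?r" using norm_triangle_ineq2[of x p] by (simp add: dist_norm norm_minus_commute)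
  qed
  have int: "integrable lebesgue (\<lambda>y. indicator (cball 0 ?r) y *\<^sub>R f y)"
    using f[of ?r] by (simp add: set_integrable_def)
  have eq: "indicator (open_rect t p a b) y *\<^sub>R f y =
      indicator (open_rect t p a b) y *\<^sub>R (indicator (cball 0 ?r) y *\<^sub>R f y)" for t y
    using sub[of t] by (auto split: split_indicator)
  have m: "(\<lambda>y. indicator (open_rect t p a b) y *\<^sub>R f y) \<in> borel_measurable lebesgue" for t
    by (subst eq, intro borel_measurable_scaleR borel_measurable_indicator borel_measurable_integrable[OF int]) simp
  have "((\<lambda>s. LINT y:open_rect s p a b|lebesgue. f y) \<longlongrightarrow> (LINT y:open_rect s p a b|lebesgue. f y)) (at s)"
    unfolding tendsto_at_iff_sequentially comp_def set_lebesgue_integral_def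
  proof (intro allI impI)
    fix X assume "X \<longlonglongrightarrow> s"
    show "(\<lambda>n. LINT y|lebesgue. indicator (open_rect (X n) p a b) y *\<^sub>R f y)
      \<longlonglongrightarrow> (LINT y|lebesgue. indicator (open_rect s p a b) y *\<^sub>R f y)"
    proof (rule integral_dominated_convergence[where w = "\<lambda>y. norm (indicator (cball 0 ?r) y *\<^sub>R f y)"])
      show "integrable lebesgue (\<lambda>y. norm (indicator (cball 0 ?r) y *\<^sub>R f y))"
        using int by (rule integrable_norm)
      show "AE y in lebesgue. norm (indicator (open_rect (X n) p a b) y *\<^sub>R f y) \<le>
          norm (indicator (cball 0 ?r) y *\<^sub>R f y)" for n
        using sub[of "X n"] by (intro AE_I2) (auto split: split_indicator)
      have "AE y in lebesgue. (y - p) \<bullet> dir s \<noteq> 0 \<and> (y - p) \<bullet> dir s \<noteq> a \<and>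
         (y - p) \<bullet> dir (s + pi / 2) \<noteq> 0 \<and> (y - p) \<bullet> dir (s + pi / 2) \<noteq> b"
        using dir_neq_0 by (intro AE_conjI AE_not_hyperplane) auto
      then show "AE y in lebesgue. (\<lambda>n. indicator (open_rect (X n) p a b) y *\<^sub>R f y)
          \<longlonglongrightarrow> indicator (open_rect s p a b) y *\<^sub>R f y"
      proof eventually_elim
        case (elim y)
        have c: "isCont (\<lambda>t. (y - p) \<bullet> dir (t + d)) s" for d
        proof -
          have "continuous_on UNIV (\<lambda>t. (y - p) \<bullet> dir (t + d))" by (intro continuous_intros)
          then show ?thesis by (simp add: continuous_on_eq_continuous_at)
        qed
        have t1: "(\<lambda>n. (y - p) \<bullet> dir (X n)) \<longlonglongrightarrow> (y - p) \<bullet> dir s"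
          using isCont_tendsto_compose[OF c[of 0] \<open>X \<longlonglongrightarrow> s\<close>] by simp
        have t2: "(\<lambda>n. (y - p) \<bullet> dir (X n + pi / 2)) \<longlonglongrightarrow> (y - p) \<bullet> dir (s + pi / 2)"
          by (rule isCont_tendsto_compose[OF c \<open>X \<longlonglongrightarrow> s\<close>])
        have ev: "eventually (\<lambda>n. (0 < Y n \<and> Y n < c) = (0 < l \<and> l < c)) sequentially"
          if "Y \<longlonglongrightarrow> l" "l \<noteq> 0" "l \<noteq> c" for Y and l c :: real
        proof (cases "0 < l \<and> l < c")
          case True
          then have "eventually (\<lambda>n. 0 < Y n \<and> Y n < c) sequentially"
            using order_tendstoD[OF that(1)] by (intro eventually_conj) auto
          then show ?thesis by (rule eventually_mono) (use True in auto)
        next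
          case False
          then have "l < 0 \<or> c < l" using that by linarith
          then have "eventually (\<lambda>n. Y n < 0 \<or> c < Y n) sequentially"
          proof
            assume "l < 0" from order_tendstoD(2)[OF that(1) this] show ?thesis by eventually_elim simp
          next
            assume "c < l" from order_tendstoD(1)[OF that(1) this] show ?thesis by eventually_elim simp
          qed
          then show ?thesis by (rule eventually_mono) (use False in auto)
        qed
        have "eventually (\<lambda>n. indicator (open_rect (X n) p a b) y *\<^sub>R f y = indicator (open_rect s p a b) y *\<^sub>R f y) sequentially"
        proof -
          have "eventually (\<lambda>n. (y \<in> open_rect (X n) p a b) = (y \<in> open_rect s p a b)) sequentially"
          proof -
            have "eventually (\<lambda>n. (0 < (y - p) \<bullet> dir (X n) \<and> (y - p) \<bullet> dir (X n) < a) =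
                (0 < (y - p) \<bullet> dir s \<and> (y - p) \<bullet> dir s < a)) sequentially"
              using ev[OF t1, of a] elim by blast
            moreover have "eventually (\<lambda>n. (0 < (y - p) \<bullet> dir (X n + pi / 2) \<and> (y - p) \<bullet> dir (X n + pi / 2) < b) =
                (0 < (y - p) \<bullet> dir (s + pi / 2) \<and> (y - p) \<bullet> dir (s + pi / 2) < b)) sequentially"
              using ev[OF t2, of b] elim by blast
            ultimately show ?thesis unfolding mem_open_rect_iff by eventually_elim argo
          qed
          then show ?thesis by (rule eventually_mono) (simp add: indicator_def)
        qed
        then show ?case by (rule tendsto_eventually)
      qed
    qed (use m in auto)
  qed
  then show ?thesis
    unfolding isCont_def average_def measure_open_rect[OF ab] using ab by (intro tendsto_divide) auto
qed

text \<open>With the corner and the sides fixed, membership of the point is an open condition and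
  the average is continuous in the slope; the heavy pairs are the union of such open sets over all
  corners and sides.\<close>

lemma open_heavy:
  assumes f: "\<And>r. set_integrable lebesgue (cball 0 r) f"
  shows "open {(s, x). heavy f e l s x}"
proof -
  have eq: "{(s, x). heavy f e l s x} = (\<Union>(p, a, b) \<in> {(p, a, b). 0 < a \<and> 0 < b \<and> a + b < e}.
     {(s, x). x \<in> open_rect s p a b} \<inter> {s. l < average f (open_rect s p a b)} \<times> UNIV)"
    by (auto simp: heavy_def)
  have o1: "open {(s, x). x \<in> open_rect s p a b}" for p a b
  proof -
    have "{(s, x). x \<in> open_rect s p a b} = {z. 0 < (snd z - p) \<bullet> dir (fst z)} \<inter> {z. (snd z - p) \<bullet> dir (fst z) < a} \<inter>
       {z. 0 < (snd z - p) \<bullet> dir (fst z + pi / 2)} \<inter> {z. (snd z - p) \<bullet> dir (fst z + pi / 2) < b}"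
      by (auto simp: mem_open_rect_iff)
    then show ?thesis
      by (simp only:) (intro open_Int open_Collect_less continuous_intros)
  qed
  have o2: "open {s. l < average f (open_rect s p a b)}" if "0 < a" "0 < b" for p a b
    using isCont_average[OF f that]
    by (intro open_Collect_less continuous_intros) (auto simp: continuous_on_eq_continuous_at)
  show ?thesis
    unfolding eq by (intro open_UN) (auto intro!: open_Int o1 open_Times o2)
qed

text \<open>The tube lemma. It serves both directions of the theorem: openness of the sets of slopes
  below, and uniformity over an arc of slopes in \<open>compact_family\<close>.\<close>

lemma heavy_nearby:
  assumes f: "\<And>r. set_integrable lebesgue (cball 0 r) f"
    and K: "compact K" "\<And>x. x \<in> K \<Longrightarrow> heavy f e l s x"
  obtains U where "open U" "s \<in> U" "\<And>t x. t \<in> U \<Longrightarrow> x \<in> K \<Longrightarrow> heavy f e l t x"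
proof -
  have "{s} \<times> K \<subseteq> {(s, x). heavy f e l s x}" using K by auto
  from Elementary_Topology.tube_lemma[OF K(1) open_heavy[OF f] this] obtain U where "s \<in> U" "open U" "U \<times> K \<subseteq> {(s, x). heavy f e l s x}"
    by blast
  then show ?thesis using that[of U] by blast
qed

lemma open_heavy_section:
  assumes f: "\<And>r. set_integrable lebesgue (cball 0 r) f"
  shows "open {x. heavy f e l s x}"
proof -
  have "{x. heavy f e l s x} = Pair s -` {(s, x). heavy f e l s x}" by auto
  then show ?thesis
    by (simp only:) (intro continuous_open_vimage open_heavy f continuous_intros)
qed

lemma integrable_imp_set_integrable_cball:
  "integrable lebesgue f \<Longrightarrow> set_integrable lebesgue (cball 0 r) (f :: real ^ 2 \<Rightarrow> real)"
  unfolding set_integrable_def by (rule integrable_mult_indicator) auto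

text \<open>A dichotomy on the unit ball. For a slope in \<open>S\<close> every \<open>H n s\<close>
  has full measure; for a differentiating slope the decreasing sets \<open>H n s\<close> have a null
  intersection, since almost every point has a finite limit of averages, and so their measures tend
  to 0.\<close>

theorem R_set_imp_gdelta:
  assumes "R_set S"
  shows "\<exists>G :: nat \<Rightarrow> real set. (\<forall>k. open (G k)) \<and> S = (\<Inter>k. G k) \<inter> {0..<pi / 2}"
proof -
  obtain f :: "real ^ 2 \<Rightarrow> real" where f: "integrable lebesgue f"
    and good: "\<And>s. s \<in> {0..<pi / 2} - S \<Longrightarrow> differentiates s f"
    and bad: "\<And>s. s \<in> S \<Longrightarrow> AE x in lebesgue. upper_derivative s f x = \<infinity>"
    and S: "S \<subseteq> {0..<pi / 2}"
    using assms unfolding R_set_def by blast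
  note fb = integrable_imp_set_integrable_cball[OF f]
  define B :: "(real ^ 2) set" where "B = cball 0 1"
  define H where "H = (\<lambda>n s. {x. heavy f (1 / Suc n) n s x} \<inter> B)"
  have Hl: "H n s \<in> lmeasurable" for n s
    unfolding H_def B_def using open_heavy_section[OF fb]
    by (intro bounded_set_imp_lmeasurable) auto
  have B: "B \<in> lmeasurable" "measure lebesgue B > 0"
    unfolding B_def by (auto simp: content_cball_pos)
  define m where "m = measure lebesgue B"
  have Hb: "bounded (H n s)" for n s
    unfolding H_def B_def by (simp add: bounded_Int)
  \<comment> \<open>Any threshold strictly between 0 and \<open>m\<close> separates the two cases.
    Openness follows by replacing \<open>H n s\<close> with a compact subset still above the
    threshold, which stays heavy for nearby slopes.\<close>
  define G where "G = (\<lambda>n. {s. m / 2 < measure lebesgue (H n s)})"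
  have "open (G n)" for n
  proof (subst open_subopen, rule ballI)
    fix s assume "s \<in> G n"
    then have "0 < measure lebesgue (H n s) - m / 2" by (simp add: G_def)
    from inner_compact[OF fmeasurableD[OF Hl[of n s]] Hb this]
    obtain K where K: "compact K" "K \<subseteq> H n s"
      "measure lebesgue (H n s) - (measure lebesgue (H n s) - m / 2) < measure lebesgue K" by blast
    obtain U where U: "open U" "s \<in> U" "\<And>t x. t \<in> U \<Longrightarrow> x \<in> K \<Longrightarrow> heavy f (1 / Suc n) n t x"
      by (rule heavy_nearby[OF fb K(1), of "1 / Suc n" n s]) (use K in \<open>auto simp: H_def\<close>)
    have "U \<subseteq> G n"
    proof
      fix t assume "t \<in> U"
      then have "K \<subseteq> H n t" using U K by (auto simp: H_def)
      then have "measure lebesgue K \<le> measure lebesgue (H n t)"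
        using Hl lmeasurable_compact[OF K(1)] by (intro measure_mono_fmeasurable) auto
      then show "t \<in> G n" using K by (simp add: G_def)
    qed
    then show "\<exists>T. open T \<and> s \<in> T \<and> T \<subseteq> G n" using U by blast
  qed
  moreover have "s \<in> (\<Inter>k. G k)" if "s \<in> S" for s
  proof
    fix n
    have "AE x in lebesgue. x \<in> B \<longleftrightarrow> x \<in> H n s"
      using bad[OF that] by eventually_elim (auto simp: H_def upper_derivative_eq_PInf_iff)
    then have "measure lebesgue B = measure lebesgue (H n s)"
      using B Hl by (intro measure_eq_AE) auto
    then show "s \<in> G n" using B by (simp add: G_def m_def)
  qed
  moreover have "s \<in> S" if s: "s \<in> (\<Inter>k. G k)" "s \<in> {0..<pi / 2}" for s
  proof (rule ccontr)
    assume "s \<notin> S"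
    then have "differentiates s f" using good s by blast
    then have ae: "AE x in lebesgue. x \<notin> (\<Inter>n. H n s)"
      unfolding differentiates_def
    proof eventually_elim
      case (elim x)
      obtain n :: nat where n: "f x + 1 < n" using reals_Archimedean2 by blast
      have "eventually (\<lambda>R. average f R < f x + 1) (shrinking_rects s x)"
        using order_tendstoD(2)[OF elim, of "f x + 1"] by simp
      then obtain e where e: "e > 0" "\<And>p a b. 0 < a \<Longrightarrow> 0 < b \<Longrightarrow> a + b < e \<Longrightarrow>
        x \<in> open_rect s p a b \<Longrightarrow> average f (open_rect s p a b) < f x + 1"
        unfolding eventually_shrinking_rects by auto
      obtain k :: nat where k: "1 / Suc k < e" using e nat_approx_posE by blast
      have le: "1 / Suc (max n k) \<le> e"
        using k by (rule order_trans[rotated, OF less_imp_le]) (simp add: frac_le)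
      have "\<not> heavy f e (f x + 1) s x"
        unfolding heavy_def using e(2) by (meson less_asym)
      moreover have "f x + 1 \<le> real (max n k)" using n by (simp add: of_nat_max)
      ultimately have "\<not> heavy f (1 / Suc (max n k)) (max n k) s x"
        using heavy_mono[of f "1 / Suc (max n k)" "max n k" s x e "f x + 1"] le by blast
      then show ?case unfolding H_def by blast
    qed
    have anti: "H n s \<subseteq> H k s" if "k \<le> n" for n k
      unfolding H_def using heavy_mono[of f "1 / Suc n" n s _ "1 / Suc k" k] that by (auto simp: frac_le)
    have "(\<lambda>n. measure lebesgue (H n s)) \<longlonglongrightarrow> measure lebesgue (\<Inter>n. H n s)"
    proof (rule Lim_measure_decseq)
      show "range (\<lambda>n. H n s) \<subseteq> sets lebesgue" using Hl by (auto dest: fmeasurableD)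
      show "decseq (\<lambda>n. H n s)" using anti by (simp add: decseq_def)
      show "emeasure lebesgue (H n s) \<noteq> \<infinity>" for n using fmeasurableD2[OF Hl] by simp
    qed
    moreover have "measure lebesgue (\<Inter>n. H n s) = measure lebesgue ({} :: (real^2) set)"
      using ae Hl by (intro measure_eq_AE) (auto intro!: sets.countable_INT)
    ultimately have "(\<lambda>n. measure lebesgue (H n s)) \<longlonglongrightarrow> 0" by simp
    then have "m / 2 \<le> 0"
      using s(1) by (intro LIMSEQ_le_const[of _ 0]) (auto simp: G_def intro!: exI[of _ 0] less_imp_le)
    then show False using B by (simp add: m_def)
  qed
  ultimately show ?thesis using S by blast
qed

section \<open>A covering estimate of Hardy-Littlewood type\<close>

text \<open>Vitali covering: disjoint balls with too much mass have a bounded sum of squared radii,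
  and their fivefold enlargements cover all such balls. The constant \<open>25 * pi\<close> is the
  area of a ball of radius 5, and \<open>M\<close> bounds the radii as the covering lemma requires.
  Averages are normalised by the squared radius, without the factor \<open>pi\<close>.\<close>

lemma Hardy_Littlewood_weak:
  fixes F :: "real ^ 2 \<Rightarrow> real"
  assumes F: "F \<in> borel_measurable borel" "\<And>x. 0 \<le> F x" "integrable lborel F"
    and t: "t > 0" and M: "M > 0"
  obtains Z where "Z \<in> lmeasurable" "measure lebesgue Z \<le> 25 * pi * (\<integral>x. F x \<partial>lborel) / t"
    "\<And>x r. 0 < r \<Longrightarrow> r \<le> M \<Longrightarrow> x \<notin> Z \<Longrightarrow> (\<integral>y. indicator (cball x r) y * F y \<partial>lborel) \<le> t * r\<^sup>2"
proof -
  define I where "I = (\<integral>x. F x \<partial>lborel)"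
  define K where "K = {(x, r). 0 < r \<and> r \<le> M \<and> t * r\<^sup>2 < (\<integral>y. indicator (cball x r) y * F y \<partial>lborel)}"
  have K0: "0 < snd i \<and> snd i \<le> M" if "i \<in> K" for i using that by (auto simp: K_def)
  obtain C where C: "countable C" "C \<subseteq> K"
    "pairwise (\<lambda>i j. disjnt (cball (fst i) (snd i)) (cball (fst j) (snd j))) C"
    "(\<Union>i\<in>K. cball (fst i) (snd i)) \<subseteq> (\<Union>i\<in>C. cball (fst i) (5 * snd i))"
    using Vitali_covering_lemma_cballs[where S = "\<Union>i\<in>K. cball (fst i) (snd i)" and K = K and a = fst and r = snd and B = M, OF order_refl K0]
    by blast
  define Z where "Z = (\<Union>i\<in>C. cball (fst i) (5 * snd i))"
  have intF: "integrable lborel (\<lambda>y. indicator A y * F y)" if "A \<in> sets borel" for A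
    using integrable_mult_indicator[OF _ F(3), of A] that by simp
  have fin: "(\<Sum>i\<in>D. (snd i)\<^sup>2) \<le> I / t" if D: "finite D" "D \<subseteq> C" for D
  proof -
    have "t * (\<Sum>i\<in>D. (snd i)\<^sup>2) = (\<Sum>i\<in>D. t * (snd i)\<^sup>2)" by (simp add: sum_distrib_left)
    also have "\<dots> \<le> (\<Sum>i\<in>D. \<integral>y. indicator (cball (fst i) (snd i)) y * F y \<partial>lborel)"
      using D C(2) by (intro sum_mono) (auto simp: K_def)
    also have "\<dots> = (\<integral>y. (\<Sum>i\<in>D. indicator (cball (fst i) (snd i)) y * F y) \<partial>lborel)"
      by (rule Bochner_Integration.integral_sum[symmetric]) (rule intF, simp)
    also have "\<dots> \<le> I"
      unfolding I_def
    proof (rule integral_mono)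
      fix y
      have "(\<Sum>i\<in>D. indicator (cball (fst i) (snd i)) y :: real) = indicator (\<Union>i\<in>D. cball (fst i) (snd i)) y"
      proof (intro indicator_UN_disjoint[symmetric] D(1))
        show "disjoint_family_on (\<lambda>i. cball (fst i) (snd i)) D"
          unfolding disjoint_family_on_def
        proof (intro ballI impI)
          fix i j assume "i \<in> D" "j \<in> D" "i \<noteq> j"
          then show "cball (fst i) (snd i) \<inter> cball (fst j) (snd j) = {}"
            using pairwiseD[OF C(3), of i j] D(2) by (auto simp: disjnt_def)
        qed
      qed
      then show "(\<Sum>i\<in>D. indicator (cball (fst i) (snd i)) y * F y) \<le> F y"
        using F(2)[of y] by (simp add: sum_distrib_right[symmetric] indicator_def)
    qed (auto intro!: intF F(3))
    finally show ?thesis using t by (simp add: field_simps)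
  qed
  have mb: "measure lebesgue (cball (fst i) (5 * snd i) :: (real^2) set) = 25 * pi * (snd i)\<^sup>2" if "i \<in> C" for i
  proof -
    have "0 \<le> 5 * snd i" using that C(2) by (auto simp: K_def)
    then show ?thesis
      by (simp add: content_cball unit_ball_vol_2 power_mult_distrib)
  qed
  have bound: "measure lebesgue (\<Union>i\<in>D. cball (fst i) (5 * snd i)) \<le> 25 * pi * (I / t)" if D: "D \<subseteq> C" "finite D" for D
  proof -
    have "measure lebesgue (\<Union>i\<in>D. cball (fst i) (5 * snd i)) \<le> (\<Sum>i\<in>D. measure lebesgue (cball (fst i) (5 * snd i)))"
      using D by (intro measure_UNION_le) auto
    also have "\<dots> = (\<Sum>i\<in>D. 25 * pi * (snd i)\<^sup>2)" using D mb by (intro sum.cong) auto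
    also have "\<dots> = 25 * pi * (\<Sum>i\<in>D. (snd i)\<^sup>2)" by (simp add: sum_distrib_left)
    also have "\<dots> \<le> 25 * pi * (I / t)" using fin[OF D(2,1)] by (intro mult_left_mono) auto
    finally show ?thesis .
  qed
  have cl: "cball (fst i) (5 * snd i) \<in> lmeasurable" if "i \<in> C" for i by simp
  have Z: "Z \<in> lmeasurable" "measure lebesgue Z \<le> 25 * pi * (I / t)"
    unfolding Z_def
     apply (rule fmeasurable_UN_bound[OF C(1) cl bound]; assumption)
    apply (rule measure_UN_bound[OF C(1) cl bound]; assumption)
    done
  have "(\<integral>y. indicator (cball x r) y * F y \<partial>lborel) \<le> t * r\<^sup>2" if "0 < r" "r \<le> M" "x \<notin> Z" for x r
  proof (rule ccontr)
    assume "\<not> ?thesis"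
    then have "(x, r) \<in> K" using that by (simp add: K_def)
    then have "x \<in> (\<Union>i\<in>K. cball (fst i) (snd i))" using that by force
    then have "x \<in> Z" using C(4) unfolding Z_def by (rule subsetD[rotated])
    then show False using that(3) by contradiction
  qed
  then show ?thesis using that[of Z] Z by (simp add: I_def)
qed

section \<open>Sheared densities\<close>

text \<open>Substituting \<open>z = u + \<xi> x\<close> slices the density into translates of the
  graph of \<open>\<xi>\<close> with weights \<open>\<eta> u\<close>. Masses of sets are then
  compared on one translate at a time, for every profile \<open>\<eta>\<close> at once.\<close>

lemma nn_integral_shear:
  fixes \<xi> \<eta> :: "real \<Rightarrow> real" and S :: "(real ^ 2) set"
  assumes d: "det2 b1 b2 \<noteq> 0" and m: "\<xi> \<in> borel_measurable borel" "\<eta> \<in> borel_measurable borel" "S \<in> sets borel"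
    and X: "\<And>x z. X (x *\<^sub>R b1 + z *\<^sub>R b2) = x" "X \<in> borel_measurable borel"
    and Z: "\<And>x z. Z (x *\<^sub>R b1 + z *\<^sub>R b2) = z" "Z \<in> borel_measurable borel"
  shows "(\<integral>\<^sup>+p. indicator S p * ennreal (\<eta> (Z p - \<xi> (X p))) \<partial>lborel) = ennreal \<bar>det2 b1 b2\<bar> *
     (\<integral>\<^sup>+u. ennreal (\<eta> u) * (\<integral>\<^sup>+x. indicator S (x *\<^sub>R b1 + (u + \<xi> x) *\<^sub>R b2) \<partial>lborel) \<partial>lborel)"
proof -
  note [measurable] = m X(2) Z(2)
  have "(\<integral>\<^sup>+p. indicator S p * ennreal (\<eta> (Z p - \<xi> (X p))) \<partial>lborel) = ennreal \<bar>det2 b1 b2\<bar> *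
     (\<integral>\<^sup>+x. \<integral>\<^sup>+z. indicator S (x *\<^sub>R b1 + z *\<^sub>R b2) * ennreal (\<eta> (z - \<xi> x)) \<partial>lborel \<partial>lborel)"
    by (subst nn_integral_coords[OF d]) (simp_all add: X Z)
  also have "(\<integral>\<^sup>+x. \<integral>\<^sup>+z. indicator S (x *\<^sub>R b1 + z *\<^sub>R b2) * ennreal (\<eta> (z - \<xi> x)) \<partial>lborel \<partial>lborel) =
     (\<integral>\<^sup>+x. \<integral>\<^sup>+u. indicator S (x *\<^sub>R b1 + (u + \<xi> x) *\<^sub>R b2) * ennreal (\<eta> u) \<partial>lborel \<partial>lborel)"
  proof (rule nn_integral_cong)
    fix x
    have "(\<integral>\<^sup>+z. indicator S (x *\<^sub>R b1 + z *\<^sub>R b2) * ennreal (\<eta> (z - \<xi> x)) \<partial>lborel) =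
      ennreal \<bar>1\<bar> * (\<integral>\<^sup>+u. indicator S (x *\<^sub>R b1 + (\<xi> x + 1 * u) *\<^sub>R b2) * ennreal (\<eta> ((\<xi> x + 1 * u) - \<xi> x)) \<partial>lborel)"
      by (rule nn_integral_real_affine) simp_all
    then show "(\<integral>\<^sup>+z. indicator S (x *\<^sub>R b1 + z *\<^sub>R b2) * ennreal (\<eta> (z - \<xi> x)) \<partial>lborel) =
      (\<integral>\<^sup>+u. indicator S (x *\<^sub>R b1 + (u + \<xi> x) *\<^sub>R b2) * ennreal (\<eta> u) \<partial>lborel)"
      by (simp add: add.commute)
  qed
  also have "\<dots> = (\<integral>\<^sup>+u. \<integral>\<^sup>+x. indicator S (x *\<^sub>R b1 + (u + \<xi> x) *\<^sub>R b2) * ennreal (\<eta> u) \<partial>lborel \<partial>lborel)"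
    by (rule lborel_pair.Fubini'[symmetric]) measurable
  also have "\<dots> = (\<integral>\<^sup>+u. ennreal (\<eta> u) * (\<integral>\<^sup>+x. indicator S (x *\<^sub>R b1 + (u + \<xi> x) *\<^sub>R b2) \<partial>lborel) \<partial>lborel)"
    by (intro nn_integral_cong) (subst nn_integral_multc, simp_all add: mult.commute)
  finally show ?thesis .
qed

text \<open>On each translate of the graph, \<open>v\<close> measures the narrow direction of
  \<open>R\<close>, and \<open>v\<close> falls at rate at least \<open>\<sigma>\<close> as
  \<open>x\<close> grows; the translate thus meets \<open>R\<close> only for \<open>x\<close> in an
  interval of length \<open>2 * w / \<sigma>\<close>. If it meets \<open>R\<close> at all, it stays
  in \<open>B\<close> for a set of \<open>x\<close> of measure \<open>l / 2\<close>. The quotient of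
  these lengths is the constant.\<close>

lemma sheared_mass_le:
  fixes \<xi> \<eta> :: "real \<Rightarrow> real" and R B :: "(real ^ 2) set"
  assumes d: "det2 b1 b2 \<noteq> 0" and m: "\<xi> \<in> borel_measurable borel" "\<eta> \<in> borel_measurable borel"
    and RB: "R \<in> sets borel" "B \<in> sets borel"
    and X: "\<And>x z. X (x *\<^sub>R b1 + z *\<^sub>R b2) = x" "X \<in> borel_measurable borel"
    and Z: "\<And>x z. Z (x *\<^sub>R b1 + z *\<^sub>R b2) = z" "Z \<in> borel_measurable borel"
    and osc: "\<And>x0 l. 0 < l \<Longrightarrow> \<exists>Y \<in> sets borel. Y \<subseteq> {x0 - l..x0 + l} \<and> ennreal (l / 2) \<le> emeasure lborel Y \<and> (\<forall>x\<in>Y. \<bar>\<xi> x - \<xi> x0\<bar> \<le> 10 * l)"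
    and mono: "\<And>x y. x \<le> y \<Longrightarrow> 4 * x - \<xi> x \<le> 4 * y - \<xi> y"
    and v: "0 \<le> v \<bullet> b2" "\<sigma> \<le> - (v \<bullet> (b1 + 4 *\<^sub>R b2))" "0 < \<sigma>"
    and w: "\<And>p q. p \<in> R \<Longrightarrow> q \<in> R \<Longrightarrow> v \<bullet> (p - q) \<le> w"
    and l: "0 < l" and B: "\<And>p dx dz. p \<in> R \<Longrightarrow> \<bar>dx\<bar> \<le> l \<Longrightarrow> \<bar>dz\<bar> \<le> 10 * l \<Longrightarrow> p + dx *\<^sub>R b1 + dz *\<^sub>R b2 \<in> B"
  shows "(\<integral>\<^sup>+p. indicator R p * ennreal (\<eta> (Z p - \<xi> (X p))) \<partial>lborel) \<le>
     ennreal (4 * w / (\<sigma> * l)) * (\<integral>\<^sup>+p. indicator B p * ennreal (\<eta> (Z p - \<xi> (X p))) \<partial>lborel)"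
proof (cases "R = {}")
  case True then show ?thesis by simp
next
  case False
  note [measurable] = m RB X(2) Z(2)
  have w0: "0 \<le> w" using False w by fastforce
  define mR where "mR = (\<lambda>S u. \<integral>\<^sup>+x. indicator S (x *\<^sub>R b1 + (u + \<xi> x) *\<^sub>R b2) \<partial>lborel)"
  \<comment> \<open>A chord of the graph is a nonnegative combination of \<open>b1 + 4 b2\<close>
    and \<open>- b2\<close>; the second coefficient is nonnegative by \<open>mono\<close>. The inner
    product of \<open>v\<close> with the first vector is at most \<open>- \<sigma>\<close>, and with
    the second it is at most 0.\<close>
  have sep: "\<sigma> * (y - x) \<le> v \<bullet> ((x *\<^sub>R b1 + (u + \<xi> x) *\<^sub>R b2) - (y *\<^sub>R b1 + (u + \<xi> y) *\<^sub>R b2))" if "x \<le> y" for x y u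
  proof -
    have "v \<bullet> ((x *\<^sub>R b1 + (u + \<xi> x) *\<^sub>R b2) - (y *\<^sub>R b1 + (u + \<xi> y) *\<^sub>R b2)) =
        (y - x) * - (v \<bullet> (b1 + 4 *\<^sub>R b2)) + ((4 * y - \<xi> y) - (4 * x - \<xi> x)) * (v \<bullet> b2)"
      by (simp add: inner_diff_right inner_add_right algebra_simps)
    moreover have "0 \<le> ((4 * y - \<xi> y) - (4 * x - \<xi> x)) * (v \<bullet> b2)" using mono[OF that] v by simp
    moreover have "(y - x) * \<sigma> \<le> (y - x) * - (v \<bullet> (b1 + 4 *\<^sub>R b2))" using that v by (intro mult_left_mono) auto
    ultimately show ?thesis by (simp add: mult.commute)
  qed
  have key: "mR R u \<le> ennreal (4 * w / (\<sigma> * l)) * mR B u" for u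
  proof (cases "\<exists>x0. x0 *\<^sub>R b1 + (u + \<xi> x0) *\<^sub>R b2 \<in> R")
    case False
    then have "mR R u = (\<integral>\<^sup>+x. 0 \<partial>(lborel :: real measure))"
      unfolding mR_def by (intro nn_integral_cong) auto
    then show ?thesis by simp
  next
    case True
    then obtain x0 where x0: "x0 *\<^sub>R b1 + (u + \<xi> x0) *\<^sub>R b2 \<in> R" by blast
    have "mR R u \<le> (\<integral>\<^sup>+x. indicator {x0 - w / \<sigma>..x0 + w / \<sigma>} x \<partial>lborel)"
      unfolding mR_def
    proof (rule nn_integral_mono)
      fix x
      have "x \<in> {x0 - w / \<sigma>..x0 + w / \<sigma>}" if x: "x *\<^sub>R b1 + (u + \<xi> x) *\<^sub>R b2 \<in> R"
      proof (cases "x \<le> x0")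
        case True
        have "\<sigma> * (x0 - x) \<le> w" using sep[OF True, of u] w[OF x x0] by linarith
        then have "x0 - x \<le> w / \<sigma>" using v by (simp add: pos_le_divide_eq mult.commute)
        moreover have "0 \<le> w / \<sigma>" using v w0 by simp
        ultimately show ?thesis using True unfolding atLeastAtMost_iff by linarith
      next
        case False
        then have le: "x0 \<le> x" by simp
        have "\<sigma> * (x - x0) \<le> w" using sep[OF le, of u] w[OF x0 x] by linarith
        then have "x - x0 \<le> w / \<sigma>" using v by (simp add: pos_le_divide_eq mult.commute)
        moreover have "0 \<le> w / \<sigma>" using v w0 by simp
        ultimately show ?thesis using le unfolding atLeastAtMost_iff by linarith
      qed
      then show "indicator R (x *\<^sub>R b1 + (u + \<xi> x) *\<^sub>R b2) \<le> (indicator {x0 - w / \<sigma>..x0 + w / \<sigma>} x :: ennreal)"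
        by (simp add: indicator_def)
    qed
    also have "\<dots> = ennreal (2 * w / \<sigma>)" using w0 v by simp
    finally have 1: "mR R u \<le> ennreal (2 * w / \<sigma>)" .
    \<comment> \<open>The graph has jumps, so it need not stay close to its value at
      \<open>x0\<close> on both sides; \<open>osc\<close> supplies enough points nearby.\<close>
    obtain Y where Y: "Y \<in> sets borel" "Y \<subseteq> {x0 - l..x0 + l}" "ennreal (l / 2) \<le> emeasure lborel Y"
      "\<And>x. x \<in> Y \<Longrightarrow> \<bar>\<xi> x - \<xi> x0\<bar> \<le> 10 * l" using osc[OF l, of x0] by blast
    have "emeasure lborel Y = (\<integral>\<^sup>+x. indicator Y x \<partial>lborel)" using Y by simp
    also have "\<dots> \<le> mR B u"
      unfolding mR_def
    proof (rule nn_integral_mono)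
      fix x
      have "x *\<^sub>R b1 + (u + \<xi> x) *\<^sub>R b2 \<in> B" if x: "x \<in> Y"
      proof -
        have "\<bar>x - x0\<bar> \<le> l" using Y(2) x by (auto simp: abs_le_iff)
        from B[OF x0 this Y(4)[OF x]] show ?thesis by (simp add: algebra_simps)
      qed
      then show "(indicator Y x :: ennreal) \<le> indicator B (x *\<^sub>R b1 + (u + \<xi> x) *\<^sub>R b2)"
        by (simp add: indicator_def)
    qed
    finally have 2: "ennreal (l / 2) \<le> mR B u" using Y(3) by order
    have "ennreal (2 * w / \<sigma>) = ennreal (4 * w / (\<sigma> * l)) * ennreal (l / 2)"
      using l v w0 by (simp add: ennreal_mult[symmetric] del: times_divide_eq_left times_divide_eq_right) (simp add: field_simps)
    also have "\<dots> \<le> ennreal (4 * w / (\<sigma> * l)) * mR B u" using 2 by (rule mult_left_mono) simp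
    finally show ?thesis using 1 by order
  qed
  have "(\<integral>\<^sup>+u. ennreal (\<eta> u) * mR R u \<partial>lborel) \<le> (\<integral>\<^sup>+u. ennreal (4 * w / (\<sigma> * l)) * (ennreal (\<eta> u) * mR B u) \<partial>lborel)"
  proof (rule nn_integral_mono)
    fix u show "ennreal (\<eta> u) * mR R u \<le> ennreal (4 * w / (\<sigma> * l)) * (ennreal (\<eta> u) * mR B u)"
      using mult_left_mono[OF key[of u], of "ennreal (\<eta> u)"] by (simp add: mult.left_commute)
  qed
  also have "\<dots> = ennreal (4 * w / (\<sigma> * l)) * (\<integral>\<^sup>+u. ennreal (\<eta> u) * mR B u \<partial>lborel)"
    unfolding mR_def by (rule nn_integral_cmult) measurable
  finally have fin: "(\<integral>\<^sup>+u. ennreal (\<eta> u) * mR R u \<partial>lborel) \<le> ennreal (4 * w / (\<sigma> * l)) * (\<integral>\<^sup>+u. ennreal (\<eta> u) * mR B u \<partial>lborel)" .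
  note sh = nn_integral_shear[OF d m _ X Z, folded mR_def]
  show ?thesis
    unfolding sh[OF RB(1)] sh[OF RB(2)]
    using mult_left_mono[OF fin[unfolded mR_def], of "ennreal \<bar>det2 b1 b2\<bar>"] by (simp add: mult.left_commute)
qed

lemma dir_add_int_pi: "dir (x + of_int k * pi) = dir x \<or> dir (x + of_int k * pi) = - dir x"
proof (induction k rule: int_induct[where k = 0])
  case (step1 i)
  have "x + of_int (i + 1) * pi = (x + of_int i * pi) + pi" by (simp add: algebra_simps)
  then have "dir (x + of_int (i + 1) * pi) = - dir (x + of_int i * pi)" by (simp only: dir_add_pi)
  then show ?case using step1(2) by auto
next
  case (step2 i)
  have "(x + of_int (i - 1) * pi) + pi = x + of_int i * pi" by (simp add: algebra_simps)
  then have "dir (x + of_int i * pi) = - dir (x + of_int (i - 1) * pi)" by (simp only: dir_add_pi[symmetric])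
  then show ?case using step2(2) by (auto simp: minus_equation_iff)
qed simp

lemma sin_ge_sin:
  assumes "0 \<le> h" "h \<le> t" "t \<le> pi - h" shows "sin h \<le> sin t"
proof (cases "t \<le> pi / 2")
  case True then show ?thesis using assms by (intro sin_monotone_2pi_le) auto
next
  case False
  then have "sin h \<le> sin (pi - t)" using assms by (intro sin_monotone_2pi_le) auto
  then show ?thesis by simp
qed

text \<open>Shift \<open>\<phi>\<close> by multiples of \<open>pi\<close> to an angle
  \<open>\<psi>\<close> between \<open>c + 3 * h\<close> and \<open>c - 3 * h + pi\<close>, and take
  the normal at angle \<open>\<psi> + pi / 2\<close>. The two inner products are sines of
  \<open>\<psi> - c + 2 * h\<close> and \<open>\<psi> - c - 2 * h\<close>. The gap between the
  half-widths \<open>2 * h\<close> of the cone and \<open>3 * h\<close> of the arc gives the lower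
  bound \<open>sin h\<close>.\<close>

lemma good_direction:
  assumes h: "0 < h" "h \<le> 1/8" and s: "\<And>k::int. \<phi> + of_int k * pi \<notin> {c - 3 * h<..<c + 3 * h}"
  obtains v where "v = dir (\<phi> + pi / 2) \<or> v = - dir (\<phi> + pi / 2)"
    "0 \<le> v \<bullet> (- dir (c - 2 * h))" "sin h \<le> - (v \<bullet> dir (c + 2 * h))"
proof -
  define k where "k = \<lfloor>(c - 3 * h - \<phi>) / pi\<rfloor> + 1"
  define \<psi> where "\<psi> = \<phi> + of_int k * pi"
  have "(c - 3 * h - \<phi>) / pi < k" "k \<le> (c - 3 * h - \<phi>) / pi + 1" unfolding k_def by linarith+
  then have a: "c - 3 * h < \<psi>" "\<psi> \<le> c - 3 * h + pi"
    using pi_gt_zero by (simp_all add: \<psi>_def field_simps)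
  then have b: "c + 3 * h \<le> \<psi>" using s[of k] by (auto simp: \<psi>_def)
  have eq: "\<psi> + pi / 2 = \<phi> + pi / 2 + of_int k * pi" by (simp add: \<psi>_def)
  show ?thesis
  proof (rule that[of "dir (\<psi> + pi / 2)"])
    show "dir (\<psi> + pi / 2) = dir (\<phi> + pi / 2) \<or> dir (\<psi> + pi / 2) = - dir (\<phi> + pi / 2)"
      unfolding eq by (rule dir_add_int_pi)
    have "dir (\<psi> + pi / 2) \<bullet> (- dir (c - 2 * h)) = - sin (c - 2 * h - \<psi>)"
      using inner_dir_perp[of "c - 2 * h" \<psi>] by (simp add: inner_commute)
    also have "\<dots> = sin (\<psi> - c + 2 * h)" by (simp only: sin_minus[symmetric]) (rule arg_cong[where f = sin], simp)
    finally show "0 \<le> dir (\<psi> + pi / 2) \<bullet> (- dir (c - 2 * h))"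
      using a b h by (simp only:) (intro sin_ge_zero, auto)
    have "- (dir (\<psi> + pi / 2) \<bullet> dir (c + 2 * h)) = - sin (c + 2 * h - \<psi>)"
      using inner_dir_perp[of "c + 2 * h" \<psi>] by (simp add: inner_commute)
    also have "\<dots> = sin (\<psi> - c - 2 * h)" by (simp only: sin_minus[symmetric]) (rule arg_cong[where f = sin], simp)
    finally show "sin h \<le> - (dir (\<psi> + pi / 2) \<bullet> dir (c + 2 * h))"
      using a b h by (simp only:) (intro sin_ge_sin, auto)
  qed
qed

section \<open>Periodic sets on fine lattices\<close>

locale lattice2 =
  fixes b1 b2 :: "real ^ 2"
  assumes det_nz: "det2 b1 b2 \<noteq> 0"
begin

definition X where "X p = det2 p b2 / det2 b1 b2"
definition Y where "Y p = det2 b1 p / det2 b1 b2"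

lemma X_coords [simp]: "X (x *\<^sub>R b1 + z *\<^sub>R b2) = x"
  using det_nz by (simp add: X_def det2_def divide_simps) (simp add: algebra_simps)

lemma Y_coords [simp]: "Y (x *\<^sub>R b1 + z *\<^sub>R b2) = z"
  using det_nz by (simp add: Y_def det2_def divide_simps) (simp add: algebra_simps)

lemma coords: "X p *\<^sub>R b1 + Y p *\<^sub>R b2 = p"
  using det_nz by (simp add: X_def Y_def det2_def vec_eq_iff forall_2 divide_simps) (simp add: algebra_simps)

lemma X_linear: "X (p + q) = X p + X q" "X (p - q) = X p - X q" "X (r *\<^sub>R p) = r * X p"
  by (simp_all add: X_def det2_def algebra_simps add_divide_distrib diff_divide_distrib)

lemma Y_linear: "Y (p + q) = Y p + Y q" "Y (p - q) = Y p - Y q" "Y (r *\<^sub>R p) = r * Y p"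
  by (simp_all add: Y_def det2_def algebra_simps add_divide_distrib diff_divide_distrib)

lemma continuous_X: "continuous_on A X" and continuous_Y: "continuous_on A Y"
  unfolding X_def[abs_def] Y_def[abs_def] det2_def using det_nz by (intro continuous_intros, simp add: det2_def)+

lemma X_borel [measurable]: "X \<in> borel_measurable borel" and Y_borel [measurable]: "Y \<in> borel_measurable borel"
  by (intro borel_measurable_continuous_onI continuous_X continuous_Y)+

definition C :: real where "C = (norm b1 + norm b2) / \<bar>det2 b1 b2\<bar>"

lemma X_bound: "\<bar>X p\<bar> \<le> 2 * C * norm p" and Y_bound: "\<bar>Y p\<bar> \<le> 2 * C * norm p"
proof -
  note * = abs_det2_le
  have "\<bar>det2 p b2\<bar> \<le> 2 * (norm b1 + norm b2) * norm p"
    using *[of p b2] by (rule order_trans) (simp add: algebra_simps)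
  then show "\<bar>X p\<bar> \<le> 2 * C * norm p" using det_nz by (simp add: X_def C_def abs_divide divide_simps mult.commute)
  have "\<bar>det2 b1 p\<bar> \<le> 2 * (norm b1 + norm b2) * norm p"
    using *[of b1 p] by (rule order_trans) (simp add: algebra_simps)
  then show "\<bar>Y p\<bar> \<le> 2 * C * norm p" using det_nz by (simp add: Y_def C_def abs_divide divide_simps mult.commute)
qed

definition lat :: "int \<times> int \<Rightarrow> real ^ 2" where
  "lat i = of_int (fst i) *\<^sub>R b1 + of_int (snd i) *\<^sub>R b2"

definition cell0 :: "(real ^ 2) set" where "cell0 = {p. 0 \<le> X p \<and> X p < 1 \<and> 0 \<le> Y p \<and> Y p < 1}"

definition idx :: "nat \<Rightarrow> real ^ 2 \<Rightarrow> int \<times> int" where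
  "idx N p = (\<lfloor>2 ^ N * X p\<rfloor>, \<lfloor>2 ^ N * Y p\<rfloor>)"

definition cell :: "nat \<Rightarrow> int \<times> int \<Rightarrow> (real ^ 2) set" where
  "cell N i = {p. idx N p = i}"

definition copy :: "nat \<Rightarrow> (real ^ 2) set \<Rightarrow> int \<times> int \<Rightarrow> (real ^ 2) set" where
  "copy N K i = (\<lambda>p. (1 / 2 ^ N) *\<^sub>R (p + lat i)) ` K"

lemma lat_coords [simp]: "X (lat i) = of_int (fst i)" "Y (lat i) = of_int (snd i)"
  by (simp_all add: lat_def)

lemma copy_subset_cell: "K \<subseteq> cell0 \<Longrightarrow> copy N K i \<subseteq> cell N i"
proof
  fix q assume K: "K \<subseteq> cell0" and "q \<in> copy N K i"
  then obtain p where p: "p \<in> cell0" "q = (1 / 2 ^ N) *\<^sub>R (p + lat i)" by (auto simp: copy_def)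
  have "\<lfloor>X p\<rfloor> = 0" "\<lfloor>Y p\<rfloor> = 0" using p(1) by (simp_all add: cell0_def floor_eq_iff)
  then show "q \<in> cell N i" by (simp add: p(2) cell_def idx_def X_linear Y_linear)
qed

lemma cell_eq_copy: "cell N i = copy N cell0 i"
proof
  show "copy N cell0 i \<subseteq> cell N i" by (rule copy_subset_cell) simp
  show "cell N i \<subseteq> copy N cell0 i"
  proof
    fix p assume p: "p \<in> cell N i"
    have "2 ^ N *\<^sub>R p - lat i \<in> cell0"
      using p unfolding cell_def idx_def cell0_def by (simp add: X_linear Y_linear) (auto, linarith+)
    then show "p \<in> copy N cell0 i"
      unfolding copy_def by (intro image_eqI[of _ _ "2 ^ N *\<^sub>R p - lat i"]) auto
  qed
qed

lemma measure_copy: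
  assumes "K \<in> lmeasurable"
  shows "copy N K i \<in> lmeasurable" "measure lebesgue (copy N K i) = measure lebesgue K / 4 ^ N"
proof -
  have eq: "copy N K i = (\<lambda>x. (1 / 2 ^ N) *\<^sub>R x) ` ((+) (lat i) ` K)"
    by (simp add: copy_def image_image add.commute)
  have t: "(+) (lat i) ` K \<in> lmeasurable" using assms by (rule measurable_translation)
  have l: "linear (\<lambda>x::real^2. (1 / 2 ^ N) *\<^sub>R x)" by (rule linear_scaleR)
  show "copy N K i \<in> lmeasurable"
    unfolding eq by (rule measurable_linear_image[OF l t])
  have "det (matrix (\<lambda>x::real^2. (1 / 2 ^ N) *\<^sub>R x)) = 1 / 4 ^ N"
    by (simp add: det_2 matrix_def axis_def flip: power_mult_distrib)
  then show "measure lebesgue (copy N K i) = measure lebesgue K / 4 ^ N"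
    unfolding eq by (simp add: measure_linear_image[OF l t] measure_translation)
qed

lemma bounded_cell0: "bounded cell0"
proof -
  have "norm p \<le> norm b1 + norm b2" if "p \<in> cell0" for p
  proof -
    have "norm p = norm (X p *\<^sub>R b1 + Y p *\<^sub>R b2)" by (simp add: coords)
    also have "\<dots> \<le> \<bar>X p\<bar> * norm b1 + \<bar>Y p\<bar> * norm b2" by (rule order_trans[OF norm_triangle_ineq]) simp
    also have "\<dots> \<le> 1 * norm b1 + 1 * norm b2"
      using that by (intro add_mono mult_right_mono) (auto simp: cell0_def)
    finally show ?thesis by simp
  qed
  then show ?thesis unfolding bounded_iff by blast
qed

lemma cell0_borel: "cell0 \<in> sets borel"
  unfolding cell0_def by measurable

lemma cell0_lmeasurable: "cell0 \<in> lmeasurable"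
  using bounded_cell0 cell0_borel by (intro bounded_set_imp_lmeasurable) auto

lemma finite_idx_bounded:
  assumes "bounded A"
  shows "finite (idx N ` A)"
proof -
  obtain M where M: "\<And>p. p \<in> A \<Longrightarrow> norm p \<le> M" using assms unfolding bounded_iff by blast
  define k where "k = \<lceil>2 ^ N * (2 * C * M)\<rceil>"
  have C0: "0 \<le> C" by (simp add: C_def)
  have fl: "- k - 1 \<le> \<lfloor>2 ^ N * x\<rfloor> \<and> \<lfloor>2 ^ N * x\<rfloor> \<le> k" if "\<bar>x\<bar> \<le> 2 * C * M" for x :: real
  proof -
    have "\<bar>2 ^ N * x\<bar> \<le> 2 ^ N * (2 * C * M)" using that by (simp add: abs_mult)
    also have "\<dots> \<le> k" by (simp add: k_def)
    finally show ?thesis by (simp add: abs_le_iff) linarith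
  qed
  have "idx N ` A \<subseteq> {-k-1..k} \<times> {-k-1..k}"
  proof
    fix i assume "i \<in> idx N ` A"
    then obtain p where p: "p \<in> A" "i = idx N p" by blast
    have "2 * C * norm p \<le> 2 * C * M" using M[OF p(1)] C0 by (intro mult_left_mono) auto
    then have "\<bar>X p\<bar> \<le> 2 * C * M" "\<bar>Y p\<bar> \<le> 2 * C * M" using X_bound[of p] Y_bound[of p] by linarith+
    from fl[OF this(1)] fl[OF this(2)] show "i \<in> {-k-1..k} \<times> {-k-1..k}" by (simp add: p idx_def)
  qed
  then show ?thesis by (rule finite_subset) simp
qed

definition inner_idx :: "nat \<Rightarrow> (real ^ 2) set \<Rightarrow> (int \<times> int) set" where
  "inner_idx N A = {i. cell N i \<subseteq> A}"

lemma cell_nonempty: "cell N i \<noteq> {}"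
proof -
  have "0 \<in> cell0" by (simp add: cell0_def X_def Y_def det2_def)
  then show ?thesis unfolding cell_eq_copy copy_def by blast
qed

lemma finite_inner_idx: "bounded A \<Longrightarrow> finite (inner_idx N A)"
proof (rule finite_subset[OF _ finite_idx_bounded[of A N]])
  show "inner_idx N A \<subseteq> idx N ` A"
  proof
    fix i assume i: "i \<in> inner_idx N A"
    obtain q where "q \<in> cell N i" using cell_nonempty[of N i] by blast
    then have "q \<in> A" "idx N q = i" using i by (auto simp: inner_idx_def cell_def)
    then show "i \<in> idx N ` A" by blast
  qed
qed

lemma idx_Suc: "idx (Suc N) p = idx (Suc N) q \<Longrightarrow> idx N p = idx N q"
proof -
  have *: "\<lfloor>2 ^ N * x\<rfloor> = \<lfloor>2 ^ Suc N * x\<rfloor> div 2" for x :: real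
    using floor_divide_real_eq_div[of 2 "2 ^ Suc N * x"] by simp
  show "idx (Suc N) p = idx (Suc N) q \<Longrightarrow> idx N p = idx N q"
    unfolding idx_def * by simp
qed

text \<open>Cells of successive levels are nested, so the unions of inner cells increase; their
  diameters tend to 0, so they exhaust the open set. Continuity from below gives the limit.\<close>

lemma inner_cells_tendsto:
  assumes A: "open A" "bounded A"
  shows "(\<lambda>N. measure lebesgue (\<Union>i\<in>inner_idx N A. cell N i)) \<longlonglongrightarrow> measure lebesgue A"
proof -
  define V where "V = (\<lambda>N. \<Union>i\<in>inner_idx N A. cell N i)"
  have V: "V N = {p. cell N (idx N p) \<subseteq> A}" for N
    by (auto simp: V_def inner_idx_def cell_def)
  have cl: "cell N i \<in> lmeasurable" for N i
    unfolding cell_eq_copy by (rule measure_copy cell0_lmeasurable)+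
  have Vl: "V N \<in> lmeasurable" for N
    unfolding V_def using finite_inner_idx[OF A(2)] cl by (intro fmeasurable.finite_UN) auto
  have "incseq V"
  proof (rule incseq_SucI)
    fix N show "V N \<subseteq> V (Suc N)"
    proof
      fix p assume "p \<in> V N"
      moreover have "cell (Suc N) (idx (Suc N) p) \<subseteq> cell N (idx N p)"
        unfolding cell_def by (rule Collect_mono) (blast intro: idx_Suc)
      ultimately show "p \<in> V (Suc N)" unfolding V by blast
    qed
  qed
  moreover have "(\<Union>N. V N) = A"
  proof
    show "(\<Union>N. V N) \<subseteq> A" unfolding V by (auto simp: cell_def)
    show "A \<subseteq> (\<Union>N. V N)"
    proof
      fix p assume "p \<in> A"
      then obtain e where e: "e > 0" "ball p e \<subseteq> A" using A openE by blast
      define D where "D = norm b1 + norm b2"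
      have D: "D > 0" 
      proof -
        have "b1 \<noteq> 0" using det_nz by (auto simp: det2_def)
        then show ?thesis by (simp add: D_def add_pos_nonneg)
      qed
      obtain N where N: "D / e < 2 ^ N" using real_arch_pow[of 2 "D / e"] by auto
      have "cell N (idx N p) \<subseteq> ball p e"
      proof
        fix q assume "q \<in> cell N (idx N p)"
        then have i: "idx N q = idx N p" by (simp add: cell_def)
        have *: "\<bar>x - y\<bar> \<le> 1 / 2 ^ N" if "\<lfloor>2 ^ N * x\<rfloor> = \<lfloor>2 ^ N * y\<rfloor>" for x y :: real
        proof -
          have "\<bar>2 ^ N * x - 2 ^ N * y\<bar> \<le> 1" using that by linarith
          then have "2 ^ N * \<bar>x - y\<bar> \<le> 1" by (simp add: right_diff_distrib[symmetric] abs_mult)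
          then show ?thesis by (simp add: field_simps)
        qed
        have "norm (q - p) = norm (X (q - p) *\<^sub>R b1 + Y (q - p) *\<^sub>R b2)" by (simp add: coords)
        also have "\<dots> \<le> \<bar>X q - X p\<bar> * norm b1 + \<bar>Y q - Y p\<bar> * norm b2"
          by (rule order_trans[OF norm_triangle_ineq]) (simp add: X_linear Y_linear)
        also have "\<dots> \<le> 1 / 2 ^ N * norm b1 + 1 / 2 ^ N * norm b2"
          using i by (intro add_mono mult_right_mono *) (auto simp: idx_def)
        also have "\<dots> = D / 2 ^ N" by (simp add: D_def add_divide_distrib)
        also have "\<dots> < e" using N e by (simp add: field_simps)
        finally show "q \<in> ball p e" by (simp add: dist_norm norm_minus_commute)
      qed
      then show "p \<in> (\<Union>N. V N)" unfolding V using e by blast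
    qed
  qed
  moreover have "(\<lambda>N. measure lebesgue (V N)) \<longlonglongrightarrow> measure lebesgue (\<Union>N. V N)"
  proof (rule Lim_measure_incseq)
    show "range V \<subseteq> sets lebesgue" using Vl by (auto dest: fmeasurableD)
    show "emeasure lebesgue (\<Union>N. V N) \<noteq> \<infinity>"
      unfolding \<open>(\<Union>N. V N) = A\<close> using fmeasurableD2[OF lmeasurable_open[OF A(2,1)]] by simp
  qed (rule \<open>incseq V\<close>)
  ultimately show ?thesis by (simp add: V_def)
qed

text \<open>Only copies in cells lying wholly inside \<open>A\<close> are taken away. There are
  finitely many and they are disjoint, so the removed measure is computed exactly and the remainder
  of an open set stays open for compact \<open>K\<close>.\<close>

definition remove :: "nat \<Rightarrow> (real ^ 2) set \<Rightarrow> (real ^ 2) set \<Rightarrow> (real ^ 2) set" where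
  "remove N K A = A - (\<Union>i\<in>inner_idx N A. copy N K i)"

lemma open_remove: "open A \<Longrightarrow> bounded A \<Longrightarrow> compact K \<Longrightarrow> open (remove N K A)"
  unfolding remove_def copy_def
  by (intro open_Diff closed_UN finite_inner_idx ballI compact_imp_closed compact_continuous_image continuous_intros)

lemma bounded_remove: "bounded A \<Longrightarrow> bounded (remove N K A)"
  unfolding remove_def by (rule bounded_subset) auto

text \<open>In every inner cell at least the proportion \<open>p\<close> disappears, and inner cells
  fill \<open>A\<close> in the limit; \<open>e\<close> pays for the cells that meet the
  boundary.\<close>

lemma eventually_remove:
  assumes A: "open A" "bounded A" and K: "compact K" "K \<subseteq> cell0" "p * measure lebesgue cell0 \<le> measure lebesgue K"
    and p: "0 \<le> p" and e: "e > 0"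
  shows "eventually (\<lambda>N. measure lebesgue (remove N K A) \<le> (1 - p) * measure lebesgue A + e) sequentially"
proof -
  have lim: "(\<lambda>N. p * measure lebesgue (\<Union>i\<in>inner_idx N A. cell N i)) \<longlonglongrightarrow> p * measure lebesgue A"
    by (intro tendsto_intros inner_cells_tendsto A)
  have Kl: "K \<in> lmeasurable" using K(1) by (rule lmeasurable_compact)
  have dis: "disjoint_family_on (copy N L) (inner_idx N A)" if "L \<subseteq> cell0" for N L
    using copy_subset_cell[OF that] unfolding disjoint_family_on_def cell_def by blast
  have fin: "finite (inner_idx N A)" for N by (rule finite_inner_idx[OF A(2)])
  have un: "measure lebesgue (\<Union>i\<in>inner_idx N A. copy N L i) = card (inner_idx N A) * (measure lebesgue L / 4 ^ N)"
    if "L \<in> lmeasurable" "L \<subseteq> cell0" for N L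
  proof -
    have "measure lebesgue (\<Union>i\<in>inner_idx N A. copy N L i) = (\<Sum>i\<in>inner_idx N A. measure lebesgue (copy N L i))"
    proof (rule measure_finite_Union[OF fin _ dis[OF that(2)]])
      show "copy N L ` inner_idx N A \<subseteq> sets lebesgue" using measure_copy(1)[OF that(1)] by (auto dest: fmeasurableD)
      show "emeasure lebesgue (copy N L i) \<noteq> \<infinity>" for i using fmeasurableD2[OF measure_copy(1)[OF that(1)], of N i] by simp
    qed
    then show ?thesis using measure_copy(2)[OF that(1)] by simp
  qed
  have le: "p * measure lebesgue (\<Union>i\<in>inner_idx N A. cell N i) \<le> measure lebesgue (\<Union>i\<in>inner_idx N A. copy N K i)" for N
  proof -
    have "p * measure lebesgue (\<Union>i\<in>inner_idx N A. cell N i) = card (inner_idx N A) * (p * measure lebesgue cell0 / 4 ^ N)"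
      unfolding cell_eq_copy by (subst un[OF cell0_lmeasurable]) simp_all
    also have "\<dots> \<le> card (inner_idx N A) * (measure lebesgue K / 4 ^ N)"
      by (intro mult_left_mono divide_right_mono K) auto
    finally show ?thesis using un[OF Kl K(2)] by simp
  qed
  have rem: "measure lebesgue (remove N K A) = measure lebesgue A - measure lebesgue (\<Union>i\<in>inner_idx N A. copy N K i)" for N
    unfolding remove_def
  proof (rule measurable_measure_Diff)
    show "A \<in> lmeasurable" by (rule lmeasurable_open[OF A(2,1)])
    show "(\<Union>i\<in>inner_idx N A. copy N K i) \<in> sets lebesgue"
      using measure_copy(1)[OF Kl] fin by (intro sets.finite_UN) (auto dest: fmeasurableD)
    show "(\<Union>i\<in>inner_idx N A. copy N K i) \<subseteq> A"
      using copy_subset_cell[OF K(2)] unfolding inner_idx_def by blast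
  qed
  have "eventually (\<lambda>N. p * measure lebesgue A - e < p * measure lebesgue (\<Union>i\<in>inner_idx N A. cell N i)) sequentially"
    using e by (intro order_tendstoD(1)[OF lim]) simp
  then show ?thesis
  proof eventually_elim
    case (elim N)
    then show ?case using le[of N] rem[of N] by (simp add: left_diff_distrib)
  qed
qed

text \<open>Quasi-independence of finely rescaled periodic sets, for finitely many sets at once.\<close>

lemma layers:
  assumes fin: "finite \<K>" and K: "\<And>K. K \<in> \<K> \<Longrightarrow> compact K \<and> K \<subseteq> cell0 \<and> p * measure lebesgue cell0 \<le> measure lebesgue K"
    and p: "0 \<le> p" "p \<le> 1" and e: "e > 0" and A: "open A" "bounded A"
  shows "\<exists>Ns. length Ns = J \<and> (\<forall>N\<in>set Ns. N0 \<le> N) \<and>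
    (\<forall>K\<in>\<K>. \<exists>A'. open A' \<and> bounded A' \<and> measure lebesgue A' \<le> (1 - p) ^ J * measure lebesgue A + e \<and>
       A - A' \<subseteq> (\<Union>N\<in>set Ns. \<Union>i. copy N K i))"
  using e
proof (induction J arbitrary: e)
  case 0
  have "\<exists>A'. open A' \<and> bounded A' \<and> measure lebesgue A' \<le> (1 - p) ^ 0 * measure lebesgue A + e \<and>
       A - A' \<subseteq> (\<Union>N\<in>set []. \<Union>i. copy N K i)" for K
    using A 0 by (intro exI[of _ A]) simp
  then show ?case by (intro exI[of _ "[]"]) simp
next
  case (Suc J)
  have e2: "0 < e / 2" using Suc.prems by simp
  from Suc.IH[OF e2] obtain Ns where Ns: "length Ns = J" "\<forall>N\<in>set Ns. N0 \<le> N"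
    "\<forall>K\<in>\<K>. \<exists>A'. open A' \<and> bounded A' \<and> measure lebesgue A' \<le> (1 - p) ^ J * measure lebesgue A + e / 2 \<and>
       A - A' \<subseteq> (\<Union>N\<in>set Ns. \<Union>i. copy N K i)"
    by (elim exE conjE)
  obtain A' where A'0: "\<forall>K\<in>\<K>. open (A' K) \<and> bounded (A' K) \<and>
    measure lebesgue (A' K) \<le> (1 - p) ^ J * measure lebesgue A + e / 2 \<and> A - A' K \<subseteq> (\<Union>N\<in>set Ns. \<Union>i. copy N K i)"
    using bchoice[OF Ns(3)] by (elim exE)
  have A': "\<And>K. K \<in> \<K> \<Longrightarrow> open (A' K)" "\<And>K. K \<in> \<K> \<Longrightarrow> bounded (A' K)"
    "\<And>K. K \<in> \<K> \<Longrightarrow> measure lebesgue (A' K) \<le> (1 - p) ^ J * measure lebesgue A + e / 2"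
    "\<And>K. K \<in> \<K> \<Longrightarrow> A - A' K \<subseteq> (\<Union>N\<in>set Ns. \<Union>i. copy N K i)"
    using A'0 by blast+
  \<comment> \<open>The remainders \<open>A' K\<close> differ from one \<open>K\<close> to another,
    but \<open>\<K>\<close> is finite, so a single scale \<open>N\<close> is fine enough for all of
    them.\<close>
  have "eventually (\<lambda>N. \<forall>K\<in>\<K>. measure lebesgue (remove N K (A' K)) \<le> (1 - p) * measure lebesgue (A' K) + e / 2) sequentially"
    using fin Suc.prems K A' p by (intro eventually_ball_finite ballI eventually_remove) auto
  from eventually_happens'[OF sequentially_bot eventually_conj[OF this eventually_ge_at_top[of N0]]]
  obtain N where N: "N \<ge> N0"
    "\<And>K. K \<in> \<K> \<Longrightarrow> measure lebesgue (remove N K (A' K)) \<le> (1 - p) * measure lebesgue (A' K) + e / 2"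
    by auto
  show ?case
  proof (intro exI[of _ "N # Ns"] conjI ballI)
    fix K assume k: "K \<in> \<K>"
    have "measure lebesgue (remove N K (A' K)) \<le> (1 - p) * measure lebesgue (A' K) + e / 2" by (rule N(2)[OF k])
    also have "\<dots> \<le> (1 - p) * ((1 - p) ^ J * measure lebesgue A + e / 2) + e / 2"
      using A'(3)[OF k] p by (intro add_right_mono mult_left_mono) auto
    \<comment> \<open>The error \<open>e / 2\<close> of the previous remainder is multiplied by at
      most 1, and the new layer adds the other half.\<close>
    also have "\<dots> \<le> (1 - p) ^ Suc J * measure lebesgue A + e"
    proof -
      have "(1 - p) * (e / 2) \<le> 1 * (e / 2)" using p Suc.prems by (intro mult_right_mono) auto
      then show ?thesis by (simp add: distrib_left)
    qed
    finally have "measure lebesgue (remove N K (A' K)) \<le> (1 - p) ^ Suc J * measure lebesgue A + e" .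
    moreover have "A - remove N K (A' K) \<subseteq> (\<Union>N\<in>set (N # Ns). \<Union>i. copy N K i)"
    proof
      fix x assume x: "x \<in> A - remove N K (A' K)"
      show "x \<in> (\<Union>N\<in>set (N # Ns). \<Union>i. copy N K i)"
      proof (cases "x \<in> A' K")
        case True
        then have "x \<in> (\<Union>i. copy N K i)" using x unfolding remove_def by blast
        then show ?thesis by simp
      next
        case False
        then have "x \<in> (\<Union>N\<in>set Ns. \<Union>i. copy N K i)" using x A'(4)[OF k] by blast
        then show ?thesis by simp
      qed
    qed
    ultimately show "\<exists>A'. open A' \<and> bounded A' \<and> measure lebesgue A' \<le> (1 - p) ^ Suc J * measure lebesgue A + e \<and>
       A - A' \<subseteq> (\<Union>N\<in>set (N # Ns). \<Union>i. copy N K i)"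
      using open_remove[of "A' K" K N] bounded_remove[of "A' K" N K] A'(1,2)[OF k] K[OF k]
      by (intro exI[of _ "remove N K (A' K)"] conjI) simp_all
  next
    show "length (N # Ns) = Suc J" using Ns(1) by simp
    show "N0 \<le> M" if "M \<in> set (N # Ns)" for M using that Ns(2) N(1) by auto
  qed
qed

end

section \<open>The sawtooth\<close>

definition saw_upto :: "nat \<Rightarrow> nat \<Rightarrow> real \<Rightarrow> real" where
  "saw_upto n k x = (\<Sum>j = 1..k. 4 / n * frac (2 ^ j * x) / 2 ^ j)"

definition saw :: "nat \<Rightarrow> real \<Rightarrow> real" where "saw n = saw_upto n n"

lemma frac_borel [measurable]: "(frac :: real \<Rightarrow> real) \<in> borel_measurable borel"
  unfolding frac_def[abs_def] by measurable

lemma saw_borel [measurable]: "saw n \<in> borel_measurable borel"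
  unfolding saw_def saw_upto_def[abs_def] by measurable

lemma sum_half_powers_le: "(\<Sum>j\<in>{j. k < j \<and> j \<le> n}. 1 / 2 ^ j :: real) \<le> 1 / 2 ^ k"
proof (cases "k \<le> n")
  case True
  have "(\<Sum>j\<in>{j. k < j \<and> j \<le> n}. 1 / 2 ^ j :: real) = 1 / 2 ^ k - 1 / 2 ^ n"
    using True
  proof (induction n rule: dec_induct)
    case base
    have "{j. k < j \<and> j \<le> k} = {}" by auto
    then show ?case by (simp only: sum.empty diff_self)
  next
    case (step m)
    have "{j. k < j \<and> j \<le> Suc m} = insert (Suc m) {j. k < j \<and> j \<le> m}" using step by auto
    moreover have "finite {j. k < j \<and> j \<le> m}" by simp
    ultimately show ?case using step by simp
  qed
  then show ?thesis by simp
next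
  case False
  then have "{j. k < j \<and> j \<le> n} = {}" by auto
  then show ?thesis by (simp only: sum.empty) simp
qed

lemma saw_split:
  assumes "k \<le> n"
  shows "saw n x = saw_upto n k x + (\<Sum>j\<in>{j. k < j \<and> j \<le> n}. 4 / n * frac (2 ^ j * x) / 2 ^ j)"
proof -
  have "{1..n} = {1..k} \<union> {j. k < j \<and> j \<le> n}" using assms by auto
  then show ?thesis unfolding saw_def saw_upto_def by (simp only:) (rule sum.union_disjoint, auto)
qed

text \<open>All generations finer than \<open>k\<close> together displace the graph by at most the
  height of one tooth of generation \<open>k\<close>, because their heights form a geometric
  series.\<close>

lemma saw_tail_bounds:
  "0 \<le> (\<Sum>j\<in>{j. k < j \<and> j \<le> n}. 4 / real n * frac (2 ^ j * x :: real) / 2 ^ j)"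
  "(\<Sum>j\<in>{j. k < j \<and> j \<le> n}. 4 / real n * frac (2 ^ j * x :: real) / 2 ^ j) \<le> 4 / n / 2 ^ k"
proof -
  show "0 \<le> (\<Sum>j\<in>{j. k < j \<and> j \<le> n}. 4 / real n * frac (2 ^ j * x :: real) / 2 ^ j)"
    by (intro sum_nonneg) (simp add: frac_ge_0)
  have "(\<Sum>j\<in>{j. k < j \<and> j \<le> n}. 4 / real n * frac (2 ^ j * x :: real) / 2 ^ j) \<le> (\<Sum>j\<in>{j. k < j \<and> j \<le> n}. 4 / n * (1 / 2 ^ j))"
  proof (rule sum_mono)
    fix j
    have "4 / n * frac (2 ^ j * x) \<le> 4 / n * 1" using less_imp_le[OF frac_lt_1[of "2 ^ j * x"]] by (intro mult_left_mono) auto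
    from divide_right_mono[OF this, of "2 ^ j"] show "4 / n * frac (2 ^ j * x) / 2 ^ j \<le> 4 / n * (1 / 2 ^ j)" by simp
  qed
  also have "\<dots> = 4 / n * (\<Sum>j\<in>{j. k < j \<and> j \<le> n}. 1 / 2 ^ j)" by (simp add: sum_distrib_left)
  also have "\<dots> \<le> 4 / n * (1 / 2 ^ k)" by (intro mult_left_mono sum_half_powers_le) auto
  finally show "(\<Sum>j\<in>{j. k < j \<and> j \<le> n}. 4 / real n * frac (2 ^ j * x :: real) / 2 ^ j) \<le> 4 / n / 2 ^ k" by simp
qed

lemma saw_bounds: "0 \<le> saw n x" "saw n x \<le> 4 / n"
  using saw_split[of 0 n x] saw_tail_bounds[where k = 0 and n = n and x = x] by (simp_all add: saw_upto_def)

lemma frac_add_int: "frac (x + of_int i) = frac (x :: real)"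
  by (simp add: frac_def)

lemma saw_upto_periodic: "saw_upto n k (x + of_int i) = saw_upto n k x"
  unfolding saw_upto_def
proof (intro sum.cong refl arg_cong2[where f = "(/)"] arg_cong2[where f = "(*)"])
  fix j show "frac (2 ^ j * (x + of_int i)) = frac (2 ^ j * x)"
    using frac_add_int[of "2 ^ j * x" "2 ^ j * i"] by (simp add: algebra_simps)
qed

lemma saw_periodic: "saw n (x + of_int i) = saw n x"
  by (simp add: saw_def saw_upto_periodic)

text \<open>Each generation contributes slope \<open>4 / n\<close> and jumps downwards only.
  Subtracting from the total slope 4 leaves a positive combination of floor functions, which is
  monotone.\<close>

lemma saw_mono:
  assumes n: "0 < n" and le: "x \<le> y"
  shows "4 * x - saw n x \<le> 4 * y - saw n y"
proof -
  have *: "4 * x - saw n x = (\<Sum>j = 1..n. 4 / n * (of_int \<lfloor>2 ^ j * x\<rfloor> / 2 ^ j))" for x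
  proof -
    have "4 * x = (\<Sum>j = 1..n. 4 / n * x)" using n by simp
    then have "4 * x - saw n x = (\<Sum>j = 1..n. 4 / n * x - 4 / n * frac (2 ^ j * x) / 2 ^ j)"
      by (simp only: saw_def saw_upto_def sum_subtractf)
    also have "\<dots> = (\<Sum>j = 1..n. 4 / n * (of_int \<lfloor>2 ^ j * x\<rfloor> / 2 ^ j))"
      by (intro sum.cong refl) (simp add: frac_def field_simps)
    finally show ?thesis .
  qed
  show ?thesis
    unfolding * using le by (intro sum_mono mult_left_mono divide_right_mono) (auto intro!: floor_mono)
qed

lemma floor_pow_eq:
  fixes x y :: real
  assumes "\<lfloor>2 ^ k * x\<rfloor> = \<lfloor>2 ^ k * y\<rfloor>" "j \<le> k"
  shows "\<lfloor>2 ^ j * x\<rfloor> = \<lfloor>2 ^ j * y\<rfloor>"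
proof -
  have *: "\<lfloor>2 ^ j * x\<rfloor> = \<lfloor>2 ^ k * x\<rfloor> div 2 ^ (k - j)" for x :: real
  proof -
    have "(2 :: real) ^ k = 2 ^ j * 2 ^ (k - j)" using assms(2) by (simp flip: power_add)
    then have "2 ^ j * x = 2 ^ k * x / of_int (2 ^ (k - j))" by simp
    then show ?thesis using floor_divide_real_eq_div[of "2 ^ (k - j)" "2 ^ k * x"] by simp
  qed
  show ?thesis unfolding * assms(1) ..
qed

lemma saw_upto_same_cell:
  assumes eq: "\<lfloor>2 ^ k * x\<rfloor> = \<lfloor>2 ^ k * y\<rfloor>"
  shows "saw_upto n k x - saw_upto n k y = k * (4 / n) * (x - y)"
proof -
  have "saw_upto n k x - saw_upto n k y = (\<Sum>j = 1..k. 4 / n * frac (2 ^ j * x) / 2 ^ j - 4 / n * frac (2 ^ j * y) / 2 ^ j)"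
    by (simp only: saw_upto_def sum_subtractf)
  also have "\<dots> = (\<Sum>j = 1..k. 4 / n * (x - y))"
  proof (intro sum.cong refl)
    fix j assume "j \<in> {1..k}"
    then have "\<lfloor>2 ^ j * x\<rfloor> = \<lfloor>2 ^ j * y\<rfloor>" using floor_pow_eq[OF eq, of j] by simp
    then have "frac (2 ^ j * x) - frac (2 ^ j * y) = 2 ^ j * (x - y)"
      by (simp add: frac_def algebra_simps)
    then have fr: "frac (2 ^ j * x) = frac (2 ^ j * y) + 2 ^ j * (x - y)" by simp
    show "4 / n * frac (2 ^ j * x) / 2 ^ j - 4 / n * frac (2 ^ j * y) / 2 ^ j = 4 / n * (x - y)"
      unfolding fr by (simp only: distrib_left add_divide_distrib) simp
  qed
  finally show ?thesis by simp
qed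

lemma generation_slope_le:
  assumes "k \<le> n" "0 < n"
  shows "real k * (4 / real n) \<le> 4"
  using assms by (simp add: field_simps)

lemma saw_osc_same_cell:
  assumes n: "0 < n" and eq: "\<lfloor>2 ^ k * x\<rfloor> = \<lfloor>2 ^ k * x0\<rfloor>" and l: "1 / 2 ^ k < 2 * l" "\<bar>x - x0\<bar> \<le> l / 2"
  shows "\<bar>saw n x - saw n x0\<bar> \<le> 10 * l"
proof (cases "k \<le> n")
  case True
  have n4: "4 / real n \<le> 4" using n by (simp add: field_simps)
  have "4 / n / 2 ^ k \<le> 4 * (1 / 2 ^ k)" using mult_right_mono[OF n4, of "1 / 2 ^ k"] by simp
  also have "\<dots> \<le> 8 * l" using l by simp
  finally have t: "4 / n / 2 ^ k \<le> 8 * l" .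
  have "\<bar>saw_upto n k x - saw_upto n k x0\<bar> = real k * (4 / n) * \<bar>x - x0\<bar>"
    unfolding saw_upto_same_cell[OF eq] by (simp add: abs_mult)
  also have "\<dots> \<le> 4 * (l / 2)" using l generation_slope_le[OF True n] by (intro mult_mono) auto
  finally show ?thesis
    using saw_split[OF True, of x] saw_split[OF True, of x0] saw_tail_bounds[where k = k and n = n and x = x] saw_tail_bounds[where k = k and n = n and x = x0] t by linarith
next
  case False
  then have eq': "\<lfloor>2 ^ n * x\<rfloor> = \<lfloor>2 ^ n * x0\<rfloor>" using floor_pow_eq[OF eq, of n] by simp
  have "\<bar>saw n x - saw n x0\<bar> = real n * (4 / n) * \<bar>x - x0\<bar>"
    unfolding saw_def saw_upto_same_cell[OF eq'] by (simp add: abs_mult)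
  also have "\<dots> \<le> 4 * (l / 2)" using l generation_slope_le[of n n] n by (intro mult_mono) auto
  finally show ?thesis using l by linarith
qed

text \<open>A dyadic interval of length between \<open>l\<close> and \<open>2 * l\<close> around
  \<open>x0\<close> extends by at least \<open>l / 2\<close> to one side of \<open>x0\<close>. On it
  the coarse generations vary by at most \<open>2 * l\<close>, having slope at most 4, and the finer
  ones by at most \<open>8 * l\<close>.\<close>

lemma saw_osc:
  assumes n: "0 < n" and l: "0 < l"
  shows "(\<forall>x\<in>{x0..<x0 + l / 2}. \<bar>saw n x - saw n x0\<bar> \<le> 10 * l) \<or>
         (\<forall>x\<in>{x0 - l / 2<..x0}. \<bar>saw n x - saw n x0\<bar> \<le> 10 * l)"
proof (cases "1 \<le> l")
  case True
  have n4: "4 / real n \<le> 4" using n by (simp add: field_simps)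
  have "\<bar>saw n x - saw n x0\<bar> \<le> 10 * l" for x
    using saw_bounds[of n x] saw_bounds[of n x0] n4 True by linarith
  then show ?thesis by blast
next
  case False
  \<comment> \<open>Minimality places the predecessor \<open>k\<close> of \<open>m\<close> so that
    \<open>1 / 2 ^ k\<close> lies between \<open>l\<close> and \<open>2 * l\<close>.\<close>
  define m where "m = (LEAST m. 1 / 2 ^ m < l)"
  obtain m0 where "(1 / 2) ^ m0 < l" using real_arch_pow_inv[OF l, of "1/2"] by auto
  then have "1 / 2 ^ m0 < l" by (simp add: power_one_over)
  then have m: "1 / 2 ^ m < l" unfolding m_def by (rule LeastI)
  have "m \<noteq> 0"
  proof
    assume "m = 0" then show False using m False by simp
  qed
  then obtain k where k: "m = Suc k" by (cases m) auto
  have kl: "l \<le> 1 / 2 ^ k" using not_less_Least[of k "\<lambda>m. 1 / 2 ^ m < l"] k unfolding m_def[symmetric] by auto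
  have k2: "1 / 2 ^ k < 2 * l" using m k by (simp add: field_simps)
  define f where "f = \<lfloor>2 ^ k * x0\<rfloor>"
  have f: "of_int f \<le> 2 ^ k * x0" "2 ^ k * x0 < of_int f + 1" unfolding f_def by linarith+
  have p: "0 < (2 :: real) ^ k" by simp
  have kl': "2 ^ k * l \<le> 1" using kl by (simp add: field_simps)
  show ?thesis
  proof (cases "2 ^ k * x0 + 2 ^ k * (l / 2) \<le> of_int f + 1")
    case True
    have "\<bar>saw n x - saw n x0\<bar> \<le> 10 * l" if "x \<in> {x0..<x0 + l / 2}" for x
    proof (rule saw_osc_same_cell[OF n _ k2])
      have "2 ^ k * x0 \<le> 2 ^ k * x" "2 ^ k * x < 2 ^ k * (x0 + l / 2)"
        using that p by (simp_all only: mult_le_cancel_left_pos mult_less_cancel_left_pos) auto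
      then show "\<lfloor>2 ^ k * x\<rfloor> = \<lfloor>2 ^ k * x0\<rfloor>"
        unfolding f_def[symmetric] floor_eq_iff distrib_left using f True by (intro conjI) linarith+
    qed (use that in auto)
    then show ?thesis by blast
  next
    case False
    have "\<bar>saw n x - saw n x0\<bar> \<le> 10 * l" if "x \<in> {x0 - l / 2<..x0}" for x
    proof (rule saw_osc_same_cell[OF n _ k2])
      have "2 ^ k * x \<le> 2 ^ k * x0" "2 ^ k * (x0 - l / 2) < 2 ^ k * x"
        using that p by (simp_all only: mult_le_cancel_left_pos mult_less_cancel_left_pos) auto
      then show "\<lfloor>2 ^ k * x\<rfloor> = \<lfloor>2 ^ k * x0\<rfloor>"
        unfolding f_def[symmetric] floor_eq_iff right_diff_distrib using f False kl' by (intro conjI) linarith+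
    qed (use that in auto)
    then show ?thesis by blast
  qed
qed

lemma saw_scaled_osc:
  assumes n: "0 < n" and l: "0 < l"
  shows "\<exists>Y \<in> sets borel. Y \<subseteq> {x0 - l..x0 + l} \<and> ennreal (l / 2) \<le> emeasure lborel Y \<and>
     (\<forall>x\<in>Y. \<bar>saw n (2 ^ N * x) / 2 ^ N - saw n (2 ^ N * x0) / 2 ^ N\<bar> \<le> 10 * l)"
proof -
  have p: "0 < (2 :: real) ^ N" by simp
  have sc: "\<bar>saw n (2 ^ N * x) / 2 ^ N - saw n (2 ^ N * x0) / 2 ^ N\<bar> \<le> 10 * l"
    if "\<bar>saw n (2 ^ N * x) - saw n (2 ^ N * x0)\<bar> \<le> 10 * (2 ^ N * l)" for x
    using that p by (simp add: diff_divide_distrib[symmetric] abs_divide divide_le_eq mult_ac)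
  have l': "0 < 2 ^ N * l" using l by simp
  from saw_osc[OF n l', of "2 ^ N * x0"] show ?thesis
  proof
    assume *: "\<forall>x\<in>{2 ^ N * x0..<2 ^ N * x0 + 2 ^ N * l / 2}. \<bar>saw n x - saw n (2 ^ N * x0)\<bar> \<le> 10 * (2 ^ N * l)"
    have "\<bar>saw n (2 ^ N * x) - saw n (2 ^ N * x0)\<bar> \<le> 10 * (2 ^ N * l)" if "x \<in> {x0..<x0 + l / 2}" for x
    proof -
      have "2 ^ N * x < 2 ^ N * (x0 + l / 2)" using that p by (simp only: mult_less_cancel_left_pos) auto
      then show ?thesis using * that by (simp add: distrib_left)
    qed
    then show ?thesis using l sc by (intro bexI[of _ "{x0..<x0 + l / 2}"]) auto
  next
    assume *: "\<forall>x\<in>{2 ^ N * x0 - 2 ^ N * l / 2<..2 ^ N * x0}. \<bar>saw n x - saw n (2 ^ N * x0)\<bar> \<le> 10 * (2 ^ N * l)"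
    have "\<bar>saw n (2 ^ N * x) - saw n (2 ^ N * x0)\<bar> \<le> 10 * (2 ^ N * l)" if "x \<in> {x0 - l / 2<..x0}" for x
    proof -
      have "2 ^ N * (x0 - l / 2) < 2 ^ N * x" using that p by (simp only: mult_less_cancel_left_pos) auto
      then show ?thesis using * that by (simp add: right_diff_distrib)
    qed
    then show ?thesis using l sc by (intro bexI[of _ "{x0 - l / 2<..x0}"]) auto
  qed
qed

lemma saw_scaled_mono:
  assumes n: "0 < n" and le: "x \<le> y"
  shows "4 * x - saw n (2 ^ N * x) / 2 ^ N \<le> 4 * y - saw n (2 ^ N * y) / 2 ^ N"
proof -
  have "4 * (2 ^ N * x) - saw n (2 ^ N * x) \<le> 4 * (2 ^ N * y) - saw n (2 ^ N * y)"
    using le by (intro saw_mono n) simp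
  then have "(4 * (2 ^ N * x) - saw n (2 ^ N * x)) / 2 ^ N \<le> (4 * (2 ^ N * y) - saw n (2 ^ N * y)) / 2 ^ N"
    by (rule divide_right_mono) simp
  then show ?thesis by (simp add: diff_divide_distrib)
qed

lemma saw_on_cell:
  assumes k: "k \<le> n" and x: "of_int c / 2 ^ k \<le> x" "x < of_int c / 2 ^ k + 1 / 2 ^ k"
  shows "saw_upto n k (of_int c / 2 ^ k) + k * (4 / n) * (x - of_int c / 2 ^ k) \<le> saw n x"
    "saw n x \<le> saw_upto n k (of_int c / 2 ^ k) + k * (4 / n) * (x - of_int c / 2 ^ k) + 4 / n / 2 ^ k"
proof -
  have "of_int c \<le> 2 ^ k * x" "2 ^ k * x < of_int c + 1" using x by (simp_all add: field_simps)
  then have "\<lfloor>2 ^ k * x\<rfloor> = \<lfloor>2 ^ k * (of_int c / 2 ^ k :: real)\<rfloor>" by (simp add: floor_eq_iff)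
  from saw_upto_same_cell[OF this, of n]
  show "saw_upto n k (of_int c / 2 ^ k) + k * (4 / n) * (x - of_int c / 2 ^ k) \<le> saw n x"
    "saw n x \<le> saw_upto n k (of_int c / 2 ^ k) + k * (4 / n) * (x - of_int c / 2 ^ k) + 4 / n / 2 ^ k"
    using saw_split[OF k, of x] saw_tail_bounds[where k = k and n = n and x = x] by linarith+
qed

text \<open>At both ends of a dyadic interval of level \<open>k\<close> the tooth of generation
  \<open>k\<close> itself vanishes, so at most \<open>k - 1\<close> generations rise across the
  interval. This missing tooth keeps the shadows in \<open>heavy_row\<close> disjoint.\<close>

lemma saw_upto_next_cell:
  assumes k: "1 \<le> k"
  shows "saw_upto n k (of_int (c + 1) / 2 ^ k) \<le> saw_upto n k (of_int c / 2 ^ k) + (real k - 1) * (4 / n) / 2 ^ k"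
proof -
  have fr: "frac (x + y) \<le> frac x + y" if "0 \<le> y" for x y :: real
  proof -
    have "\<lfloor>x\<rfloor> \<le> \<lfloor>x + y\<rfloor>" using that by (intro floor_mono) simp
    then have "real_of_int \<lfloor>x\<rfloor> \<le> of_int \<lfloor>x + y\<rfloor>" by (simp only: of_int_le_iff)
    then show ?thesis by (simp add: frac_def)
  qed
  have eq: "{1..k} = insert k {1..k - 1}" using k by auto
  have su: "saw_upto n k (of_int c / 2 ^ k) = (\<Sum>j = 1..k - 1. 4 / n * frac (2 ^ j * (of_int c / 2 ^ k)) / 2 ^ j)" for c
  proof -
    have "frac (2 ^ k * (real_of_int c / 2 ^ k)) = 0" by simp
    then show ?thesis unfolding saw_upto_def eq by (subst sum.insert) (use k in auto)
  qed
  have "saw_upto n k (of_int (c + 1) / 2 ^ k) \<le> (\<Sum>j = 1..k - 1. 4 / n * frac (2 ^ j * (of_int c / 2 ^ k)) / 2 ^ j + 4 / n / 2 ^ k)"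
    unfolding su
  proof (rule sum_mono)
    fix j
    have "2 ^ j * (real_of_int (c + 1) / 2 ^ k) = 2 ^ j * (of_int c / 2 ^ k) + 2 ^ j / 2 ^ k" by (simp add: field_simps)
    then have "frac (2 ^ j * (real_of_int (c + 1) / 2 ^ k)) \<le> frac (2 ^ j * (of_int c / 2 ^ k)) + 2 ^ j / 2 ^ k"
      by (simp only:) (rule fr, simp)
    then have "4 / n * frac (2 ^ j * (real_of_int (c + 1) / 2 ^ k)) / 2 ^ j \<le> 4 / n * (frac (2 ^ j * (of_int c / 2 ^ k)) + 2 ^ j / 2 ^ k) / 2 ^ j"
      by (intro divide_right_mono mult_left_mono) auto
    also have "\<dots> = 4 / n * frac (2 ^ j * (of_int c / 2 ^ k)) / 2 ^ j + 4 / n / 2 ^ k"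
      by (simp add: distrib_left add_divide_distrib)
    finally show "4 / n * frac (2 ^ j * (real_of_int (c + 1) / 2 ^ k)) / 2 ^ j \<le> \<dots>" .
  qed
  also have "\<dots> = saw_upto n k (of_int c / 2 ^ k) + (real k - 1) * (4 / n) / 2 ^ k"
    unfolding su using k by (simp add: sum.distrib of_nat_diff)
  finally show ?thesis .
qed

lemma emeasure_periodic:
  fixes A :: "real set"
  assumes A: "A \<in> sets borel" and per: "\<And>x i. x + of_int i \<in> A \<longleftrightarrow> x \<in> A"
  shows "emeasure lborel (A \<inter> {a..<a + 1}) = emeasure lborel (A \<inter> {0..<1})"
proof -
  define m where "m = \<lfloor>a\<rfloor> + 1"
  have m: "of_int m - 1 \<le> a" "a < of_int m" unfolding m_def by linarith+
  have sh: "emeasure lborel (A \<inter> {u..<v}) = emeasure lborel (A \<inter> {u - of_int i..<v - of_int i})" for u v i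
  proof -
    have "emeasure lborel (A \<inter> {u..<v}) = (\<integral>\<^sup>+x. indicator (A \<inter> {u..<v}) x \<partial>lborel)" using A by simp
    also have "\<dots> = ennreal \<bar>1\<bar> * (\<integral>\<^sup>+x. indicator (A \<inter> {u..<v}) (of_int i + 1 * x) \<partial>lborel)"
      using A by (intro nn_integral_real_affine) auto
    also have "\<dots> = (\<integral>\<^sup>+x. indicator (A \<inter> {u - of_int i..<v - of_int i}) x \<partial>lborel)"
    proof -
      have *: "of_int i + x \<in> A \<longleftrightarrow> x \<in> A" for x using per[of x i] by (simp only: add.commute)
      have "(indicator (A \<inter> {u..<v}) (of_int i + 1 * x) :: ennreal) = indicator (A \<inter> {u - of_int i..<v - of_int i}) x" for x
        unfolding indicator_def mult_1 Int_iff * by (auto simp: algebra_simps)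
      then show ?thesis by simp
    qed
    also have "\<dots> = emeasure lborel (A \<inter> {u - of_int i..<v - of_int i})" using A by simp
    finally show ?thesis .
  qed
  have un: "emeasure lborel (A \<inter> {u..<w}) = emeasure lborel (A \<inter> {u..<v}) + emeasure lborel (A \<inter> {v..<w})"
    if "u \<le> v" "v \<le> w" for u v w
  proof -
    have "A \<inter> {u..<w} = (A \<inter> {u..<v}) \<union> (A \<inter> {v..<w})" using that by auto
    then show ?thesis using A by (simp only:) (rule plus_emeasure[symmetric], auto)
  qed
  have "emeasure lborel (A \<inter> {a..<a + 1}) = emeasure lborel (A \<inter> {a..<of_int m}) + emeasure lborel (A \<inter> {of_int m..<a + 1})"
    using m by (intro un) auto
  also have "emeasure lborel (A \<inter> {a..<of_int m}) = emeasure lborel (A \<inter> {a - of_int m + 1..<1})"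
  proof -
    have *: "a - of_int (m - 1) = a - of_int m + 1" "real_of_int m - of_int (m - 1) = 1" by simp_all
    show ?thesis using sh[of a "of_int m" "m - 1"] unfolding * .
  qed
  also have "emeasure lborel (A \<inter> {of_int m..<a + 1}) = emeasure lborel (A \<inter> {0..<a - of_int m + 1})"
  proof -
    have *: "a + 1 - of_int m = a - of_int m + 1" "real_of_int m - of_int m = 0" by simp_all
    show ?thesis using sh[of "of_int m" "a + 1" m] unfolding * .
  qed
  also have "emeasure lborel (A \<inter> {a - of_int m + 1..<1}) + emeasure lborel (A \<inter> {0..<a - of_int m + 1}) = emeasure lborel (A \<inter> {0..<1})"
    using m un[of 0 "a - of_int m + 1" 1] by (simp only: add.commute[of "emeasure lborel (A \<inter> {a - of_int m + 1..<1})"])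
  finally show ?thesis .
qed

text \<open>The \<open>m\<close> intervals with indices from 0 to \<open>m - 1\<close> are disjoint
  and fit into one period starting at \<open>l 0\<close>; periodicity carries the estimate over to
  the unit interval.\<close>

lemma periodic_intervals:
  fixes l :: "int \<Rightarrow> real"
  assumes L: "0 < L" and step: "\<And>c. l c + L \<le> l (c + 1)" and per: "\<And>c. l (c + int m) = l c + 1"
  shows "ennreal (m * L) \<le> emeasure lborel ((\<Union>c. {l c<..<l c + L}) \<inter> {0..<1})"
proof -
  define A where "A = (\<Union>c. {l c<..<l c + L})"
  have A: "A \<in> sets borel" unfolding A_def by (intro borel_open open_UN) auto
  have per': "l (c + i * int m) = l c + of_int i" for c i
  proof (induction i rule: int_induct[where k = 0])
    case (step1 i) then show ?case using per[of "c + i * int m"] by (simp add: algebra_simps)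
  next
    case (step2 i) then show ?case using per[of "c + (i - 1) * int m"] by (simp add: algebra_simps)
  qed simp
  have in1: "x + of_int i \<in> A" if "x \<in> A" for x i
  proof -
    from that obtain c where "x \<in> {l c<..<l c + L}" unfolding A_def by blast
    then have "x + of_int i \<in> {l (c + i * int m)<..<l (c + i * int m) + L}" by (simp add: per')
    then show ?thesis unfolding A_def by blast
  qed
  have perA: "x + of_int i \<in> A \<longleftrightarrow> x \<in> A" for x i
    using in1[of x i] in1[of "x + of_int i" "- i"] by auto
  have mono: "l (c + int d) \<ge> l c + d * L" for c d
  proof (induction d)
    case (Suc d) then show ?case using step[of "c + int d"] by (simp add: algebra_simps)
  qed simp
  have mono': "l c + L \<le> l c'" if "c < c'" for c c'
  proof -
    define d where "d = nat (c' - c)"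
    have "1 \<le> d" "c' = c + int d" using that by (auto simp: d_def)
    moreover have "L \<le> d * L" using \<open>1 \<le> d\<close> L by simp
    ultimately show ?thesis using mono[of c d] by simp
  qed
  have sub: "(\<Union>c\<in>{0..<int m}. {l c<..<l c + L}) \<subseteq> A \<inter> {l 0..<l 0 + 1}"
  proof
    fix x assume "x \<in> (\<Union>c\<in>{0..<int m}. {l c<..<l c + L})"
    then obtain c where c: "0 \<le> c" "c < int m" "l c < x" "x < l c + L" by auto
    have "l 0 \<le> l c" using mono'[of 0 c] c L by (cases "c = 0") auto
    moreover have "l c + L \<le> l 0 + 1" using mono'[of c "int m"] c per[of 0] by simp
    ultimately show "x \<in> A \<inter> {l 0..<l 0 + 1}" using c by (auto simp: A_def)
  qed
  have "ennreal (m * L) = (\<Sum>c\<in>{0..<int m}. ennreal L)"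
    using L by (simp add: ennreal_mult ennreal_of_nat_eq_real_of_nat)
  also have "\<dots> = (\<Sum>c\<in>{0..<int m}. emeasure lborel {l c<..<l c + L})" using L by simp
  also have "\<dots> = emeasure lborel (\<Union>c\<in>{0..<int m}. {l c<..<l c + L})"
  proof (rule sum_emeasure)
    show "disjoint_family_on (\<lambda>c. {l c<..<l c + L}) {0..<int m}"
      unfolding disjoint_family_on_def
    proof (intro ballI impI)
      fix c c' :: int assume "c \<noteq> c'"
      then consider "c < c'" | "c' < c" by linarith
      then show "{l c<..<l c + L} \<inter> {l c'<..<l c' + L} = {}"
      proof cases
        case 1 from mono'[OF 1] show ?thesis by auto
      next
        case 2 from mono'[OF 2] show ?thesis by auto
      qed
    qed
  qed auto
  also have "\<dots> \<le> emeasure lborel (A \<inter> {l 0..<l 0 + 1})" using sub A by (intro emeasure_mono) auto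
  also have "\<dots> = emeasure lborel (A \<inter> {0..<1})" by (rule emeasure_periodic[OF A perA])
  finally show ?thesis by (simp add: A_def)
qed

section \<open>Venetian blinds\<close>

text \<open>Keeps the two sines in \<open>slope\<close> within a factor 3 of each other.\<close>

lemma sin_triple_le:
  assumes "0 \<le> h" "h \<le> pi" shows "sin (3 * h) \<le> 3 * sin h"
proof -
  have s: "0 \<le> sin h" using assms by (intro sin_ge_zero)
  have "sin (3 * h) = sin (2 * h + h)" by simp
  also have "\<dots> = 2 * (sin h * (cos h * cos h)) + cos (2 * h) * sin h"
    unfolding sin_add sin_double by (simp add: mult_ac)
  also have "\<dots> \<le> 2 * (sin h * 1) + 1 * sin h"
  proof -
    have "cos h * cos h \<le> 1" using sin_cos_squared_add[of h] by (simp add: power2_eq_square)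
      (metis add.commute le_add_same_cancel1 zero_le_square)
    then show ?thesis using s by (intro add_mono mult_left_mono mult_right_mono) auto
  qed
  finally show ?thesis by simp
qed

locale blind =
  fixes c h :: real and n :: nat
  assumes h: "0 < h" "h \<le> 1 / 8" and n: "4 \<le> n"
begin

text \<open>With this choice \<open>b1 + 4 e2\<close> is \<open>dir (c + 2 * h)\<close>. Since
  \<open>saw\<close> has slope at most 4 and jumps down, all chords of the graph point into the cone
  between \<open>dir (c - 2 * h)\<close> and \<open>dir (c + 2 * h)\<close>. Slopes in the inner arc
  lie inside this cone, those outside the outer arc leave it by an angle at least
  \<open>h\<close>.\<close>

definition b1 :: "real ^ 2" where "b1 = dir (c + 2 * h) + 4 *\<^sub>R dir (c - 2 * h)"
definition e2 :: "real ^ 2" where "e2 = - dir (c - 2 * h)"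
text \<open>The vertical period \<open>n\<close> makes the mean density \<open>1 / n\<close> and
  leaves room for heights up to \<open>n / 4\<close> above the graph within one cell.\<close>

definition b2 :: "real ^ 2" where "b2 = real n *\<^sub>R e2"
definition d :: real where "d = sin (4 * h)"

lemma d_pos: "0 < d"
  using h pi_gt3 by (auto simp: d_def intro!: sin_gt_zero)

lemma n_pos: "0 < n" "4 \<le> real n" using n by auto

lemma det_b1_e2: "det2 b1 e2 = d"
proof -
  have "det2 b1 e2 = - det2 (dir (c + 2 * h)) (dir (c - 2 * h))"
    by (simp add: b1_def e2_def det2_def algebra_simps)
  also have "\<dots> = - sin (- (4 * h))" unfolding det2_dir by (intro arg_cong[where f = "\<lambda>x. - sin x"]) simp
  finally show ?thesis by (simp add: d_def)
qed

lemma det_b1_b2: "det2 b1 b2 = n * d"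
  unfolding det_b1_e2[symmetric] by (simp add: b2_def det2_def algebra_simps)

lemma norm_b1: "norm b1 \<le> 5" and norm_e2: "norm e2 = 1"
proof -
  have "norm b1 \<le> norm (dir (c + 2 * h)) + norm (4 *\<^sub>R dir (c - 2 * h))" unfolding b1_def by (rule norm_triangle_ineq)
  then show "norm b1 \<le> 5" by simp
qed (simp add: e2_def)

sublocale lattice2 b1 b2
  using det_b1_b2 d_pos n_pos by unfold_locales auto

definition Z where "Z p = n * Y p"

lemma Z_e2 [simp]: "X (x *\<^sub>R b1 + z *\<^sub>R e2) = x" "Z (x *\<^sub>R b1 + z *\<^sub>R e2) = z" "Y (x *\<^sub>R b1 + z *\<^sub>R e2) = z / n"
proof -
  have eq: "x *\<^sub>R b1 + z *\<^sub>R e2 = x *\<^sub>R b1 + (z / n) *\<^sub>R b2" using n_pos by (simp add: b2_def)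
  show "X (x *\<^sub>R b1 + z *\<^sub>R e2) = x" "Z (x *\<^sub>R b1 + z *\<^sub>R e2) = z" "Y (x *\<^sub>R b1 + z *\<^sub>R e2) = z / n"
    unfolding eq using n_pos by (simp_all add: Z_def)
qed

lemma coords_e2: "X p *\<^sub>R b1 + Z p *\<^sub>R e2 = p"
  using coords[of p] by (simp add: Z_def b2_def mult.commute)

lemma Z_borel [measurable]: "Z \<in> borel_measurable borel"
  unfolding Z_def[abs_def] by measurable

lemma Z_scale: "Z (r *\<^sub>R p) = r * Z p" by (simp add: Z_def Y_linear)

text \<open>The thickness of the strip carrying the mass. It equals the height of a tooth of the
  last generation and so is no obstacle for teeth of any generation.\<close>

definition delta :: real where "delta = 4 / n / 2 ^ n"

lemma delta: "0 < delta" "delta \<le> 1" "delta < n"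
proof -
  show "0 < delta" using n_pos by (simp add: delta_def)
  have "4 / real n \<le> 1" using n_pos by simp
  then have "delta \<le> 1 / 2 ^ n" unfolding delta_def by (rule divide_right_mono) simp
  also have "\<dots> \<le> 1" by simp
  finally show "delta \<le> 1" .
  then show "delta < n" using n_pos by linarith
qed

text \<open>Unit mass per period \<open>n\<close>, spread evenly over a strip of height
  \<open>delta\<close>, so that the layers are bounded and continuous almost everywhere.\<close>

definition bump :: "real \<Rightarrow> real" where
  "bump z = (if frac (z / n) < delta / n then 1 / delta else 0)"

lemma bump_borel [measurable]: "bump \<in> borel_measurable borel"
  unfolding bump_def[abs_def] by measurable

lemma bump_nonneg: "0 \<le> bump z" and bump_le: "bump z \<le> 1 / delta"
  using delta by (auto simp: bump_def)

lemma bump_periodic: "bump (z + real n * of_int i) = bump z"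
proof -
  have "(z + real n * of_int i) / n = z / n + of_int i" using n_pos by (simp add: add_divide_distrib)
  then show ?thesis by (simp add: bump_def frac_add_int)
qed

lemma bump_eq: "0 \<le> u \<Longrightarrow> u < delta \<Longrightarrow> bump u = 1 / delta"
proof -
  assume u: "0 \<le> u" "u < delta"
  then have "0 \<le> u / n" "u / n < 1" using delta n_pos by auto
  then have "frac (u / n) = u / n" by (simp add: frac_eq)
  then show "bump u = 1 / delta" using u n_pos by (simp add: bump_def divide_strict_right_mono)
qed

text \<open>Unit mass for each period that the interval meets; the summand 2 counts the incomplete
  periods at the ends.\<close>

lemma bump_integral_le:
  assumes "s \<le> t"
  shows "(\<integral>\<^sup>+y. indicator {s..t} y * ennreal (bump y) \<partial>lborel) \<le> ennreal ((t - s) / n + 2)"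
proof -
  define D where "D = {\<lfloor>s / n\<rfloor>..\<lfloor>t / n\<rfloor>}"
  have "(\<integral>\<^sup>+y. indicator {s..t} y * ennreal (bump y) \<partial>lborel) \<le>
      (\<integral>\<^sup>+y. (\<Sum>k\<in>D. ennreal (1 / delta) * indicator {of_int k * n..of_int k * n + delta} y) \<partial>lborel)"
  proof (rule nn_integral_mono)
    fix y
    show "indicator {s..t} y * ennreal (bump y) \<le> (\<Sum>k\<in>D. ennreal (1 / delta) * indicator {of_int k * n..of_int k * n + delta} y)"
    proof (cases "y \<in> {s..t} \<and> frac (y / n) < delta / n")
      case True
      define k where "k = \<lfloor>y / n\<rfloor>"
      have kD: "k \<in> D" using True n_pos by (auto simp: D_def k_def intro!: floor_mono divide_right_mono)
      have "of_int k \<le> y / n" "y / n < (of_int k * n + delta) / n"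
        using True n_pos by (auto simp: k_def frac_def add_divide_distrib)
      then have "of_int k * n \<le> y" "y < of_int k * n + delta"
        using n_pos by (simp_all only: pos_le_divide_eq divide_less_cancel) auto
      then have ind: "indicator {of_int k * n..of_int k * n + delta} y = (1 :: ennreal)" by simp
      have "indicator {s..t} y * ennreal (bump y) = ennreal (1 / delta) * indicator {of_int k * n..of_int k * n + delta} y"
        unfolding ind using True by (simp add: bump_def)
      also have "\<dots> \<le> (\<Sum>k\<in>D. ennreal (1 / delta) * indicator {of_int k * n..of_int k * n + delta} y)"
        using kD by (intro member_le_sum) (auto simp: D_def)
      finally show ?thesis .
    next
      case False
      then have "indicator {s..t} y * ennreal (bump y) = 0" by (auto simp: bump_def)
      then show ?thesis by (simp only: zero_le)
    qed
  qed
  also have "\<dots> = (\<Sum>k\<in>D. \<integral>\<^sup>+y. ennreal (1 / delta) * indicator {of_int k * n..of_int k * n + delta} y \<partial>lborel)"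
    by (rule nn_integral_sum) simp
  also have "\<dots> = (\<Sum>k\<in>D. 1)"
  proof (intro sum.cong refl)
    fix k
    have "(\<integral>\<^sup>+y. ennreal (1 / delta) * indicator {of_int k * n..of_int k * n + delta} y \<partial>lborel) = ennreal (1 / delta) * ennreal delta"
      using delta by (subst nn_integral_cmult_indicator) auto
    also have "\<dots> = ennreal (1 / delta * delta)" using delta by (intro ennreal_mult[symmetric]) auto
    also have "\<dots> = 1" using delta by simp
    finally show "(\<integral>\<^sup>+y. ennreal (1 / delta) * indicator {of_int k * n..of_int k * n + delta} y \<partial>lborel) = 1" .
  qed
  also have "\<dots> = ennreal (card D)" by (simp add: ennreal_of_nat_eq_real_of_nat)
  also have "\<dots> \<le> ennreal ((t - s) / n + 2)"
  proof (rule ennreal_leI)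
    have le: "\<lfloor>s / n\<rfloor> \<le> \<lfloor>t / n\<rfloor>" using assms by (intro floor_mono divide_right_mono) auto
    then have "real (card D) = of_int (\<lfloor>t / n\<rfloor> - \<lfloor>s / n\<rfloor> + 1)" by (simp add: D_def)
    also have "\<dots> \<le> t / n - s / n + 2" by simp linarith
    finally show "real (card D) \<le> (t - s) / n + 2" by (simp add: diff_divide_distrib)
  qed
  finally show ?thesis .
qed

definition base :: "real ^ 2 \<Rightarrow> real" where
  "base p = bump (Z p - saw n (X p))"

definition layer :: "nat \<Rightarrow> real ^ 2 \<Rightarrow> real" where
  "layer N p = base (2 ^ N *\<^sub>R p)"

lemma base_borel [measurable]: "base \<in> borel_measurable borel"
  unfolding base_def[abs_def] by measurable

lemma layer_borel [measurable]: "layer N \<in> borel_measurable borel"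
  unfolding layer_def[abs_def] by measurable

lemma base_bounds: "0 \<le> base p" "base p \<le> 1 / delta"
  by (simp_all add: base_def bump_nonneg bump_le)

lemma layer_bounds: "0 \<le> layer N p" "layer N p \<le> 1 / delta"
  by (simp_all add: layer_def base_bounds)

lemma layer_eq: "layer N p = (\<lambda>z. bump (2 ^ N * z)) (Z p - (\<lambda>x. saw n (2 ^ N * x) / 2 ^ N) (X p))"
  by (simp add: layer_def base_def X_linear Z_scale right_diff_distrib)

lemma base_periodic: "base (p + lat i) = base p"
proof -
  have "Z (p + lat i) = Z p + real n * of_int (snd i)" by (simp add: Z_def Y_linear distrib_left)
  moreover have "X (p + lat i) = X p + of_int (fst i)" by (simp add: X_linear)
  ultimately have "base (p + lat i) = bump ((Z p - saw n (X p)) + real n * of_int (snd i))"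
    unfolding base_def by (simp only: saw_periodic) (simp add: algebra_simps)
  then show ?thesis by (simp only: bump_periodic base_def)
qed

text \<open>The normal \<open>v\<close> must be taken across the narrow side, which may be either of
  the two. Accordingly \<open>good_direction\<close> is applied to \<open>s\<close> or to
  \<open>s + pi / 2\<close>, and this is why the arc is avoided modulo
  \<open>pi / 2\<close>.\<close>

lemma layer_mass_le:
  assumes good: "\<And>k::int. s + of_int k * (pi / 2) \<notin> {c - 3 * h<..<c + 3 * h}"
    and ab: "0 < a" "0 < b" and x: "x \<in> open_rect s p a b"
  shows "(mass (open_rect s p a b) (layer N)) \<le>
     ennreal (4 * min a b / (sin h * max a b)) *
     (mass (cball x (17 * max a b)) (layer N))"
proof -
  let ?l = "max a b" and ?w = "min a b"
  obtain v where v: "0 \<le> v \<bullet> e2" "sin h \<le> - (v \<bullet> (b1 + 4 *\<^sub>R e2))"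
    and w: "\<And>y q. y \<in> open_rect s p a b \<Longrightarrow> q \<in> open_rect s p a b \<Longrightarrow> v \<bullet> (y - q) \<le> ?w"
  proof (cases "b \<le> a")
    case True
    have g: "s + of_int k * pi \<notin> {c - 3 * h<..<c + 3 * h}" for k :: int
      using good[of "2 * k"] by simp
    obtain v where v: "v = dir (s + pi / 2) \<or> v = - dir (s + pi / 2)"
      "0 \<le> v \<bullet> (- dir (c - 2 * h))" "sin h \<le> - (v \<bullet> dir (c + 2 * h))"
      by (rule good_direction[OF h g])
    have "v \<bullet> (y - q) \<le> ?w" if "y \<in> open_rect s p a b" "q \<in> open_rect s p a b" for y q
      using that v(1) True unfolding mem_open_rect_iff
      by (auto simp: inner_commute[of _ "dir (s + pi / 2)"] inner_diff_right)
    then show ?thesis using that[of v] v by (simp add: e2_def b1_def)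
  next
    case False
    have g: "s + pi / 2 + of_int k * pi \<notin> {c - 3 * h<..<c + 3 * h}" for k :: int
      using good[of "2 * k + 1"] by (simp add: algebra_simps add_divide_distrib)
    obtain v where v: "v = dir (s + pi / 2 + pi / 2) \<or> v = - dir (s + pi / 2 + pi / 2)"
      "0 \<le> v \<bullet> (- dir (c - 2 * h))" "sin h \<le> - (v \<bullet> dir (c + 2 * h))"
      by (rule good_direction[OF h g])
    have "dir (s + pi / 2 + pi / 2) = - dir s" using dir_add_pi[of s] by (simp add: add.assoc)
    then have v': "v = dir s \<or> v = - dir s" using v(1) by auto
    have "v \<bullet> (y - q) \<le> ?w" if "y \<in> open_rect s p a b" "q \<in> open_rect s p a b" for y q
      using that v' False unfolding mem_open_rect_iff
      by (auto simp: inner_commute[of _ "dir s"] inner_diff_right)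
    then show ?thesis using that[of v] v by (simp add: e2_def b1_def)
  qed
  show ?thesis
    unfolding layer_eq
  proof (rule sheared_mass_le[where ?b1.0 = b1 and ?b2.0 = e2 and v = v and X = X and Z = Z and
        \<xi> = "\<lambda>x. saw n (2 ^ N * x) / 2 ^ N" and \<eta> = "\<lambda>z. bump (2 ^ N * z)"])
    show "det2 b1 e2 \<noteq> 0" using det_b1_e2 d_pos by simp
    show "0 < sin h" using h pi_gt3 by (intro sin_gt_zero) auto
    show "0 < ?l" using ab by simp
    show "\<exists>Y\<in>sets borel. Y \<subseteq> {x0 - l..x0 + l} \<and> ennreal (l / 2) \<le> emeasure lborel Y \<and>
      (\<forall>x\<in>Y. \<bar>saw n (2 ^ N * x) / 2 ^ N - saw n (2 ^ N * x0) / 2 ^ N\<bar> \<le> 10 * l)" if "0 < l" for x0 l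
      by (rule saw_scaled_osc[OF n_pos(1) that])
    show "4 * x - saw n (2 ^ N * x) / 2 ^ N \<le> 4 * y - saw n (2 ^ N * y) / 2 ^ N" if "x \<le> y" for x y
      by (rule saw_scaled_mono[OF n_pos(1) that])
    \<comment> \<open>The radius 17 splits as 2 for the rectangle, 5 for a shift along
      \<open>b1\<close> and 10 for the oscillation of the sawtooth.\<close>
    show "q + dx *\<^sub>R b1 + dz *\<^sub>R e2 \<in> cball x (17 * ?l)"
      if q: "q \<in> open_rect s p a b" and dx: "\<bar>dx\<bar> \<le> ?l" and dz: "\<bar>dz\<bar> \<le> 10 * ?l" for q dx dz
    proof -
      have "norm (dx *\<^sub>R b1) \<le> ?l * 5" unfolding norm_scaleR using dx norm_b1 by (intro mult_mono) auto
      moreover have "norm (dz *\<^sub>R e2) \<le> 10 * ?l" using dz by (simp add: norm_e2)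
      moreover have "norm (q - x) \<le> 2 * ?l"
        using dist_open_rect_less[OF q x] by (auto simp: dist_norm)
      moreover have "norm ((q + dx *\<^sub>R b1 + dz *\<^sub>R e2) - x) \<le> norm (q - x) + norm (dx *\<^sub>R b1) + norm (dz *\<^sub>R e2)"
      proof -
        have "(q + dx *\<^sub>R b1 + dz *\<^sub>R e2) - x = (q - x) + dx *\<^sub>R b1 + dz *\<^sub>R e2" by simp
        show ?thesis unfolding \<open>(q + dx *\<^sub>R b1 + dz *\<^sub>R e2) - x = (q - x) + dx *\<^sub>R b1 + dz *\<^sub>R e2\<close>
          using norm_triangle_ineq[of "(q - x) + dx *\<^sub>R b1" "dz *\<^sub>R e2"] norm_triangle_ineq[of "q - x" "dx *\<^sub>R b1"] by linarith
      qed
      ultimately show ?thesis by (simp add: dist_norm norm_minus_commute)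
    qed
  qed (use v w in \<open>simp_all\<close>)
qed

lemma coords_bound: "\<bar>X p\<bar> \<le> 10 / d * norm p" "\<bar>Z p\<bar> \<le> 10 / d * norm p"
proof -
  note * = abs_det2_le
  have "det2 (X p *\<^sub>R b1 + Z p *\<^sub>R e2) e2 = X p * d" "det2 b1 (X p *\<^sub>R b1 + Z p *\<^sub>R e2) = Z p * d"
    unfolding det_b1_e2[symmetric] by (simp_all add: det2_def algebra_simps)
  then have x: "X p = det2 p e2 / d" and z: "Z p = det2 b1 p / d" using d_pos by (simp_all add: coords_e2)
  have "\<bar>det2 p e2\<bar> \<le> 10 * norm p" using *[of p e2] norm_ge_zero[of p] unfolding norm_e2 by linarith
  then show "\<bar>X p\<bar> \<le> 10 / d * norm p" using d_pos by (simp add: x abs_divide divide_right_mono)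
  have "norm b1 * norm p \<le> 5 * norm p" by (intro mult_right_mono norm_b1) simp
  then have "\<bar>det2 b1 p\<bar> \<le> 10 * norm p" using *[of b1 p] by linarith
  then show "\<bar>Z p\<bar> \<le> 10 / d * norm p" using d_pos by (simp add: z abs_divide divide_right_mono)
qed

text \<open>In each column the mass is at most the number of periods met divided by
  \<open>2 ^ N\<close>. The bound is of order \<open>1 / n\<close> at all scales with
  \<open>n \<le> 2 ^ N\<close>.\<close>

lemma layer_window_mass:
  assumes M: "0 < M" and N: "real n \<le> 2 ^ N"
  shows "(mass (cball 0 M) (layer N)) \<le>
    ennreal (d * (20 / d * M) * ((20 / d * M + 2) / n))"
proof -
  define A where "A = 10 / d * M"
  have A: "0 < A" using M d_pos by (simp add: A_def)
  have [measurable]: "cball (0 :: real ^ 2) M \<in> sets borel" by simp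
  have mm: "(\<lambda>q. indicator (cball 0 M) q * ennreal (layer N q)) \<in> borel_measurable borel" by measurable
  have inner: "(\<integral>\<^sup>+z. indicator {-A..A} z * ennreal (bump (2 ^ N * z - u)) \<partial>lborel) \<le> ennreal ((2 * A + 2) / n)" for u
  proof -
    have "(\<integral>\<^sup>+y. indicator {- (2 ^ N * A) - u..2 ^ N * A - u} y * ennreal (bump y) \<partial>lborel) =
       ennreal \<bar>2 ^ N\<bar> * (\<integral>\<^sup>+z. indicator {- (2 ^ N * A) - u..2 ^ N * A - u} (- u + 2 ^ N * z) * ennreal (bump (- u + 2 ^ N * z)) \<partial>lborel)"
      by (rule nn_integral_real_affine) auto
    also have "(\<integral>\<^sup>+z. indicator {- (2 ^ N * A) - u..2 ^ N * A - u} (- u + 2 ^ N * z) * ennreal (bump (- u + 2 ^ N * z)) \<partial>lborel)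
       = (\<integral>\<^sup>+z. indicator {-A..A} z * ennreal (bump (2 ^ N * z - u)) \<partial>lborel)"
    proof (rule nn_integral_cong)
      fix z :: real
      have p: "0 < (2 :: real) ^ N" by simp
      have "- (2 ^ N * A) \<le> 2 ^ N * z \<longleftrightarrow> - A \<le> z"
        using mult_le_cancel_left_pos[OF p, of "- A" z] by simp
      moreover have "2 ^ N * z \<le> 2 ^ N * A \<longleftrightarrow> z \<le> A" by simp
      ultimately have "- u + 2 ^ N * z \<in> {- (2 ^ N * A) - u..2 ^ N * A - u} \<longleftrightarrow> z \<in> {-A..A}" by auto
      moreover have "- u + 2 ^ N * z = 2 ^ N * z - u" by simp
      ultimately show "indicator {- (2 ^ N * A) - u..2 ^ N * A - u} (- u + 2 ^ N * z) * ennreal (bump (- u + 2 ^ N * z))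
         = indicator {-A..A} z * ennreal (bump (2 ^ N * z - u))"
        unfolding indicator_def by (simp only:)
    qed
    finally have e: "ennreal (2 ^ N) * (\<integral>\<^sup>+z. indicator {-A..A} z * ennreal (bump (2 ^ N * z - u)) \<partial>lborel) =
       (\<integral>\<^sup>+y. indicator {- (2 ^ N * A) - u..2 ^ N * A - u} y * ennreal (bump y) \<partial>lborel)" by simp
    also have "\<dots> \<le> ennreal ((2 ^ N * A - u - (- (2 ^ N * A) - u)) / n + 2)"
    proof (rule bump_integral_le)
      have "0 \<le> 2 ^ N * A" using A by simp
      then show "- (2 ^ N * A) - u \<le> 2 ^ N * A - u" by linarith
    qed
    also have "\<dots> \<le> ennreal (2 ^ N * ((2 * A + 2) / n))"
    proof (rule ennreal_leI)
      \<comment> \<open>At these scales the rescaled period is at most 1, and incomplete periods at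
        the ends are absorbed.\<close>
      have "2 \<le> 2 ^ N * 2 / n" using N n_pos by (simp add: field_simps)
      then show "(2 ^ N * A - u - (- (2 ^ N * A) - u)) / n + 2 \<le> 2 ^ N * ((2 * A + 2) / n)"
        by (simp add: distrib_left add_divide_distrib mult_ac)
    qed
    also have "\<dots> = ennreal (2 ^ N) * ennreal ((2 * A + 2) / n)" using A by (intro ennreal_mult) auto
    finally show ?thesis
      by (subst (asm) ennreal_mult_le_mult_iff) (simp_all add: ennreal_eq_0_iff not_le)
  qed
  have "(mass (cball 0 M) (layer N)) = ennreal d *
     (\<integral>\<^sup>+x. \<integral>\<^sup>+z. indicator (cball 0 M) (x *\<^sub>R b1 + z *\<^sub>R e2) * ennreal (layer N (x *\<^sub>R b1 + z *\<^sub>R e2)) \<partial>lborel \<partial>lborel)"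
    using d_pos mm by (subst nn_integral_coords[where ?b1.0 = b1 and ?b2.0 = e2]) (auto simp: det_b1_e2)
  also have "\<dots> \<le> ennreal d * (\<integral>\<^sup>+x. indicator {-A..A} x * ennreal ((2 * A + 2) / n) \<partial>lborel)"
  proof (intro mult_left_mono nn_integral_mono)
    fix x
    have "(\<integral>\<^sup>+z. indicator (cball 0 M) (x *\<^sub>R b1 + z *\<^sub>R e2) * ennreal (layer N (x *\<^sub>R b1 + z *\<^sub>R e2)) \<partial>lborel)
       \<le> (\<integral>\<^sup>+z. indicator {-A..A} x * (indicator {-A..A} z * ennreal (bump (2 ^ N * z - saw n (2 ^ N * x)))) \<partial>lborel)"
    proof (rule nn_integral_mono)
      fix z
      show "indicator (cball 0 M) (x *\<^sub>R b1 + z *\<^sub>R e2) * ennreal (layer N (x *\<^sub>R b1 + z *\<^sub>R e2))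
       \<le> indicator {-A..A} x * (indicator {-A..A} z * ennreal (bump (2 ^ N * z - saw n (2 ^ N * x))))"
      proof (cases "x *\<^sub>R b1 + z *\<^sub>R e2 \<in> cball 0 M")
        case True
        then have "10 / d * norm (x *\<^sub>R b1 + z *\<^sub>R e2) \<le> A" using d_pos unfolding A_def by (intro mult_left_mono) auto
        then have "\<bar>x\<bar> \<le> A" "\<bar>z\<bar> \<le> A" using coords_bound[of "x *\<^sub>R b1 + z *\<^sub>R e2"] by auto
        then have "x \<in> {-A..A}" "z \<in> {-A..A}" by auto
        then show ?thesis using True by (simp add: layer_eq right_diff_distrib)
      qed simp
    qed
    also have "\<dots> = indicator {-A..A} x * (\<integral>\<^sup>+z. indicator {-A..A} z * ennreal (bump (2 ^ N * z - saw n (2 ^ N * x))) \<partial>lborel)"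
      by (rule nn_integral_cmult) measurable
    also have "\<dots> \<le> indicator {-A..A} x * ennreal ((2 * A + 2) / n)" by (intro mult_left_mono inner) simp
    finally show "(\<integral>\<^sup>+z. indicator (cball 0 M) (x *\<^sub>R b1 + z *\<^sub>R e2) * ennreal (layer N (x *\<^sub>R b1 + z *\<^sub>R e2)) \<partial>lborel)
       \<le> indicator {-A..A} x * ennreal ((2 * A + 2) / n)" .
  qed simp
  also have "\<dots> = ennreal d * (ennreal (2 * A) * ennreal ((2 * A + 2) / n))"
    using A by (subst nn_integral_multc) auto
  also have "\<dots> = ennreal (d * (2 * A * ((2 * A + 2) / n)))"
  proof -
    have q: "0 \<le> (2 * A + 2) / n" using A by simp
    have q2: "0 \<le> 2 * A * ((2 * A + 2) / n)" using A q by (intro mult_nonneg_nonneg) auto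
    show ?thesis unfolding ennreal_mult''[OF q2] ennreal_mult''[OF q] ..
  qed
  finally have fin: "(mass (cball 0 M) (layer N)) \<le> ennreal (d * (2 * A * ((2 * A + 2) / n)))" .
  have A2: "2 * A = 20 / d * M" by (simp add: A_def)
  from fin[unfolded A2] show ?thesis by (simp only: mult.assoc)
qed

end

section \<open>Heavy points of a single blind\<close>

context blind
begin

text \<open>The rectangles of \<open>heavy_point\<close> have area at most \<open>612 / 2 ^ k\<close> and carry mass at least \<open>d / 2 ^ k\<close>; 700 is a margin.\<close>

definition c0 :: real where "c0 = d / 700"

text \<open>Lines of slope \<open>s\<close> are the level lines of \<open>z - \<mu> * x\<close>. The
  last hypothesis puts the point in the shadow, along these lines, of the strip over one tooth of
  generation \<open>k\<close>. A rectangle of length of order \<open>z\<close> reaches from the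
  point down to the tooth; the tooth is so nearly parallel to it that width of order
  \<open>1 / (z * 2 ^ k)\<close> suffices to contain the whole strip. The area is thus of order
  \<open>1 / 2 ^ k\<close> whatever \<open>z\<close> is, as is the mass.\<close>

lemma heavy_point:
  fixes s \<mu> \<gamma> x z :: real and i :: int and k :: nat
  assumes N: "\<And>x z. (x *\<^sub>R b1 + z *\<^sub>R e2) \<bullet> dir (s + pi / 2) = \<gamma> * (z - \<mu> * x)"
    and \<gamma>: "0 < \<gamma>" "\<gamma> \<le> 1" and \<mu>: "1 \<le> \<mu>"
    and z: "1 \<le> z" "z \<le> n / 4"
    and k: "1 \<le> k" "k \<le> n" "k * (4 / n) \<le> \<mu>" "\<mu> - (real k - 1) * (4 / n) \<le> 2 / z"
    and x: "saw_upto n k (i / 2 ^ k) - \<mu> * (i / 2 ^ k) - (\<mu> - k * (4 / n)) / 2 ^ k < z - \<mu> * x"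
      "z - \<mu> * x < saw_upto n k (i / 2 ^ k) - \<mu> * (i / 2 ^ k) + 4 / n / 2 ^ k"
  shows "heavy base (100 * n) c0 s (x *\<^sub>R b1 + z *\<^sub>R e2)"
proof -
  define t where "t = 4 / real n"
  define K where "K = (2 :: real) ^ k"
  define xc where "xc = i / K"
  define \<beta> where "\<beta> = saw_upto n k xc - \<mu> * xc"
  define lo where "lo = \<beta> - (\<mu> - k * t) / K"
  \<comment> \<open>The width of the shadow in terms of \<open>z - \<mu> * x\<close>: the tilt of
    the tooth against the lines, one \<open>t / K\<close> for the finer generations and one for the
    thickness \<open>delta\<close>.\<close>
  define W where "W = (\<mu> - k * t + 2 * t) / K"
  have t: "0 < t" "t \<le> 1" "t \<le> 1 / z" using n_pos z by (auto simp: t_def field_simps)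
  have K: "1 \<le> K" by (simp add: K_def)
  have nn: "4 \<le> real n" using n_pos by simp
  have W0: "0 < W"
  proof -
    have "k * t \<le> \<mu>" using k(3) by (simp add: t_def)
    then have "0 < \<mu> - k * t + 2 * t" using t by linarith
    then show ?thesis unfolding W_def using K by (intro divide_pos_pos) auto
  qed
  have "(\<mu> - k * t + 2 * t) \<le> 3 / z"
    using k(4) t(3) by (simp add: t_def[symmetric] left_diff_distrib add_divide_distrib)
  then have W1: "W \<le> 3 / z / K" unfolding W_def using K by (intro divide_right_mono) auto
  have "3 / z / K \<le> 3 / z" using K z by (simp add: field_simps)
  also have "3 / z \<le> 3" using z by (simp add: field_simps)
  finally have W3: "W \<le> 3" using W1 by linarith
  have hi: "\<beta> + 2 * t / K = lo + W"
    by (simp add: lo_def W_def add_divide_distrib diff_divide_distrib)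
  have u0: "lo < z - \<mu> * x" "z - \<mu> * x < \<beta> + t / K"
    using x by (simp_all add: lo_def \<beta>_def xc_def K_def t_def)
  have tK: "0 < t / K" using t K by simp
  have u0': "z - \<mu> * x < lo + W" using u0(2) hi tK by simp
  define L0 where "L0 = (x *\<^sub>R b1 + z *\<^sub>R e2) \<bullet> dir s"
  \<comment> \<open>The points needed differ from the given one by at most
    \<open>25 * z + 2 * z\<close> along \<open>dir s\<close>, less than half of this length. The
    side \<open>b\<close> contains the shadow with a margin \<open>W\<close> on either side, to make
    the inequalities strict.\<close>
  define a where "a = 68 * z"
  define b where "b = \<gamma> * W + 2 * W"
  define p where "p = (L0 - 34 * z) *\<^sub>R dir s + (\<gamma> * lo - W) *\<^sub>R dir (s + pi / 2)"
  have a0: "0 < a" using z by (simp add: a_def)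
  have gW: "0 < \<gamma> * W" "\<gamma> * W \<le> W" using \<gamma> W0 by auto
  have b0: "0 < b" "b \<le> 3 * W" using gW W0 by (auto simp: b_def)
  have memR: "x' *\<^sub>R b1 + z' *\<^sub>R e2 \<in> open_rect s p a b"
    if z': "0 \<le> z'" "z' \<le> 2 * z" and u': "lo \<le> z' - \<mu> * x'" "z' - \<mu> * x' \<le> lo + W" for x' z'
  proof -
    have p1: "p \<bullet> dir s = L0 - 34 * z" "p \<bullet> dir (s + pi / 2) = \<gamma> * lo - W"
      by (simp_all add: p_def inner_add_left inner_dir_dir)
    have dz: "\<bar>z' - z\<bar> \<le> 2 * z" using z' z by linarith
    have "\<bar>x' - x\<bar> \<le> \<mu> * \<bar>x' - x\<bar>" using \<mu> mult_right_mono[OF \<mu>, of "\<bar>x' - x\<bar>"] by simp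
    also have "\<dots> = \<bar>\<mu> * x' - \<mu> * x\<bar>" using \<mu> by (simp add: right_diff_distrib[symmetric] abs_mult)
    also have "\<dots> \<le> \<bar>z' - z\<bar> + W" using u' u0 u0' by linarith
    also have "\<dots> \<le> 5 * z" using dz W3 z by linarith
    finally have dx: "\<bar>x' - x\<bar> \<le> 5 * z" .
    have "\<bar>(x' *\<^sub>R b1 + z' *\<^sub>R e2) \<bullet> dir s - L0\<bar> = \<bar>((x' - x) *\<^sub>R b1 + (z' - z) *\<^sub>R e2) \<bullet> dir s\<bar>"
      by (simp add: L0_def inner_add_left inner_diff_left algebra_simps)
    also have "\<dots> \<le> norm ((x' - x) *\<^sub>R b1 + (z' - z) *\<^sub>R e2)" by (rule abs_inner_dir_le)
    also have "\<dots> \<le> \<bar>x' - x\<bar> * norm b1 + \<bar>z' - z\<bar> * norm e2"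
      by (rule order_trans[OF norm_triangle_ineq]) simp
    also have "\<dots> \<le> (5 * z) * 5 + (2 * z) * 1"
      using dx dz norm_b1 norm_e2 z by (intro add_mono mult_mono) auto
    also have "\<dots> < 34 * z" using z by simp
    finally have L: "\<bar>(x' *\<^sub>R b1 + z' *\<^sub>R e2) \<bullet> dir s - L0\<bar> < 34 * z" .
    have "\<gamma> * lo \<le> \<gamma> * (z' - \<mu> * x')" "\<gamma> * (z' - \<mu> * x') \<le> \<gamma> * (lo + W)"
      using u' \<gamma> by (auto intro!: mult_left_mono)
    then have M: "\<gamma> * lo \<le> (x' *\<^sub>R b1 + z' *\<^sub>R e2) \<bullet> dir (s + pi / 2)"
      "(x' *\<^sub>R b1 + z' *\<^sub>R e2) \<bullet> dir (s + pi / 2) \<le> \<gamma> * lo + \<gamma> * W"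
      unfolding N by (simp_all add: distrib_left)
    show ?thesis
      unfolding mem_open_rect_iff inner_diff_left p1 a_def b_def using L M W0 by (simp add: abs_less_iff)
  qed
  have x_in: "x *\<^sub>R b1 + z *\<^sub>R e2 \<in> open_rect s p a b"
    using z u0 u0' by (intro memR) auto
  have E_in: "x' *\<^sub>R b1 + (u + saw n x') *\<^sub>R e2 \<in> open_rect s p a b"
    if x': "xc \<le> x'" "x' < xc + 1 / K" and u: "0 \<le> u" "u < delta" for x' u
  proof (rule memR)
    have sb: "0 \<le> saw n x'" "saw n x' \<le> t" using saw_bounds[of n x'] by (auto simp: t_def)
    show "0 \<le> u + saw n x'" using sb u by simp
    show "u + saw n x' \<le> 2 * z" using sb u delta t z by linarith
    note sc = saw_on_cell[OF k(2) x'[unfolded xc_def K_def], folded K_def, folded xc_def t_def]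
    have e: "u + saw n x' - \<mu> * x' = \<beta> + u + (saw n x' - saw_upto n k xc - k * t * (x' - xc)) - (\<mu> - k * t) * (x' - xc)"
      by (simp add: \<beta>_def algebra_simps)
    have m0: "0 \<le> \<mu> - k * t" using k(3) by (simp add: t_def)
    have "(\<mu> - k * t) * (x' - xc) \<le> (\<mu> - k * t) * (1 / K)" using x' m0 by (intro mult_left_mono) auto
    moreover have "0 \<le> (\<mu> - k * t) * (x' - xc)" using x' m0 by simp
    moreover have "delta \<le> t / K"
    proof -
      have "K \<le> 2 ^ n" unfolding K_def using k(2) by (intro power_increasing) auto
      then show ?thesis unfolding delta_def t_def[symmetric] using t K by (intro divide_left_mono) auto
    qed
    moreover have "(\<mu> - k * t) * (1 / K) = (\<mu> - k * t) / K" "lo + W = \<beta> + t / K + t / K" using hi by simp_all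
    ultimately show "lo \<le> u + saw n x' - \<mu> * x'" "u + saw n x' - \<mu> * x' \<le> lo + W"
      unfolding e using sc u lo_def by linarith+
  qed
  define m where "m = (mass (open_rect s p a b) base)"
  \<comment> \<open>The strip over one tooth: determinant \<open>d\<close>, horizontal length
    \<open>1 / K\<close>, vertical mass 1.\<close>
  have "ennreal (d * (1 / K)) = ennreal d * (\<integral>\<^sup>+u. ennreal (1 / delta) * indicator {0..<delta} u * ennreal (1 / K) \<partial>lborel)"
  proof -
    have "(\<integral>\<^sup>+u. ennreal (1 / delta) * indicator {0..<delta} u * ennreal (1 / K) \<partial>lborel) = ennreal (1 / delta) * ennreal delta * ennreal (1 / K)"
      using delta by (subst nn_integral_multc, simp, subst nn_integral_cmult_indicator) auto
    also have "\<dots> = ennreal (1 / K)" using delta by (simp flip: ennreal_mult)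
    finally have *: "(\<integral>\<^sup>+u. ennreal (1 / delta) * indicator {0..<delta} u * ennreal (1 / K) \<partial>lborel) = ennreal (1 / K)" .
    show ?thesis unfolding * using K by (intro ennreal_mult'') simp
  qed
  also have "\<dots> \<le> ennreal d * (\<integral>\<^sup>+u. ennreal (bump u) *
     (\<integral>\<^sup>+x'. indicator (open_rect s p a b) (x' *\<^sub>R b1 + (u + saw n x') *\<^sub>R e2) \<partial>lborel) \<partial>lborel)"
  proof (intro mult_left_mono nn_integral_mono)
    fix u
    show "ennreal (1 / delta) * indicator {0..<delta} u * ennreal (1 / K) \<le> ennreal (bump u) *
     (\<integral>\<^sup>+x'. indicator (open_rect s p a b) (x' *\<^sub>R b1 + (u + saw n x') *\<^sub>R e2) \<partial>lborel)"
    proof (cases "u \<in> {0..<delta}")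
      case True
      have "ennreal (1 / K) = (\<integral>\<^sup>+x'. indicator {xc..<xc + 1 / K} x' \<partial>lborel)" using K by simp
      also have "\<dots> \<le> (\<integral>\<^sup>+x'. indicator (open_rect s p a b) (x' *\<^sub>R b1 + (u + saw n x') *\<^sub>R e2) \<partial>lborel)"
        using E_in True by (intro nn_integral_mono) (simp add: indicator_def)
      finally show ?thesis using True by (simp add: bump_eq mult_left_mono)
    qed simp
  qed simp
  also have "\<dots> = m"
    unfolding m_def base_def
    using nn_integral_shear[of b1 e2 "saw n" bump "open_rect s p a b" X Z] det_b1_e2 d_pos by simp
  finally have m1: "ennreal (d / K) \<le> m" by simp
  have "m \<le> (\<integral>\<^sup>+q. ennreal (1 / delta) * indicator (open_rect s p a b) q \<partial>lborel)"
    unfolding m_def using base_bounds(2) by (intro nn_integral_mono) (auto simp: indicator_def intro!: ennreal_leI)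
  also have "\<dots> = ennreal (1 / delta) * ennreal (a * b)"
    using emeasure_open_rect[OF a0 b0(1)] by (subst nn_integral_cmult_indicator) auto
  also have "\<dots> < top" by (simp add: ennreal_mult_less_top)
  finally have m2: "m < top" .
  have "d / K \<le> enn2real m"
  proof -
    have "enn2real (ennreal (d / K)) = d / K" using d_pos K by (intro enn2real_ennreal) simp
    then show ?thesis using enn2real_mono[OF m1 m2] by simp
  qed
  moreover have ab: "a * b \<le> 612 / K"
  proof -
    have "a * b \<le> (68 * z) * (3 * (3 / z / K))"
      unfolding a_def using b0 W1 z by (intro mult_left_mono) auto
    also have "\<dots> = 612 / K" using z by simp
    finally show ?thesis .
  qed
  moreover have "c0 * (612 / K) < d / K"
    unfolding c0_def using d_pos K by (simp add: field_simps)
  moreover have "c0 * (a * b) \<le> c0 * (612 / K)" using ab d_pos by (intro mult_left_mono) (auto simp: c0_def)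
  ultimately have "c0 * (a * b) < enn2real m" by linarith
  then have "c0 < enn2real m / (a * b)" using a0 b0 by (simp add: pos_less_divide_eq)
  then have "c0 < average base (open_rect s p a b)"
    by (simp add: average_eq_nn base_bounds a0 b0 m_def)
  moreover have "a + b < 100 * n" using z(2) b0(2) W3 nn by (simp add: a_def)
  ultimately show ?thesis unfolding heavy_def using a0 b0 x_in by blast
qed

text \<open>The angles between \<open>s\<close> and the two edges of the cone lie between
  \<open>h\<close> and \<open>3 * h\<close>, so the quotient of their sines lies between 1/3 and 3.
  Subtracting it from 4 gives \<open>\<mu>\<close>.\<close>

lemma slope:
  assumes s: "s \<in> {c - h..c + h}"
  obtains \<mu> \<gamma> where "0 < \<gamma>" "\<gamma> \<le> 1" "1 \<le> \<mu>" "\<mu> \<le> 11 / 3"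
    "\<And>x z. (x *\<^sub>R b1 + z *\<^sub>R e2) \<bullet> dir (s + pi / 2) = \<gamma> * (z - \<mu> * x)"
proof -
  define \<gamma> where "\<gamma> = sin (s - c + 2 * h)"
  define \<alpha> where "\<alpha> = sin (c + 2 * h - s)"
  have sh: "0 < sin h" using h pi_gt3 by (intro sin_gt_zero) auto
  have rng: "sin h \<le> sin y" "sin y \<le> 3 * sin h" if "h \<le> y" "y \<le> 3 * h" for y
  proof -
    have y2: "3 * h \<le> pi / 2" using h pi_gt3 by simp
    show "sin h \<le> sin y" using that y2 h by (intro sin_monotone_2pi_le) auto
    have "sin y \<le> sin (3 * h)" using that y2 h by (intro sin_monotone_2pi_le) auto
    also have "\<dots> \<le> 3 * sin h" using h pi_gt3 by (intro sin_triple_le) auto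
    finally show "sin y \<le> 3 * sin h" .
  qed
  have g: "sin h \<le> \<gamma>" "\<gamma> \<le> 3 * sin h" and a: "sin h \<le> \<alpha>" "\<alpha> \<le> 3 * sin h"
    unfolding \<gamma>_def \<alpha>_def using s by (auto intro!: rng)
  have g0: "0 < \<gamma>" using g sh by linarith
  show ?thesis
  proof (rule that[of \<gamma> "4 - \<alpha> / \<gamma>"])
    show "0 < \<gamma>" "\<gamma> \<le> 1" using g0 by (auto simp: \<gamma>_def)
    show "1 \<le> 4 - \<alpha> / \<gamma>" "4 - \<alpha> / \<gamma> \<le> 11 / 3" using a g g0 by (auto simp: field_simps)
    fix x z
    have "sin (c - 2 * h - s) = - \<gamma>" unfolding \<gamma>_def sin_minus[symmetric] by (rule arg_cong[where f = sin]) simp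
    then have "(x *\<^sub>R b1 + z *\<^sub>R e2) \<bullet> dir (s + pi / 2) = x * (\<alpha> - 4 * \<gamma>) + z * \<gamma>"
      by (simp add: b1_def e2_def inner_add_left inner_dir_perp \<alpha>_def algebra_simps)
    also have "\<dots> = \<gamma> * (z - (4 - \<alpha> / \<gamma>) * x)" using g0 by (simp add: field_simps)
    finally show "(x *\<^sub>R b1 + z *\<^sub>R e2) \<bullet> dir (s + pi / 2) = \<gamma> * (z - (4 - \<alpha> / \<gamma>) * x)" .
  qed
qed

text \<open>In one period there are \<open>2 ^ k\<close> teeth of generation \<open>k\<close>, whose
  shadows at height \<open>z\<close> are disjoint intervals of length \<open>L\<close>. Together
  they fill the proportion \<open>(\<mu> - (k - 1) * t) / \<mu>\<close>, at least
  \<open>(1 / z) / 4\<close> by the choice of \<open>k\<close>.\<close>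

lemma heavy_row:
  assumes s: "s \<in> {c - h..c + h}" and z: "1 \<le> z" "z \<le> n / 4"
  shows "ennreal (1 / (4 * z)) \<le> (\<integral>\<^sup>+x. indicator ({p. heavy base (100 * n) c0 s p} \<inter> cell0) (x *\<^sub>R b1 + z *\<^sub>R e2) \<partial>lborel)"
proof -
  obtain \<mu> \<gamma> where \<gamma>: "0 < \<gamma>" "\<gamma> \<le> 1" and \<mu>: "1 \<le> \<mu>" "\<mu> \<le> 11 / 3"
    and N: "\<And>x z. (x *\<^sub>R b1 + z *\<^sub>R e2) \<bullet> dir (s + pi / 2) = \<gamma> * (z - \<mu> * x)"
    by (rule slope[OF s]) blast
  define t where "t = 4 / real n"
  have t: "0 < t" "t \<le> 1 / z" using n_pos z by (auto simp: t_def field_simps)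
  have z1: "1 / z \<le> 1" "0 < 1 / z" using z by (auto simp: field_simps)
  \<comment> \<open>The least generation whose slope \<open>k * t\<close> exceeds
    \<open>\<mu> - 1 / z\<close>. As \<open>t \<le> 1 / z\<close>, it does not exceed
    \<open>\<mu>\<close>: the teeth are flatter than the lines, by less than
    \<open>1 / z\<close>.\<close>
  define k where "k = nat (\<lfloor>(\<mu> - 1 / z) / t\<rfloor> + 1)"
  have "0 \<le> (\<mu> - 1 / z) / t" using \<mu> z1 t by (intro divide_nonneg_nonneg) linarith+
  then have fl0: "0 \<le> \<lfloor>(\<mu> - 1 / z) / t\<rfloor>" by (simp only: zero_le_floor)
  then have k1: "1 \<le> k" and rk: "real k - 1 = of_int \<lfloor>(\<mu> - 1 / z) / t\<rfloor>" by (auto simp: k_def nat_add_distrib)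
  have "real k - 1 \<le> (\<mu> - 1 / z) / t" "(\<mu> - 1 / z) / t < real k" unfolding rk using rk by linarith+
  then have kt: "(real k - 1) * t \<le> \<mu> - 1 / z" "\<mu> - 1 / z < real k * t"
    using t by (auto simp: pos_le_divide_eq pos_divide_less_eq)
  then have k3: "k * t \<le> \<mu>" and k4: "\<mu> - (real k - 1) * t \<le> 2 / z" "1 / z \<le> \<mu> - (real k - 1) * t"
    using t by (auto simp: left_diff_distrib)
  have k2: "k \<le> n"
  proof (rule ccontr)
    assume "\<not> k \<le> n"
    then have "real n * t \<le> k * t" using t by (intro mult_right_mono) auto
    then show False using k3 \<mu> n_pos by (simp add: t_def)
  qed
  define K where "K = (2 :: real) ^ k"
  have K: "0 < K" by (simp add: K_def)
  define \<beta> where "\<beta> = (\<lambda>i::int. saw_upto n k (i / K) - \<mu> * (i / K))"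
  \<comment> \<open>At \<open>x = l i\<close> the level line through height \<open>z\<close> passes
    along the top of the shadow of tooth \<open>i\<close>, at \<open>x = l i + L\<close> along its
    bottom. By \<open>saw_upto_next_cell\<close> the value \<open>\<beta>\<close> drops from tooth
    to tooth by at least the height of a shadow, which is \<open>step\<close>.\<close>
  define l where "l = (\<lambda>i::int. (z - \<beta> i - t / K) / \<mu>)"
  define L where "L = (\<mu> - (real k - 1) * t) / K / \<mu>"
  have A0: "0 < \<mu> - (real k - 1) * t" using k4(2) z1 by linarith
  have L0: "0 < L" unfolding L_def using A0 K \<mu> by simp
  have step: "l i + L \<le> l (i + 1)" for i
  proof -
    have b: "\<beta> (i + 1) \<le> \<beta> i - (\<mu> - (real k - 1) * t) / K"
      using saw_upto_next_cell[OF k1, of n i] by (simp add: \<beta>_def K_def t_def add_divide_distrib diff_divide_distrib distrib_left)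
    have "l i + L = (z - (\<beta> i - (\<mu> - (real k - 1) * t) / K) - t / K) / \<mu>"
      by (simp add: l_def L_def add_divide_distrib diff_divide_distrib)
    also have "\<dots> \<le> l (i + 1)" unfolding l_def using b \<mu> by (intro divide_right_mono) auto
    finally show ?thesis .
  qed
  have per: "l (i + int (2 ^ k)) = l i + 1" for i
  proof -
    have "(i + int (2 ^ k)) / K = i / K + of_int 1" using K by (simp add: K_def add_divide_distrib)
    then have "\<beta> (i + int (2 ^ k)) = \<beta> i - \<mu>"
      unfolding \<beta>_def by (simp only: saw_upto_periodic) (simp add: algebra_simps)
    then show ?thesis using \<mu> by (simp add: l_def add_divide_distrib diff_divide_distrib)
  qed
  have "1 / (4 * z) \<le> (2 ^ k) * L"
  proof -
    have "2 ^ k * L = (\<mu> - (real k - 1) * t) / \<mu>" by (simp add: L_def K_def)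
    also have "\<dots> \<ge> (1 / z) / \<mu>" using k4 \<mu> by (intro divide_right_mono) auto
    also have "(1 / z) / \<mu> \<ge> (1 / z) / 4" using \<mu> z by (intro divide_left_mono) auto
    finally show ?thesis by simp
  qed
  then have "ennreal (1 / (4 * z)) \<le> ennreal (real (2 ^ k) * L)" by (intro ennreal_leI) simp
  also have "\<dots> \<le> emeasure lborel ((\<Union>i. {l i<..<l i + L}) \<inter> {0..<1})"
    by (rule periodic_intervals[OF L0 step per])
  also have "\<dots> = (\<integral>\<^sup>+x. indicator ((\<Union>i. {l i<..<l i + L}) \<inter> {0..<1}) x \<partial>lborel)"
    by (subst nn_integral_indicator) auto
  also have "\<dots> \<le> (\<integral>\<^sup>+x. indicator ({p. heavy base (100 * n) c0 s p} \<inter> cell0) (x *\<^sub>R b1 + z *\<^sub>R e2) \<partial>lborel)"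
  proof (rule nn_integral_mono)
    fix x
    have "x *\<^sub>R b1 + z *\<^sub>R e2 \<in> {p. heavy base (100 * n) c0 s p} \<inter> cell0"
      if x: "x \<in> (\<Union>i. {l i<..<l i + L}) \<inter> {0..<1}"
    proof -
      obtain i where i: "l i < x" "x < l i + L" using x by auto
      have e1: "\<mu> * l i = z - \<beta> i - t / K" using \<mu> by (simp add: l_def)
      have e2: "\<mu> * (l i + L) = z - \<beta> i + (\<mu> - k * t) / K"
      proof -
        have "\<mu> * L = (\<mu> - (real k - 1) * t) / K" using \<mu> by (simp add: L_def)
        then show ?thesis
          by (simp only: distrib_left e1) (simp add: left_diff_distrib add_divide_distrib diff_divide_distrib)
      qed
      have "\<mu> * l i < \<mu> * x" "\<mu> * x < \<mu> * (l i + L)" using i \<mu> by auto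
      then have "\<beta> i - (\<mu> - k * t) / K < z - \<mu> * x" "z - \<mu> * x < \<beta> i + t / K" unfolding e1 e2 by linarith+
      then have "heavy base (100 * n) c0 s (x *\<^sub>R b1 + z *\<^sub>R e2)"
        using k1 k2 k3 k4 by (intro heavy_point[OF N \<gamma> \<mu>(1) z, of k i]) (auto simp: \<beta>_def K_def t_def)
      moreover have "x *\<^sub>R b1 + z *\<^sub>R e2 \<in> cell0" using x z n_pos by (simp add: cell0_def)
      ultimately show ?thesis by simp
    qed
    then show "(indicator ((\<Union>i. {l i<..<l i + L}) \<inter> {0..<1}) x :: ennreal) \<le>
        indicator ({p. heavy base (100 * n) c0 s p} \<inter> cell0) (x *\<^sub>R b1 + z *\<^sub>R e2)"
      by (simp add: indicator_def)
  qed
  finally show ?thesis .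
qed

lemma base_integrable_cball: "set_integrable lebesgue (cball 0 r) base"
proof -
  have [measurable]: "cball (0 :: real ^ 2) r \<in> sets borel" by simp
  have "integrable lborel (\<lambda>x. indicator (cball 0 r) x *\<^sub>R base x)"
  proof (rule integrableI_bounded_set_indicator[where B = "1 / delta"])
    show "AE x in lborel. x \<in> cball 0 r \<longrightarrow> norm (base x) \<le> 1 / delta" using base_bounds by simp
    show "emeasure lborel (cball (0 :: real ^ 2) r) < \<infinity>" by (rule emeasure_lborel_cball_finite)
  qed simp_all
  then show ?thesis unfolding set_integrable_def by (rule integrable_completion[THEN iffD2, rotated]) simp
qed

lemma measure_cell0: "measure lebesgue cell0 = n * d"
proof -
  have "emeasure lborel cell0 = (\<integral>\<^sup>+p. indicator cell0 p \<partial>lborel)" using cell0_borel by simp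
  also have "\<dots> = ennreal d * (\<integral>\<^sup>+x. \<integral>\<^sup>+z. indicator cell0 (x *\<^sub>R b1 + z *\<^sub>R e2) \<partial>lborel \<partial>lborel)"
    using d_pos cell0_borel by (subst nn_integral_coords[where ?b1.0 = b1 and ?b2.0 = e2]) (auto simp: det_b1_e2)
  also have "(\<integral>\<^sup>+x. \<integral>\<^sup>+z. indicator cell0 (x *\<^sub>R b1 + z *\<^sub>R e2) \<partial>lborel \<partial>lborel) =
      (\<integral>\<^sup>+x. \<integral>\<^sup>+z. indicator {0..<1} x * indicator {0..<real n} z \<partial>lborel \<partial>(lborel :: real measure))"
  proof (intro nn_integral_cong)
    fix x z :: real
    have "0 \<le> z / n \<longleftrightarrow> 0 \<le> z" "z / n < 1 \<longleftrightarrow> z < n" using n_pos by (auto simp: zero_le_divide_iff)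
    then show "indicator cell0 (x *\<^sub>R b1 + z *\<^sub>R e2) = (indicator {0..<1} x * indicator {0..<real n} z :: ennreal)"
      by (simp add: cell0_def indicator_def)
  qed
  also have "\<dots> = ennreal n" by (simp add: nn_integral_cmult nn_integral_multc)
  also have "ennreal d * ennreal n = ennreal (n * d)" using d_pos by (simp add: ennreal_mult mult.commute)
  finally have "emeasure lebesgue cell0 = ennreal (n * d)" using cell0_borel by simp
  then show ?thesis using d_pos by (simp add: measure_def)
qed

text \<open>The integral of \<open>1 / (4 * z)\<close> for \<open>z\<close> from 1 to
  \<open>n / 4\<close>. It is to be compared with the area \<open>n * d\<close> of the cell.\<close>

lemma heavy_density:
  assumes s: "s \<in> {c - h..c + h}"
  shows "d * (ln (n / 4) / 4) \<le> measure lebesgue ({p. heavy base (100 * n) c0 s p} \<inter> cell0)" (is "_ \<le> measure lebesgue ?S")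
proof -
  define S where "S = ?S"
  have So [measurable]: "S \<in> sets borel"
    unfolding S_def
    using sets.Int[OF borel_open[OF open_heavy_section[OF base_integrable_cball, of "100 * n" c0 s]] cell0_borel] by simp
  have ln: "(\<integral>\<^sup>+z. ennreal (1 / (4 * z)) * indicator {1..real n / 4} z \<partial>lborel) = ennreal (ln (n / 4) / 4 - ln 1 / 4)"
    by (rule nn_integral_FTC_Icc) (use n_pos in \<open>auto intro!: derivative_eq_intros simp: field_simps\<close>)
  have "ennreal (d * (ln (n / 4) / 4)) = ennreal d * (\<integral>\<^sup>+z. ennreal (1 / (4 * z)) * indicator {1..real n / 4} z \<partial>lborel)"
  proof -
    have "1 \<le> real n / 4" using n_pos by simp
    then have "0 \<le> ln (real n / 4) / 4" by (simp add: ln_ge_zero)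
    from ennreal_mult''[OF this, of d] show ?thesis unfolding ln by simp
  qed
  also have "\<dots> \<le> ennreal d * (\<integral>\<^sup>+z. \<integral>\<^sup>+x. indicator S (x *\<^sub>R b1 + z *\<^sub>R e2) \<partial>lborel \<partial>lborel)"
    unfolding S_def using heavy_row[OF s] by (intro mult_left_mono nn_integral_mono) (auto simp: indicator_def)
  also have "(\<integral>\<^sup>+z. \<integral>\<^sup>+x. indicator S (x *\<^sub>R b1 + z *\<^sub>R e2) \<partial>lborel \<partial>lborel) =
      (\<integral>\<^sup>+x. \<integral>\<^sup>+z. indicator S (x *\<^sub>R b1 + z *\<^sub>R e2) \<partial>lborel \<partial>lborel)"
    by (intro lborel_pair.Fubini') measurable
  also have "ennreal d * \<dots> = (\<integral>\<^sup>+p. indicator S p \<partial>lborel)"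
    using d_pos So by (subst nn_integral_coords[where ?b1.0 = b1 and ?b2.0 = e2]) (auto simp: det_b1_e2)
  also have "\<dots> = emeasure lebesgue S" using So by simp
  also have "\<dots> = ennreal (measure lebesgue S)"
    using So by (intro emeasure_eq_measure2 bounded_set_imp_lmeasurable bounded_subset[OF bounded_cell0]) (auto simp: S_def)
  finally show ?thesis by (simp add: ennreal_le_iff S_def)
qed

end

section \<open>Behaviour of heaviness under translation, dilation and domination\<close>

lemma nn_integral_translate:
  fixes g :: "real ^ 2 \<Rightarrow> ennreal"
  assumes "g \<in> borel_measurable borel"
  shows "(\<integral>\<^sup>+x. g (v + x) \<partial>lborel) = (\<integral>\<^sup>+x. g x \<partial>lborel)"
proof -
  have "(\<integral>\<^sup>+x. g x \<partial>lborel) = (\<integral>\<^sup>+x. g x \<partial>distr lborel borel ((+) v))" by (simp add: lborel_distr_plus)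
  also have "\<dots> = (\<integral>\<^sup>+x. g (v + x) \<partial>lborel)" using assms by (intro nn_integral_distr) auto
  finally show ?thesis ..
qed

lemma nn_integral_scale:
  fixes g :: "real ^ 2 \<Rightarrow> ennreal"
  assumes g: "g \<in> borel_measurable borel" and t: "0 < t"
  shows "(\<integral>\<^sup>+x. g x \<partial>lborel) = ennreal (t * t) * (\<integral>\<^sup>+x. g (t *\<^sub>R x) \<partial>lborel)"
proof -
  let ?a = "dir 0" and ?b = "dir (pi / 2)"
  have d1: "det2 ?a ?b = 1" by (simp add: det2_dir)
  have d2: "det2 (t *\<^sub>R ?a) (t *\<^sub>R ?b) = t * t"
  proof -
    have "det2 (t *\<^sub>R ?a) (t *\<^sub>R ?b) = t * t * det2 ?a ?b" by (simp add: det2_def algebra_simps)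
    then show ?thesis by (simp add: d1)
  qed
  have m: "(\<lambda>x. g (t *\<^sub>R x)) \<in> borel_measurable borel" using g by measurable
  have "(\<integral>\<^sup>+x. g x \<partial>lborel) = ennreal \<bar>t * t\<bar> * (\<integral>\<^sup>+x. \<integral>\<^sup>+z. g (x *\<^sub>R t *\<^sub>R ?a + z *\<^sub>R t *\<^sub>R ?b) \<partial>lborel \<partial>lborel)"
    using nn_integral_coords[OF _ g, of "t *\<^sub>R ?a" "t *\<^sub>R ?b"] t unfolding d2 by simp
  also have "(\<integral>\<^sup>+x. \<integral>\<^sup>+z. g (x *\<^sub>R t *\<^sub>R ?a + z *\<^sub>R t *\<^sub>R ?b) \<partial>lborel \<partial>lborel) =
      (\<integral>\<^sup>+x. \<integral>\<^sup>+z. g (t *\<^sub>R (x *\<^sub>R ?a + z *\<^sub>R ?b)) \<partial>lborel \<partial>lborel)"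
    by (simp add: scaleR_add_right mult.commute)
  also have "\<dots> = (\<integral>\<^sup>+x. g (t *\<^sub>R x) \<partial>lborel)"
    using nn_integral_coords[OF _ m, of ?a ?b] unfolding d1 by simp
  finally show ?thesis using t by simp
qed

lemma heavy_translate:
  assumes f: "f \<in> borel_measurable borel" "\<And>x. 0 \<le> f x" and per: "\<And>x. f (x + v) = f x"
    and H: "heavy f e l s x"
  shows "heavy f e l s (x + v)"
proof -
  note [measurable] = f(1)
  obtain p a b where *: "0 < a" "0 < b" "a + b < e" "x \<in> open_rect s p a b" "l < average f (open_rect s p a b)"
    using H unfolding heavy_def by blast
  have m: "(\<lambda>x. indicator (open_rect s (p + v) a b) x * ennreal (f x)) \<in> borel_measurable borel" by measurable
  have "(mass (open_rect s (p + v) a b) f) =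
      (\<integral>\<^sup>+x. indicator (open_rect s (p + v) a b) (v + x) * ennreal (f (v + x)) \<partial>lborel)"
    by (rule nn_integral_translate[OF m, symmetric])
  also have "\<dots> = (mass (open_rect s p a b) f)"
  proof (rule nn_integral_cong)
    fix x
    have "f (v + x) = f x" using per[of x] by (simp add: add.commute)
    moreover have "v + x \<in> open_rect s (p + v) a b \<longleftrightarrow> x \<in> open_rect s p a b"
      unfolding mem_open_rect_iff by (simp add: algebra_simps)
    ultimately show "indicator (open_rect s (p + v) a b) (v + x) * ennreal (f (v + x)) = indicator (open_rect s p a b) x * ennreal (f x)"
      by (simp add: indicator_def)
  qed
  finally have "average f (open_rect s (p + v) a b) = average f (open_rect s p a b)"
    using f * by (simp add: average_eq_nn)
  moreover have "x + v \<in> open_rect s (p + v) a b"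
    using *(4) unfolding mem_open_rect_iff by simp
  ultimately show ?thesis using * unfolding heavy_def by metis
qed

lemma heavy_scale:
  assumes f: "f \<in> borel_measurable borel" "\<And>x. 0 \<le> f x" and t: "0 < t"
    and H: "heavy f e l s (t *\<^sub>R x)"
  shows "heavy (\<lambda>x. f (t *\<^sub>R x)) (e / t) l s x"
proof -
  note [measurable] = f(1)
  obtain p a b where *: "0 < a" "0 < b" "a + b < e" "t *\<^sub>R x \<in> open_rect s p a b" "l < average f (open_rect s p a b)"
    using H unfolding heavy_def by blast
  have mem: "t *\<^sub>R y \<in> open_rect s p a b \<longleftrightarrow> y \<in> open_rect s ((1 / t) *\<^sub>R p) (a / t) (b / t)" for y
  proof -
    have e: "(t *\<^sub>R y - p) \<bullet> v = t * ((y - (1 / t) *\<^sub>R p) \<bullet> v)" for v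
      using t by (simp add: inner_diff_left right_diff_distrib)
    show ?thesis
      unfolding mem_open_rect_iff e using t
      by (simp add: zero_less_mult_iff less_divide_eq mult.commute[of t])
  qed
  have mf: "(\<lambda>x. f (t *\<^sub>R x)) \<in> borel_measurable borel" by measurable
  define I where "I = (\<integral>\<^sup>+x. indicator (open_rect s ((1 / t) *\<^sub>R p) (a / t) (b / t)) x * ennreal (f (t *\<^sub>R x)) \<partial>lborel)"
  have "(mass (open_rect s p a b) f) =
      ennreal (t * t) * (\<integral>\<^sup>+x. indicator (open_rect s p a b) (t *\<^sub>R x) * ennreal (f (t *\<^sub>R x)) \<partial>lborel)"
    by (rule nn_integral_scale[OF _ t]) measurable
  also have "(\<integral>\<^sup>+x. indicator (open_rect s p a b) (t *\<^sub>R x) * ennreal (f (t *\<^sub>R x)) \<partial>lborel) = I"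
    unfolding I_def by (intro nn_integral_cong) (simp add: indicator_def mem)
  finally have "average f (open_rect s p a b) = (t * t) * enn2real I / (a * b)"
    using f * t by (simp add: average_eq_nn enn2real_mult)
  also have "\<dots> = enn2real I / ((a / t) * (b / t))" using t by simp
  also have "\<dots> = average (\<lambda>x. f (t *\<^sub>R x)) (open_rect s ((1 / t) *\<^sub>R p) (a / t) (b / t))"
    using f * t by (simp add: average_eq_nn[OF mf] I_def)
  finally have "l < average (\<lambda>x. f (t *\<^sub>R x)) (open_rect s ((1 / t) *\<^sub>R p) (a / t) (b / t))" using * by simp
  moreover have "a / t + b / t < e / t" using *(3) t by (simp add: add_divide_distrib[symmetric] divide_strict_right_mono)
  moreover have "0 < a / t" "0 < b / t" using * t by auto
  ultimately show ?thesis unfolding heavy_def using mem[of x] *(4) by blast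
qed

text \<open>The bound \<open>B\<close> keeps the larger integral finite, without which
  \<open>enn2real\<close> would not be monotone.\<close>

lemma average_mono_mult:
  assumes f: "f \<in> borel_measurable borel" "\<And>x. 0 \<le> f x" "\<And>x. f x \<le> B"
    and g: "g \<in> borel_measurable borel" "\<And>x. 0 \<le> g x"
    and ab: "0 < a" "0 < b" and r: "0 \<le> r" and le: "\<And>x. x \<in> open_rect s p a b \<Longrightarrow> r * g x \<le> f x"
  shows "r * average g (open_rect s p a b) \<le> average f (open_rect s p a b)"
proof -
  note [measurable] = f(1) g(1)
  have "ennreal r * (mass (open_rect s p a b) g) =
      (\<integral>\<^sup>+x. ennreal r * (indicator (open_rect s p a b) x * ennreal (g x)) \<partial>lborel)"
    by (rule nn_integral_cmult[symmetric]) measurable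
  also have "\<dots> \<le> (mass (open_rect s p a b) f)"
    using le r g by (intro nn_integral_mono) (auto simp: indicator_def ennreal_mult[symmetric] intro!: ennreal_leI)
  finally have 1: "ennreal r * (mass (open_rect s p a b) g) \<le>
      (mass (open_rect s p a b) f)" .
  have "(mass (open_rect s p a b) f) \<le>
      (\<integral>\<^sup>+x. ennreal B * indicator (open_rect s p a b) x \<partial>lborel)"
    using f(3) by (intro nn_integral_mono) (auto simp: indicator_def intro!: ennreal_leI)
  also have "\<dots> = ennreal B * ennreal (a * b)"
    using emeasure_open_rect[OF ab] by (subst nn_integral_cmult_indicator) auto
  also have "\<dots> < top" by (simp add: ennreal_mult_less_top)
  finally have "enn2real (ennreal r * (mass (open_rect s p a b) g)) \<le>
      enn2real (mass (open_rect s p a b) f)"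
    by (rule enn2real_mono[OF 1])
  then show ?thesis
    using f g ab r by (simp add: average_eq_nn enn2real_mult divide_right_mono)
qed

section \<open>Continuity of the layers almost everywhere\<close>

lemma countable_AE_not_in: "countable (A :: real set) \<Longrightarrow> AE x in lborel. x \<notin> A"
  by (rule AE_not_in) (rule countable_imp_null_set_lborel)

lemma countable_affine_Ints: "r \<noteq> 0 \<Longrightarrow> countable {z :: real. r * z - u \<in> \<int>}"
proof -
  assume r: "r \<noteq> 0"
  have "{z. r * z - u \<in> \<int>} \<subseteq> (\<lambda>i::int. (of_int i + u) / r) ` UNIV"
  proof
    fix z assume "z \<in> {z. r * z - u \<in> \<int>}"
    then obtain i where "r * z - u = of_int i" by (auto elim: Ints_cases)
    then have "z = (of_int i + u) / r" using r by (simp add: field_simps)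
    then show "z \<in> (\<lambda>i::int. (of_int i + u) / r) ` UNIV" by blast
  qed
  then show ?thesis by (rule countable_subset) simp
qed

lemma isCont_saw:
  assumes "\<And>j. j \<le> n \<Longrightarrow> 2 ^ j * x \<notin> (\<int> :: real set)"
  shows "isCont (saw n) x"
  unfolding saw_def saw_upto_def[abs_def]
proof (rule continuous_sum)
  fix j assume "j \<in> {1..n}"
  then have "isCont frac (2 ^ j * x)" using assms by (intro continuous_frac) auto
  then have "isCont (\<lambda>x. frac (2 ^ j * x)) x"
    by (rule isCont_o2[rotated]) (intro continuous_intros)
  then have "isCont (\<lambda>x. 4 / real n / 2 ^ j * frac (2 ^ j * x)) x" by (intro continuous_mult continuous_const)
  then show "isCont (\<lambda>x. 4 / real n * frac (2 ^ j * x) / 2 ^ j) x" by simp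
qed

context blind
begin

lemma isCont_bump:
  assumes y: "y / n \<notin> \<int>" "(y - delta) / n \<notin> \<int>"
  shows "isCont bump y"
proof -
  have "isCont (\<lambda>y. y / real n) y" using n_pos by (auto intro!: continuous_intros)
  then have "isCont (\<lambda>y. frac (y / n)) y"
    by (rule isCont_o2) (rule continuous_frac[OF y(1)])
  then have lim: "((\<lambda>y. frac (y / n)) \<longlongrightarrow> frac (y / n)) (at y)" by (simp add: isCont_def)
  have ne: "frac (y / n) \<noteq> delta / n"
  proof
    assume "frac (y / n) = delta / n"
    then have "(y - delta) / n = of_int \<lfloor>y / n\<rfloor>" by (simp add: frac_def diff_divide_distrib)
    then show False using y(2) by simp
  qed
  have "eventually (\<lambda>z. bump z = bump y) (at y)"
  proof (cases "frac (y / n) < delta / n")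
    case True
    from order_tendstoD(2)[OF lim True] show ?thesis by eventually_elim (use True in \<open>simp add: bump_def\<close>)
  next
    case False
    then have "delta / n < frac (y / n)" using ne by simp
    from order_tendstoD(1)[OF lim this] show ?thesis by eventually_elim (use False in \<open>simp add: bump_def\<close>)
  qed
  then show ?thesis unfolding isCont_def by (rule tendsto_eventually)
qed

lemma AE_coords:
  assumes B [measurable]: "Measurable.pred borel P"
    and ae: "AE x in lborel. AE z in lborel. P (x *\<^sub>R b1 + z *\<^sub>R e2)"
  shows "AE p in lborel. P p"
proof -
  have "(\<integral>\<^sup>+p. indicator {p. \<not> P p} p \<partial>lborel) = ennreal \<bar>det2 b1 e2\<bar> *
     (\<integral>\<^sup>+x. \<integral>\<^sup>+z. indicator {p. \<not> P p} (x *\<^sub>R b1 + z *\<^sub>R e2) \<partial>lborel \<partial>lborel)"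
    by (rule nn_integral_coords) (use det_b1_e2 d_pos in auto)
  also have "(\<integral>\<^sup>+x. \<integral>\<^sup>+z. indicator {p. \<not> P p} (x *\<^sub>R b1 + z *\<^sub>R e2) \<partial>lborel \<partial>lborel) = (\<integral>\<^sup>+x. 0 \<partial>(lborel :: real measure))"
  proof (rule nn_integral_cong_AE)
    show "AE x in lborel. (\<integral>\<^sup>+z. indicator {p. \<not> P p} (x *\<^sub>R b1 + z *\<^sub>R e2) \<partial>lborel) = 0"
      using ae
    proof eventually_elim
      case (elim x)
      have "(\<integral>\<^sup>+z. indicator {p. \<not> P p} (x *\<^sub>R b1 + z *\<^sub>R e2) \<partial>lborel) = (\<integral>\<^sup>+z. 0 \<partial>(lborel :: real measure))"
        by (rule nn_integral_cong_AE) (use elim in \<open>eventually_elim, simp\<close>)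
      then show ?case by simp
    qed
  qed
  finally have "emeasure lborel {p. \<not> P p} = 0" by simp
  then show ?thesis by (intro AE_I[where N = "{p. \<not> P p}"]) auto
qed

text \<open>Discontinuities come from the jumps of \<open>saw\<close>, which occupy countably many
  \<open>x\<close>, and from the two edges of the strip, which for any other \<open>x\<close> occupy
  countably many \<open>z\<close>; Tonelli makes their union null.\<close>

lemma AE_isCont_layer: "AE p in lborel. isCont (layer N) p"
proof -
  have [measurable]: "(\<int> :: real set) \<in> sets borel" by (intro borel_closed closed_Ints)
  \<comment> \<open>Excluding the finest dyadic points excludes those of all coarser generations as
    well.\<close>
  define P where "P = (\<lambda>p. 2 ^ n * (2 ^ N * X p) \<notin> \<int> \<and>
     (2 ^ N * Z p - saw n (2 ^ N * X p)) / n \<notin> \<int> \<and> ((2 ^ N * Z p - saw n (2 ^ N * X p)) - delta) / n \<notin> \<int>)"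
  have "AE p in lborel. P p"
  proof (rule AE_coords)
    show "Measurable.pred borel P" unfolding P_def by measurable
    have "AE x in lborel. x \<notin> {x. (2 ^ n * 2 ^ N) * x - 0 \<in> (\<int> :: real set)}"
      by (intro countable_AE_not_in countable_affine_Ints) simp
    then show "AE x in lborel. AE z in lborel. P (x *\<^sub>R b1 + z *\<^sub>R e2)"
    proof eventually_elim
      case (elim x)
      have "AE z in lborel. z \<notin> {z. (2 ^ N / n) * z - saw n (2 ^ N * x) / n \<in> (\<int> :: real set)}"
        "AE z in lborel. z \<notin> {z. (2 ^ N / n) * z - (saw n (2 ^ N * x) + delta) / n \<in> (\<int> :: real set)}"
        by (intro countable_AE_not_in countable_affine_Ints, use n_pos in simp)+
      then show ?case
        by eventually_elim (use elim in \<open>simp add: P_def diff_divide_distrib add_divide_distrib mult.assoc diff_diff_eq\<close>)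
    qed
  qed
  then show ?thesis
  proof eventually_elim
    case (elim p)
    have "2 ^ j * (2 ^ N * X p) \<notin> \<int>" if "j \<le> n" for j
    proof
      assume "2 ^ j * (2 ^ N * X p) \<in> \<int>"
      moreover have "(2 :: real) ^ (n - j) \<in> \<int>" by simp
      ultimately have "2 ^ (n - j) * (2 ^ j * (2 ^ N * X p)) \<in> \<int>" by (rule Ints_mult[rotated])
      moreover have "2 ^ (n - j) * (2 ^ j * (2 ^ N * X p)) = 2 ^ n * (2 ^ N * X p)"
        using that by (simp add: mult.assoc[symmetric] power_add[symmetric])
      ultimately show False using elim by (simp add: P_def)
    qed
    then have s: "isCont (saw n) (2 ^ N * X p)" by (rule isCont_saw)
    have X: "isCont X p" "isCont Z p"
      using continuous_X[of UNIV] continuous_Y[of UNIV] unfolding Z_def[abs_def]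
      by (auto simp: continuous_on_eq_continuous_at intro!: continuous_intros)
    have "isCont (\<lambda>q. 2 ^ N * X q) p" by (intro continuous_intros X)
    then have "isCont (\<lambda>q. saw n (2 ^ N * X q)) p" by (rule isCont_o2) (rule s)
    then have "isCont (\<lambda>q. 2 ^ N * Z q - saw n (2 ^ N * X q)) p"
      by (intro continuous_intros X)
    then have "isCont (\<lambda>q. bump (2 ^ N * Z q - saw n (2 ^ N * X q))) p"
      by (rule isCont_o2) (use elim in \<open>auto intro!: isCont_bump simp: P_def\<close>)
    then show ?case by (simp add: layer_def[abs_def] base_def X_linear Z_scale)
  qed
qed

lemma heavy_layer:
  assumes x: "x \<in> copy N K i" and K: "\<And>q. q \<in> K \<Longrightarrow> heavy base e l s q"
  shows "heavy (layer N) (e / 2 ^ N) l s x"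
proof -
  obtain q where q: "q \<in> K" "x = (1 / 2 ^ N) *\<^sub>R (q + lat i)" using x by (auto simp: copy_def)
  have "heavy base e l s (q + lat i)"
    by (rule heavy_translate[OF base_borel base_bounds(1) base_periodic K[OF q(1)]])
  then have "heavy base e l s (2 ^ N *\<^sub>R x)" by (simp add: q(2))
  from heavy_scale[OF base_borel base_bounds(1) _ this] show ?thesis by (simp add: layer_def[abs_def])
qed

end

section \<open>Stacks of rescaled layers\<close>

context blind
begin

definition stack :: "real \<Rightarrow> nat list \<Rightarrow> real ^ 2 \<Rightarrow> real" where
  "stack \<Lambda> Ns p = \<Lambda> * (\<Sum>i<length Ns. layer (Ns ! i) p)"

lemma stack_borel [measurable]: "stack \<Lambda> Ns \<in> borel_measurable borel"
  unfolding stack_def[abs_def] by measurable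

lemma stack_bounds:
  assumes "0 < \<Lambda>" shows "0 \<le> stack \<Lambda> Ns p" "stack \<Lambda> Ns p \<le> \<Lambda> * (length Ns * (1 / delta))"
proof -
  have "(\<Sum>i<length Ns. layer (Ns ! i) p) \<le> of_nat (card {..<length Ns}) * (1 / delta)"
    by (rule sum_bounded_above) (rule layer_bounds)
  then show "stack \<Lambda> Ns p \<le> \<Lambda> * (length Ns * (1 / delta))"
    unfolding stack_def using assms by (intro mult_left_mono) auto
  show "0 \<le> stack \<Lambda> Ns p" unfolding stack_def using assms layer_bounds by (simp add: sum_nonneg)
qed

lemma stack_mass:
  assumes L: "0 < \<Lambda>" and S: "S \<in> sets borel"
  shows "(mass S (stack \<Lambda> Ns)) =
     ennreal \<Lambda> * (\<Sum>i<length Ns. \<integral>\<^sup>+p. indicator S p * ennreal (layer (Ns ! i) p) \<partial>lborel)"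
proof -
  note [measurable] = S
  have "(mass S (stack \<Lambda> Ns)) =
      (\<integral>\<^sup>+p. ennreal \<Lambda> * (\<Sum>i<length Ns. indicator S p * ennreal (layer (Ns ! i) p)) \<partial>lborel)"
  proof (rule nn_integral_cong)
    fix p
    have "ennreal (stack \<Lambda> Ns p) = ennreal \<Lambda> * (\<Sum>i<length Ns. ennreal (layer (Ns ! i) p))"
      unfolding stack_def using L layer_bounds by (subst ennreal_mult) (auto intro: sum_nonneg)
    then show "indicator S p * ennreal (stack \<Lambda> Ns p) = ennreal \<Lambda> * (\<Sum>i<length Ns. indicator S p * ennreal (layer (Ns ! i) p))"
      by (simp add: indicator_def)
  qed
  also have "\<dots> = ennreal \<Lambda> * (\<integral>\<^sup>+p. (\<Sum>i<length Ns. indicator S p * ennreal (layer (Ns ! i) p)) \<partial>lborel)"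
    by (rule nn_integral_cmult) measurable
  also have "(\<integral>\<^sup>+p. (\<Sum>i<length Ns. indicator S p * ennreal (layer (Ns ! i) p)) \<partial>lborel) =
      (\<Sum>i<length Ns. \<integral>\<^sup>+p. indicator S p * ennreal (layer (Ns ! i) p) \<partial>lborel)"
    by (rule nn_integral_sum) measurable
  finally show ?thesis .
qed

text \<open>The factor of \<open>1 / n\<close> in \<open>layer_window_mass\<close>. It depends on
  \<open>h\<close> and \<open>M\<close> but not on \<open>n\<close>, so \<open>n\<close> can be
  chosen after it.\<close>

definition win :: "real \<Rightarrow> real" where
  "win M = d * (20 / d * M) * (20 / d * M + 2)"

lemma stack_window_mass:
  assumes L: "0 < \<Lambda>" and M: "0 < M" and N: "\<And>N. N \<in> set Ns \<Longrightarrow> real n \<le> 2 ^ N"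
  shows "(mass (cball 0 M) (stack \<Lambda> Ns)) \<le> ennreal (\<Lambda> * length Ns * win M / n)"
proof -
  have w: "0 \<le> win M / n" using M d_pos by (simp add: win_def)
  have "(\<Sum>i<length Ns. \<integral>\<^sup>+p. indicator (cball 0 M) p * ennreal (layer (Ns ! i) p) \<partial>lborel) \<le> (\<Sum>i<length Ns. ennreal (win M / n))"
  proof (rule sum_mono)
    fix i assume "i \<in> {..<length Ns}"
    then have "real n \<le> 2 ^ (Ns ! i)" using N by simp
    from layer_window_mass[OF M this] show "(mass (cball 0 M) (layer (Ns ! i))) \<le> ennreal (win M / n)"
      by (simp only: win_def times_divide_eq_right)
  qed
  also have "\<dots> = ennreal (length Ns * (win M / n))"
    by (simp only: sum_constant card_lessThan ennreal_of_nat_eq_real_of_nat ennreal_mult''[OF w])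
  finally have "ennreal \<Lambda> * (\<Sum>i<length Ns. \<integral>\<^sup>+p. indicator (cball 0 M) p * ennreal (layer (Ns ! i) p) \<partial>lborel) \<le>
      ennreal \<Lambda> * ennreal (length Ns * (win M / n))" by (rule mult_left_mono) simp
  also have "\<dots> = ennreal (\<Lambda> * (length Ns * (win M / n)))"
  proof -
    have "0 \<le> real (length Ns) * (win M / n)" using w by (intro mult_nonneg_nonneg) auto
    then show ?thesis by (rule ennreal_mult''[symmetric])
  qed
  finally show ?thesis by (subst stack_mass[OF L]) (simp_all add: mult.assoc)
qed

lemma stack_rect_mass:
  assumes L: "0 < \<Lambda>"
    and good: "\<And>k::int. s + of_int k * (pi / 2) \<notin> {c - 3 * h<..<c + 3 * h}"
    and ab: "0 < a" "0 < b" and x: "x \<in> open_rect s p a b"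
  shows "(mass (open_rect s p a b) (stack \<Lambda> Ns)) \<le>
     ennreal (4 * min a b / (sin h * max a b)) *
     (mass (cball x (17 * max a b)) (stack \<Lambda> Ns))"
proof -
  have "(\<Sum>i<length Ns. \<integral>\<^sup>+q. indicator (open_rect s p a b) q * ennreal (layer (Ns ! i) q) \<partial>lborel) \<le>
     (\<Sum>i<length Ns. ennreal (4 * min a b / (sin h * max a b)) * (mass (cball x (17 * max a b)) (layer (Ns ! i))))"
    by (intro sum_mono layer_mass_le good ab x)
  also have "\<dots> = ennreal (4 * min a b / (sin h * max a b)) * (\<Sum>i<length Ns. \<integral>\<^sup>+q. indicator (cball x (17 * max a b)) q * ennreal (layer (Ns ! i) q) \<partial>lborel)"
    by (rule sum_distrib_left[symmetric])
  finally have "ennreal \<Lambda> * (\<Sum>i<length Ns. \<integral>\<^sup>+q. indicator (open_rect s p a b) q * ennreal (layer (Ns ! i) q) \<partial>lborel) \<le>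
     ennreal \<Lambda> * (ennreal (4 * min a b / (sin h * max a b)) * (\<Sum>i<length Ns. \<integral>\<^sup>+q. indicator (cball x (17 * max a b)) q * ennreal (layer (Ns ! i) q) \<partial>lborel))"
    by (rule mult_left_mono) simp
  then show ?thesis by (subst (1 2) stack_mass[OF L]) (simp_all only: open_rect_borel mult.left_commute borel_closed[OF closed_cball])
qed

text \<open>Half of the proportion from \<open>heavy_density\<close>; the other half is given up on
  passing to compact subsets.\<close>

definition dens :: real where "dens = ln (n / 4) / (8 * n)"

text \<open>A compact set of heavy points for one slope remains heavy for a neighbourhood of slopes;
  finitely many neighbourhoods cover the closed arc.\<close>

lemma compact_family:
  assumes n4: "4 < n"
  obtains \<K> where "finite \<K>" "\<And>K. K \<in> \<K> \<Longrightarrow> compact K \<and> K \<subseteq> cell0 \<and> dens * measure lebesgue cell0 \<le> measure lebesgue K"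
    "\<And>s. s \<in> {c - h..c + h} \<Longrightarrow> \<exists>K\<in>\<K>. \<forall>x\<in>K. heavy base (100 * n) c0 s x"
proof -
  have ln: "0 < ln (n / 4)" using n4 by (intro ln_gt_zero) auto
  have ex: "\<exists>K U. compact K \<and> K \<subseteq> cell0 \<and> dens * measure lebesgue cell0 \<le> measure lebesgue K \<and>
     open U \<and> s \<in> U \<and> (\<forall>t\<in>U. \<forall>x\<in>K. heavy base (100 * n) c0 t x)" if s: "s \<in> {c - h..c + h}" for s
  proof -
    define S where "S = {p. heavy base (100 * n) c0 s p} \<inter> cell0"
    have "S \<in> sets borel"
      unfolding S_def using sets.Int[OF borel_open[OF open_heavy_section[OF base_integrable_cball, of "100 * n" c0 s]] cell0_borel] by simp
    then have Sl: "S \<in> sets lebesgue" by simp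
    have Sb: "bounded S" using bounded_cell0 by (rule bounded_subset) (simp add: S_def)
    have "0 < d * (ln (n / 4) / 8)" using ln d_pos by simp
    from inner_compact[OF Sl Sb this] obtain K where K: "compact K" "K \<subseteq> S"
      "measure lebesgue S - d * (ln (n / 4) / 8) < measure lebesgue K" by blast
    have "dens * measure lebesgue cell0 = d * (ln (n / 4) / 8)"
      unfolding measure_cell0 dens_def using n_pos by simp
    then have "dens * measure lebesgue cell0 \<le> measure lebesgue K"
      using K(3) heavy_density[OF s, folded S_def] by linarith
    moreover obtain U where "open U" "s \<in> U" "\<And>t x. t \<in> U \<Longrightarrow> x \<in> K \<Longrightarrow> heavy base (100 * n) c0 t x"
      by (rule heavy_nearby[OF base_integrable_cball K(1), of "100 * n" c0 s]) (use K(2) in \<open>auto simp: S_def\<close>)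
    ultimately show ?thesis using K by (intro exI[of _ K] exI[of _ U]) (auto simp: S_def)
  qed
  then have "\<forall>s\<in>{c - h..c + h}. \<exists>K U. compact K \<and> K \<subseteq> cell0 \<and> dens * measure lebesgue cell0 \<le> measure lebesgue K \<and>
     open U \<and> s \<in> U \<and> (\<forall>t\<in>U. \<forall>x\<in>K. heavy base (100 * n) c0 t x)" by blast
  from bchoice[OF this] obtain K where "\<forall>s\<in>{c - h..c + h}. \<exists>U. compact (K s) \<and> K s \<subseteq> cell0 \<and> dens * measure lebesgue cell0 \<le> measure lebesgue (K s) \<and>
     open U \<and> s \<in> U \<and> (\<forall>t\<in>U. \<forall>x\<in>K s. heavy base (100 * n) c0 t x)" by (elim exE)
  from bchoice[OF this] obtain U where KU: "\<And>s. s \<in> {c - h..c + h} \<Longrightarrow> compact (K s) \<and> K s \<subseteq> cell0 \<and> dens * measure lebesgue cell0 \<le> measure lebesgue (K s) \<and>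
     open (U s) \<and> s \<in> U s \<and> (\<forall>t\<in>U s. \<forall>x\<in>K s. heavy base (100 * n) c0 t x)" by blast
  have "{c - h..c + h} \<subseteq> (\<Union>s\<in>{c - h..c + h}. U s)" using KU by blast
  from compactE_image[OF compact_Icc _ this] obtain C where C: "C \<subseteq> {c - h..c + h}" "finite C" "{c - h..c + h} \<subseteq> (\<Union>s\<in>C. U s)"
    using KU by blast
  show ?thesis
  proof (rule that[of "K ` C"])
    show "\<exists>L\<in>K ` C. \<forall>x\<in>L. heavy base (100 * n) c0 s x" if s': "s \<in> {c - h..c + h}" for s
    proof -
      obtain t where "t \<in> C" "s \<in> U t" using C(3) s' by blast
      then show ?thesis using KU[of t] C(1) by blast
    qed
    show "compact L \<and> L \<subseteq> cell0 \<and> dens * measure lebesgue cell0 \<le> measure lebesgue L" if "L \<in> K ` C" for L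
    proof -
      from that obtain t where t: "t \<in> C" "L = K t" by blast
      then have "t \<in> {c - h..c + h}" using C(1) by blast
      from KU[OF this] show ?thesis unfolding t(2) by (elim conjE) (intro conjI)
    qed
  qed (use C in simp)
qed

lemma stack_exists:
  assumes n4: "4 < n" and dens1: "dens \<le> 1" and e: "0 < e" "e \<le> 1" and M: "0 < M" and L: "0 < \<Lambda>"
  obtains Ns where "length Ns = J" "\<And>N. N \<in> set Ns \<Longrightarrow> real n \<le> 2 ^ N"
    "\<And>s. s \<in> {c - h..c + h} \<Longrightarrow> \<exists>W\<in>lmeasurable. measure lebesgue W \<le> (1 - dens) ^ J * measure lebesgue (ball (0 :: real ^ 2) M) + e / 2 \<and>
       (\<forall>x\<in>ball 0 M - W. heavy (\<lambda>p. indicator (cball 0 (M + 1)) p * stack \<Lambda> Ns p) e (\<Lambda> * c0) s x)"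
proof -
  obtain \<K> where K: "finite \<K>" "\<And>K. K \<in> \<K> \<Longrightarrow> compact K \<and> K \<subseteq> cell0 \<and> dens * measure lebesgue cell0 \<le> measure lebesgue K"
    "\<And>s. s \<in> {c - h..c + h} \<Longrightarrow> \<exists>K\<in>\<K>. \<forall>x\<in>K. heavy base (100 * n) c0 s x"
    by (rule compact_family[OF n4]) blast
  \<comment> \<open>At scales from \<open>N0\<close> on, rectangles of size \<open>100 * n\<close>
    shrink below \<open>e\<close>.\<close>
  obtain N0 where N0: "real (100 * n) / e < 2 ^ N0" using real_arch_pow[of 2 "100 * n / e"] by auto
  have dens0: "0 \<le> dens" using n4 by (simp add: dens_def ln_ge_zero)
  have e2: "0 < e / 2" using e by simp
  have "\<exists>Ns. length Ns = J \<and> (\<forall>N\<in>set Ns. N0 \<le> N) \<and>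
    (\<forall>K\<in>\<K>. \<exists>A'. open A' \<and> bounded A' \<and> measure lebesgue A' \<le> (1 - dens) ^ J * measure lebesgue (ball (0::real^2) M) + e / 2 \<and>
       ball 0 M - A' \<subseteq> (\<Union>N\<in>set Ns. \<Union>i. copy N K i))"
    by (rule layers[OF K(1) _ dens0 dens1 e2 open_ball bounded_ball]) (rule K(2))
  then obtain Ns where Ns: "length Ns = J" "\<forall>N\<in>set Ns. N0 \<le> N"
    "\<forall>K\<in>\<K>. \<exists>A'. open A' \<and> bounded A' \<and> measure lebesgue A' \<le> (1 - dens) ^ J * measure lebesgue (ball (0::real^2) M) + e / 2 \<and>
       ball 0 M - A' \<subseteq> (\<Union>N\<in>set Ns. \<Union>i. copy N K i)"
    by (elim exE conjE)
  have big: "real (100 * n) / e < 2 ^ N" if "N \<in> set Ns" for N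
  proof -
    have "(2::real) ^ N0 \<le> 2 ^ N" using Ns(2) that by (intro power_increasing) auto
    then show ?thesis using N0 by linarith
  qed
  show ?thesis
  proof (rule that[of Ns])
    show "real n \<le> 2 ^ N" if "N \<in> set Ns" for N
    proof -
      have "real n \<le> real (100 * n) / e" using e n_pos by (simp add: field_simps)
      then show ?thesis using big[OF that] by linarith
    qed
    fix s assume s: "s \<in> {c - h..c + h}"
    obtain K0 where K0: "K0 \<in> \<K>" "\<And>x. x \<in> K0 \<Longrightarrow> heavy base (100 * n) c0 s x" using K(3)[OF s] by blast
    obtain W where W: "open W" "bounded W" "measure lebesgue W \<le> (1 - dens) ^ J * measure lebesgue (ball (0::real^2) M) + e / 2"
      "ball 0 M - W \<subseteq> (\<Union>N\<in>set Ns. \<Union>i. copy N K0 i)" using Ns(3) K0(1) by blast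
    show "\<exists>W\<in>lmeasurable. measure lebesgue W \<le> (1 - dens) ^ J * measure lebesgue (ball (0 :: real ^ 2) M) + e / 2 \<and>
       (\<forall>x\<in>ball 0 M - W. heavy (\<lambda>p. indicator (cball 0 (M + 1)) p * stack \<Lambda> Ns p) e (\<Lambda> * c0) s x)"
    proof (intro bexI[of _ W] conjI ballI W(3))
      show "W \<in> lmeasurable" using W by (intro lmeasurable_open)
      fix x assume x: "x \<in> ball 0 M - W"
      then obtain N i where N: "N \<in> set Ns" "x \<in> copy N K0 i" using W(4) by blast
      from heavy_layer[OF N(2) K0(2)] obtain p a b where R: "0 < a" "0 < b" "a + b < real (100 * n) / 2 ^ N"
        "x \<in> open_rect s p a b" "c0 < average (layer N) (open_rect s p a b)" unfolding heavy_def by blast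
      have "real (100 * n) / 2 ^ N < e" using big[OF N(1)] e by (simp add: field_simps)
      then have ab: "a + b < e" using R(3) by linarith
      obtain j where j: "j < length Ns" "Ns ! j = N" using N(1) by (auto simp: in_set_conv_nth)
      have B: "\<Lambda> * average (layer N) (open_rect s p a b) \<le> average (\<lambda>p. indicator (cball 0 (M + 1)) p * stack \<Lambda> Ns p) (open_rect s p a b)"
      proof (rule average_mono_mult[where B = "\<Lambda> * (length Ns * (1 / delta))"])
        have [measurable]: "cball (0 :: real ^ 2) (M + 1) \<in> sets borel" by simp
        show "(\<lambda>p. indicator (cball 0 (M + 1)) p * stack \<Lambda> Ns p) \<in> borel_measurable borel" by measurable
        show "\<Lambda> * layer N y \<le> indicator (cball 0 (M + 1)) y * stack \<Lambda> Ns y" if y: "y \<in> open_rect s p a b" for y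
        proof -
          \<comment> \<open>Since \<open>e \<le> 1\<close>, rectangles used for points of the disc
            stay where the cutoff equals 1.\<close>
          have "dist y x < 1" using dist_open_rect_less[OF y R(4)] ab e by linarith
          then have "norm y \<le> M + 1" using x norm_triangle_ineq2[of y x] by (simp add: dist_norm)
          then have "indicator (cball 0 (M + 1)) y = (1 :: real)" by simp
          moreover have "layer N y \<le> (\<Sum>i<length Ns. layer (Ns ! i) y)"
            using j layer_bounds by (intro member_le_sum[where i = j and f = "\<lambda>i. layer (Ns ! i) y", simplified j(2)]) auto
          ultimately show ?thesis using L by (simp add: stack_def mult_left_mono)
        qed
        show "0 \<le> indicator (cball 0 (M + 1)) y * stack \<Lambda> Ns y" for y using stack_bounds[OF L] by simp
        show "indicator (cball 0 (M + 1)) y * stack \<Lambda> Ns y \<le> \<Lambda> * (length Ns * (1 / delta))" for y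
          using stack_bounds[OF L, where p = y and Ns = Ns] by (auto simp: indicator_def)
      qed (use R L layer_bounds in auto)
      have "\<Lambda> * c0 < \<Lambda> * average (layer N) (open_rect s p a b)" using R(5) L by simp
      then show "heavy (\<lambda>p. indicator (cball 0 (M + 1)) p * stack \<Lambda> Ns p) e (\<Lambda> * c0) s x"
        unfolding heavy_def using R ab B by (meson less_le_trans)
    qed
  qed (rule Ns(1))
qed

text \<open>The weak type inequality, applied once to the whole stack, bounds the mass of discs
  around \<open>x\<close> by \<open>t\<close> times the squared radius. The rectangle estimate turns
  this into averages; \<open>1156\<close> is 4 times the square of 17.\<close>

lemma stack_good:
  fixes \<Lambda> M t :: real
  assumes L: "0 < \<Lambda>" and M: "0 < M" and t: "0 < t" and N: "\<And>N. N \<in> set Ns \<Longrightarrow> real n \<le> 2 ^ N"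
    and good: "\<And>k::int. s + of_int k * (pi / 2) \<notin> {c - 3 * h<..<c + 3 * h}"
  obtains W where "W \<in> lmeasurable" "measure lebesgue W \<le> 25 * pi * (\<Lambda> * length Ns * win (M + 20) / n) / t"
    "\<And>x p a b. x \<notin> W \<Longrightarrow> 0 < a \<Longrightarrow> 0 < b \<Longrightarrow> a + b < 1 \<Longrightarrow> x \<in> open_rect s p a b \<Longrightarrow>
       average (\<lambda>p. indicator (cball 0 (M + 1)) p * stack \<Lambda> Ns p) (open_rect s p a b) \<le> 1156 * t / sin h"
proof -
  define G where "G = (\<lambda>q. indicator (cball 0 (M + 20)) q * stack \<Lambda> Ns q)"
  define F where "F = (\<lambda>q. indicator (cball 0 (M + 1)) q * stack \<Lambda> Ns q)"
  have [measurable]: "cball (0 :: real ^ 2) r \<in> sets borel" for r by simp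
  have Gm [measurable]: "G \<in> borel_measurable borel" and Fm [measurable]: "F \<in> borel_measurable borel"
    unfolding G_def F_def by measurable
  have G0: "0 \<le> G q" and F0: "0 \<le> F q" for q using stack_bounds[OF L] by (simp_all add: G_def F_def)
  have Gn: "(\<integral>\<^sup>+q. ennreal (G q) \<partial>lborel) \<le> ennreal (\<Lambda> * length Ns * win (M + 20) / n)"
  proof -
    have "(\<integral>\<^sup>+q. ennreal (G q) \<partial>lborel) = (mass (cball 0 (M + 20)) (stack \<Lambda> Ns))"
      unfolding G_def by (intro nn_integral_cong) (simp add: indicator_def)
    then show ?thesis using stack_window_mass[OF L _ N, of "M + 20"] M by simp
  qed
  have Gi: "integrable lborel G"
    using G0 le_less_trans[OF Gn ennreal_less_top] by (intro integrableI_nonneg) auto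
  have win0: "0 \<le> \<Lambda> * length Ns * win (M + 20) / n" using L M d_pos by (simp add: win_def)
  have GI: "(\<integral>q. G q \<partial>lborel) \<le> \<Lambda> * length Ns * win (M + 20) / n"
    using Gn nn_integral_eq_integral[OF Gi] G0 win0 by (simp add: ennreal_le_iff)
  have sh: "0 < sin h" using h pi_gt3 by (intro sin_gt_zero) auto
  obtain W where W: "W \<in> lmeasurable" "measure lebesgue W \<le> 25 * pi * (\<integral>x. G x \<partial>lborel) / t"
    "\<And>x r. 0 < r \<Longrightarrow> r \<le> 17 \<Longrightarrow> x \<notin> W \<Longrightarrow> (\<integral>y. indicator (cball x r) y * G y \<partial>lborel) \<le> t * r\<^sup>2"
    by (rule Hardy_Littlewood_weak[OF Gm G0 Gi t, of 17]) auto
  show ?thesis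
  proof (rule that[of W])
    have "25 * pi * (\<integral>x. G x \<partial>lborel) / t \<le> 25 * pi * (\<Lambda> * length Ns * win (M + 20) / n) / t"
      using GI t by (intro divide_right_mono mult_left_mono) auto
    then show "measure lebesgue W \<le> 25 * pi * (\<Lambda> * length Ns * win (M + 20) / n) / t" using W(2) by linarith
    fix x p a b assume x: "x \<notin> W" and ab: "0 < a" "0 < b" "a + b < 1" and xR: "x \<in> open_rect s p a b"
    define l where "l = max a b"
    define w where "w = min a b"
    have lw: "0 < l" "l \<le> 1" "0 < w" "w * l = a * b" using ab by (auto simp: l_def w_def min_def max_def)
    \<comment> \<open>For points of norm at most \<open>M + 2\<close> the discs of radius at most 17
      stay in the window of radius \<open>M + 20\<close>; rectangles through other points miss the
      support.\<close>
    have "average F (open_rect s p a b) \<le> 1156 * t / sin h"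
    proof (cases "norm x \<le> M + 2")
      case True
      have sub: "q \<in> cball 0 (M + 20)" if "q \<in> cball x (17 * l)" for q
        using that True lw norm_triangle_ineq2[of q x] by (simp add: dist_norm norm_minus_commute)
      define I where "I = (\<integral>y. indicator (cball x (17 * l)) y * G y \<partial>lborel)"
      have I: "I \<le> t * (17 * l)\<^sup>2" unfolding I_def using lw x by (intro W(3)) auto
      have I0: "0 \<le> I" unfolding I_def using G0 by (intro integral_nonneg_AE) auto
      have "(mass (open_rect s p a b) F) \<le>
          (mass (open_rect s p a b) (stack \<Lambda> Ns))"
        using stack_bounds[OF L] by (intro nn_integral_mono) (auto simp: F_def indicator_def)
      also have "\<dots> \<le> ennreal (4 * w / (sin h * l)) * (mass (cball x (17 * l)) (stack \<Lambda> Ns))"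
        unfolding l_def w_def by (rule stack_rect_mass[OF L good ab(1,2) xR])
      also have "(mass (cball x (17 * l)) (stack \<Lambda> Ns)) = (\<integral>\<^sup>+q. ennreal (indicator (cball x (17 * l)) q * G q) \<partial>lborel)"
        using sub by (intro nn_integral_cong) (simp add: G_def indicator_def)
      also have "\<dots> = ennreal I"
        unfolding I_def
      proof (rule nn_integral_eq_integral)
        show "integrable lborel (\<lambda>q. indicator (cball x (17 * l)) q * G q)"
          using integrable_mult_indicator[OF _ Gi, of "cball x (17 * l)"] by simp
      qed (use G0 in auto)
      also have "ennreal (4 * w / (sin h * l)) * ennreal I = ennreal (4 * w / (sin h * l) * I)"
        using I0 lw sh by (intro ennreal_mult[symmetric]) auto
      finally have m: "(mass (open_rect s p a b) F) \<le> ennreal (4 * w / (sin h * l) * I)" .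
      have "enn2real (mass (open_rect s p a b) F) \<le> 4 * w / (sin h * l) * I"
        using enn2real_mono[OF m] I0 lw sh by simp
      also have "\<dots> \<le> 4 * w / (sin h * l) * (t * (17 * l)\<^sup>2)" using I lw sh by (intro mult_left_mono) auto
      also have "\<dots> = 1156 * t / sin h * (w * l)" using lw sh by (simp add: power2_eq_square field_simps)
      finally have "enn2real (mass (open_rect s p a b) F) \<le> 1156 * t / sin h * (a * b)"
        unfolding lw(4) .
      then show ?thesis using ab by (simp add: average_eq_nn[OF Fm F0] pos_divide_le_eq)
    next
      case False
      have "F q = 0" if q: "q \<in> open_rect s p a b" for q
      proof -
        have "norm (x - q) < 1" using dist_open_rect_less[OF xR q] ab by (simp add: dist_norm)
        then have "M + 1 < norm q" using False norm_triangle_ineq2[of x q] by linarith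
        then show ?thesis by (simp add: F_def)
      qed
      then have "(mass (open_rect s p a b) F) = (\<integral>\<^sup>+q. 0 \<partial>(lborel :: (real ^ 2) measure))"
        by (intro nn_integral_cong) (auto simp: indicator_def)
      then show ?thesis using ab t sh by (simp add: average_eq_nn[OF Fm F0])
    qed
    then show "average (\<lambda>p. indicator (cball 0 (M + 1)) p * stack \<Lambda> Ns p) (open_rect s p a b) \<le> 1156 * t / sin h"
      by (simp add: F_def)
  qed (rule W(1))
qed

lemma AE_isCont_stack: "AE p in lborel. isCont (\<lambda>p. indicator (cball 0 M) p * stack \<Lambda> Ns p) p"
proof -
  have "AE p in lborel. \<forall>i\<in>{..<length Ns}. isCont (layer (Ns ! i)) p"
    by (intro AE_finite_allI AE_isCont_layer) simp
  moreover have "AE p in lborel. p \<notin> frontier (cball (0 :: real ^ 2) M)"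
  proof -
    have "negligible (frontier (cball (0 :: real ^ 2) M))" by (intro negligible_convex_frontier) simp
    then have "frontier (cball (0 :: real ^ 2) M) \<in> null_sets lebesgue" by (simp only: negligible_iff_null_sets)
    then have "frontier (cball (0 :: real ^ 2) M) \<in> null_sets lborel"
      by (simp add: null_sets_def)
    then show ?thesis by (rule AE_not_in)
  qed
  ultimately show ?thesis
  proof eventually_elim
    case (elim p)
    have "isCont (stack \<Lambda> Ns) p"
      unfolding stack_def[abs_def] using elim(1) by (intro continuous_mult continuous_const continuous_sum) auto
    moreover have "eventually (\<lambda>q. indicator (cball 0 M) q = (indicator (cball 0 M) p :: real)) (nhds p)"
    proof (cases "p \<in> cball 0 M")
      case True
      then have "p \<in> interior (cball 0 M)" using elim(2) by (auto simp: frontier_def)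
      from eventually_nhds_in_open[OF open_interior this] show ?thesis
        by eventually_elim (use True interior_subset in \<open>auto simp: indicator_def\<close>)
    next
      case False
      then have "p \<in> - cball 0 M" by simp
      from eventually_nhds_in_open[OF _ this] show ?thesis
        by (rule eventually_mono[OF _]) (use False in \<open>auto simp: indicator_def\<close>)
    qed
    then have "isCont (indicator (cball 0 M) :: _ \<Rightarrow> real) p"
      unfolding isCont_def by (intro tendsto_eventually) (auto simp: eventually_at_filter elim: eventually_mono)
    ultimately show ?case by (intro continuous_mult)
  qed
qed

end

section \<open>The building block for one arc of slopes\<close>

definition mostly_heavy :: "(real ^ 2 \<Rightarrow> real) \<Rightarrow> real \<Rightarrow> real \<Rightarrow> real \<Rightarrow> bool" where
  "mostly_heavy F e M s \<longleftrightarrow>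
     (\<exists>W\<in>lmeasurable. measure lebesgue W \<le> e \<and> (\<forall>x\<in>ball 0 M - W. heavy F e (1 / e) s x))"

definition mostly_small :: "(real ^ 2 \<Rightarrow> real) \<Rightarrow> real \<Rightarrow> real \<Rightarrow> bool" where
  "mostly_small F e s \<longleftrightarrow>
     (\<exists>W\<in>lmeasurable. measure lebesgue W \<le> e \<and>
        (\<forall>x p a b. x \<notin> W \<longrightarrow> 0 < a \<longrightarrow> 0 < b \<longrightarrow> a + b < 1 \<longrightarrow> x \<in> open_rect s p a b \<longrightarrow>
           average F (open_rect s p a b) \<le> e))"

text \<open>The level \<open>L\<close>, the threshold \<open>t\<close>, the window constant
  \<open>w\<close> and the number \<open>B\<close> of efoldings needed to exhaust the disc do not
  involve \<open>n\<close>. The total mass is then at most of order \<open>B / ln n\<close> plus a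
  rounding term of order \<open>1 / n\<close>, with constants already fixed.\<close>

lemma building_block:
  fixes c h e M :: real
  assumes h: "0 < h" "h \<le> 1 / 8" and e: "0 < e" "e \<le> 1" and M: "0 < M"
  obtains F :: "real ^ 2 \<Rightarrow> real" where
    "F \<in> borel_measurable borel" "\<And>x. 0 \<le> F x" "integrable lborel F" "(\<integral>x. F x \<partial>lborel) \<le> e"
    "AE x in lborel. isCont F x"
    "\<And>s. s \<in> {c - h..c + h} \<Longrightarrow> mostly_heavy F e M s"
    "\<And>s. (\<And>k::int. s + of_int k * (pi / 2) \<notin> {c - 3 * h<..<c + 3 * h}) \<Longrightarrow>
       mostly_small F e s"
proof -
  define D where "D = sin (4 * h)"
  have D: "0 < D" unfolding D_def using h pi_gt3 by (intro sin_gt_zero) auto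
  have sh: "0 < sin h" using h pi_gt3 by (intro sin_gt_zero) auto
  \<comment> \<open>Makes \<open>L * c0\<close> equal to \<open>1 / e\<close>; likewise
    \<open>t\<close> makes \<open>1156 * t / sin h\<close> equal to \<open>e\<close>.\<close>
  define L where "L = 700 / (e * D)"
  have L: "0 < L" using e D by (simp add: L_def)
  define t where "t = e * sin h / 1156"
  have t: "0 < t" using e sh by (simp add: t_def)
  define w where "w = D * (20 / D * (M + 20)) * (20 / D * (M + 20) + 2)"
  have w: "0 < w" unfolding w_def using D M by (intro mult_pos_pos add_pos_pos) auto
  define V where "V = measure lebesgue (ball (0 :: real ^ 2) M)"
  have V: "0 \<le> V" by (simp add: V_def)
  define B where "B = ln (2 * V / e + 1)"
  have B: "0 \<le> B" using V e by (simp add: B_def)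
  \<comment> \<open>The admissible total mass: it keeps both the integral and the weak type
    exceptional set below \<open>e\<close>.\<close>
  define d0 where "d0 = min e (e * t / (25 * pi))"
  have d0: "0 < d0" "d0 \<le> e" "25 * pi * d0 / t \<le> e"
  proof -
    show "0 < d0" using e t by (simp add: d0_def)
    show "d0 \<le> e" by (simp add: d0_def)
    have "25 * pi * d0 \<le> 25 * pi * (e * t / (25 * pi))" by (intro mult_left_mono) (auto simp: d0_def)
    then show "25 * pi * d0 / t \<le> e" using t by (simp add: pos_divide_le_eq)
  qed
  define Q where "Q = L * w / d0"
  have Q: "0 < Q" using L w d0 by (simp add: Q_def)
  \<comment> \<open>The exponential forces \<open>8 * B * Q / ln (n / 4)\<close> below 1/2, the
    second summand controls the layer lost to rounding up \<open>J\<close>, and the third gives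
    \<open>4 < n\<close>.\<close>
  define n where "n = nat \<lceil>4 * exp (16 * B * Q + 1)\<rceil> + nat \<lceil>2 * Q\<rceil> + 5"
  have n1: "4 * exp (16 * B * Q + 1) \<le> n" "2 * Q \<le> n" "5 \<le> n"
    using exp_gt_zero[of "16 * B * Q + 1"] Q unfolding n_def by (simp_all, linarith+)
  have n0: "0 < real n" using n1 by simp
  have ln_n: "16 * B * Q + 1 \<le> ln (n / 4)"
  proof -
    have "exp (16 * B * Q + 1) \<le> n / 4" using n1 by simp
    then show ?thesis using n0 by (simp add: ln_ge_iff)
  qed
  have lnpos: "0 < ln (n / 4)" using ln_n mult_nonneg_nonneg[of "16 * B" Q] B Q by linarith
  interpret blind c h n by unfold_locales (use h n1 in auto)
  have dD: "d = D" by (simp add: d_def D_def)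
  have densp: "0 < dens" using lnpos n0 by (simp add: dens_def)
  have dens1: "dens \<le> 1"
  proof -
    have "ln (n / 4) \<le> n / 4 - 1" using n0 by (intro ln_le_minus_one) simp
    also have "\<dots> \<le> 8 * real n" using n0 by simp
    finally show ?thesis using n0 by (simp add: dens_def)
  qed
  \<comment> \<open>Each layer leaves at most the fraction \<open>1 - dens\<close>, so
    \<open>B / dens\<close> layers leave at most \<open>exp (- B)\<close> of the disc.\<close>
  define J where "J = nat \<lceil>B / dens\<rceil>"
  have J: "B / dens \<le> J" "J \<le> B / dens + 1"
  proof -
    have "0 \<le> B / dens" using B densp by simp
    then show "B / dens \<le> J" "J \<le> B / dens + 1" unfolding J_def by linarith+
  qed
  have pow: "(1 - dens) ^ J * V \<le> e / 2"
  proof -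
    have "(1 - dens) ^ J \<le> exp (- dens) ^ J"
      using exp_ge_add_one_self[of "- dens"] dens1 by (intro power_mono) auto
    also have "\<dots> = exp (- (dens * J))" by (simp add: exp_of_nat_mult[symmetric] mult.commute)
    also have "\<dots> \<le> exp (- B)" using J(1) densp by (simp add: pos_divide_le_eq mult.commute)
    also have "\<dots> = 1 / (2 * V / e + 1)" using V e by (simp add: B_def exp_minus inverse_eq_divide add_nonneg_pos)
    finally have "(1 - dens) ^ J * V \<le> 1 / (2 * V / e + 1) * V" using V by (intro mult_right_mono)
    also have "\<dots> \<le> e / 2" using V e by (simp add: field_simps add_nonneg_pos)
    finally show ?thesis .
  qed
  have small: "L * real J * w / n \<le> d0"
  proof -
    have "Q * (real J / n) \<le> Q * ((B / dens + 1) / n)" using J(2) Q by (intro mult_left_mono divide_right_mono) auto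
    also have "\<dots> = 8 * B * Q / ln (n / 4) + Q / n"
      using n0 by (simp add: dens_def add_divide_distrib distrib_left)
    also have "8 * B * Q / ln (n / 4) \<le> 1 / 2" using ln_n lnpos by (simp add: pos_divide_le_eq)
    also have "Q / n \<le> 1 / 2" using n1 n0 by (simp add: pos_divide_le_eq)
    finally have "Q * (real J / n) \<le> 1" by simp
    moreover have "Q * (real J / n) = L * w * (real J / n) / d0" by (simp add: Q_def)
    ultimately have "L * w * (real J / n) / d0 \<le> 1" by simp
    then have "L * w * (real J / n) \<le> 1 * d0" using d0(1) by (simp only: pos_divide_le_eq)
    then show ?thesis by (simp add: mult_ac)
  qed
  have win: "win (M + 20) = w" by (simp add: win_def dD w_def)
  obtain Ns where Ns: "length Ns = J" "\<And>N. N \<in> set Ns \<Longrightarrow> real n \<le> 2 ^ N"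
    "\<And>s. s \<in> {c - h..c + h} \<Longrightarrow> \<exists>W\<in>lmeasurable. measure lebesgue W \<le> (1 - dens) ^ J * measure lebesgue (ball (0 :: real ^ 2) M) + e / 2 \<and>
       (\<forall>x\<in>ball 0 M - W. heavy (\<lambda>p. indicator (cball 0 (M + 1)) p * stack L Ns p) e (L * c0) s x)"
    by (rule stack_exists[OF _ dens1 e M L, of J]) (use n1 in auto)
  define F where "F = (\<lambda>p. indicator (cball 0 (M + 1)) p * stack L Ns p)"
  have [measurable]: "cball (0 :: real ^ 2) r \<in> sets borel" for r by simp
  have Fm: "F \<in> borel_measurable borel" unfolding F_def by measurable
  have F0: "0 \<le> F x" for x using stack_bounds[OF L] by (simp add: F_def)
  have Fn: "(\<integral>\<^sup>+x. ennreal (F x) \<partial>lborel) \<le> ennreal e"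
  proof -
    have "(\<integral>\<^sup>+x. ennreal (F x) \<partial>lborel) \<le> (mass (cball 0 (M + 20)) (stack L Ns))"
      unfolding F_def by (intro nn_integral_mono) (auto simp: indicator_def)
    also have "\<dots> \<le> ennreal (L * length Ns * win (M + 20) / n)"
      using stack_window_mass[OF L _ Ns(2), of "M + 20"] M by simp
    also have "\<dots> \<le> ennreal e" using small d0 Ns(1) win by (intro ennreal_leI) simp
    finally show ?thesis .
  qed
  have Fi: "integrable lborel F"
    using Fm F0 le_less_trans[OF Fn ennreal_less_top] by (intro integrableI_nonneg) auto
  show ?thesis
  proof (rule that[of F])
    show "(\<integral>x. F x \<partial>lborel) \<le> e" using Fn nn_integral_eq_integral[OF Fi] F0 e by simp
    show "AE x in lborel. isCont F x" unfolding F_def by (rule AE_isCont_stack)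
    have Lc: "L * c0 = 1 / e" using D e by (simp add: L_def c0_def dD)
    show "mostly_heavy F e M s"
      if s: "s \<in> {c - h..c + h}" for s
    proof -
      obtain W where W: "W \<in> lmeasurable" "measure lebesgue W \<le> (1 - dens) ^ J * V + e / 2"
        "\<forall>x\<in>ball 0 M - W. heavy F e (1 / e) s x"
        using Ns(3)[OF s] unfolding V_def[symmetric] F_def[symmetric] Lc by (elim bexE conjE)
      then show ?thesis unfolding mostly_heavy_def using pow by (intro bexI[of _ W]) auto
    qed
    show "mostly_small F e s"
      if s: "\<And>k::int. s + of_int k * (pi / 2) \<notin> {c - 3 * h<..<c + 3 * h}" for s
    proof -
      obtain W where W: "W \<in> lmeasurable" "measure lebesgue W \<le> 25 * pi * (L * length Ns * win (M + 20) / n) / t"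
        "\<And>x p a b. x \<notin> W \<Longrightarrow> 0 < a \<Longrightarrow> 0 < b \<Longrightarrow> a + b < 1 \<Longrightarrow> x \<in> open_rect s p a b \<Longrightarrow>
           average F (open_rect s p a b) \<le> 1156 * t / sin h"
        unfolding F_def by (rule stack_good[OF L M t Ns(2) s]) blast+
      have "25 * pi * (L * length Ns * win (M + 20) / n) / t \<le> 25 * pi * d0 / t"
        unfolding win Ns(1) using small t by (intro divide_right_mono mult_left_mono) auto
      then have "measure lebesgue W \<le> e" using W(2) d0(3) by linarith
      moreover have "1156 * t / sin h = e" using sh by (simp add: t_def)
      ultimately show ?thesis unfolding mostly_small_def using W(1,3) by (intro bexI[of _ W]) auto
    qed
  qed (fact Fm F0 Fi)+
qed

lemma isCont_tendsto_average:
  assumes F: "integrable lebesgue F" and c: "isCont F x"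
  shows "(average F \<longlongrightarrow> F x) (shrinking_rects s x)"
proof (rule tendstoI)
  fix e :: real assume e: "0 < e"
  then have e2: "0 < e / 2" by simp
  obtain r where r: "0 < r" "\<And>y. dist y x < r \<Longrightarrow> dist (F y) (F x) < e / 2"
    using c e2 unfolding continuous_at_eps_delta by metis
  show "eventually (\<lambda>R. dist (average F R) (F x) < e) (shrinking_rects s x)"
    unfolding eventually_shrinking_rects
  proof (intro exI[of _ r] conjI allI impI r(1))
    fix p a b assume ab: "0 < a" "0 < b" "a + b < r" and x: "x \<in> open_rect s p a b"
    let ?R = "open_rect s p a b"
    have near: "F x - e / 2 \<le> F y \<and> F y \<le> F x + e / 2" if "y \<in> ?R" for y
    proof -
      have "dist y x < r" using dist_open_rect_less[OF that x] ab(3) by linarith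
      from r(2)[OF this] show ?thesis unfolding dist_real_def by linarith
    qed
    have i: "integrable lebesgue (\<lambda>y. indicator ?R y *\<^sub>R F y)" by (rule integrable_mult_indicator[OF _ F]) simp
    have ic: "integrable lebesgue (\<lambda>y. indicator ?R y *\<^sub>R k)" for k :: real
      using open_rect_lmeasurable[of s p a b] by (intro integrable_scaleR_left) (simp add: fmeasurable_def)
    have cc: "(\<integral>y. indicator ?R y *\<^sub>R k \<partial>lebesgue) = a * b * k" for k :: real
      using measure_open_rect[OF ab(1,2), of s p] by simp
    have "a * b * (F x - e / 2) \<le> (\<integral>y. indicator ?R y *\<^sub>R F y \<partial>lebesgue)"
      unfolding cc[symmetric] using near by (intro integral_mono ic i) (auto simp: indicator_def)
    moreover have "(\<integral>y. indicator ?R y *\<^sub>R F y \<partial>lebesgue) \<le> a * b * (F x + e / 2)"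
      unfolding cc[symmetric] using near by (intro integral_mono ic i) (auto simp: indicator_def)
    ultimately have "F x - e / 2 \<le> average F ?R" "average F ?R \<le> F x + e / 2"
      unfolding average_def set_lebesgue_integral_def measure_open_rect[OF ab(1,2)] using ab
      by (simp_all add: pos_le_divide_eq pos_divide_le_eq mult.commute)
    then show "dist (average F ?R) (F x) < e" using e by (simp add: dist_real_def abs_less_iff)
  qed
qed

section \<open>A locally finite dyadic cover\<close>

text \<open>The interval is regarded as a circle modulo \<open>pi / 2\<close>, so a neighbourhood of
  the slope 0 also contains slopes just below \<open>pi / 2\<close>. These must drop out of the
  intersection.\<close>

lemma periodic_open_sets:
  assumes G: "\<And>k. open (G k)" and S: "S = (\<Inter>k::nat. G k) \<inter> {0..<pi / 2}"
  obtains H :: "nat \<Rightarrow> real set" where "\<And>k. open (H k)" "\<And>k x (z::int). x \<in> H k \<Longrightarrow> x + of_int z * (pi / 2) \<in> H k"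
    "\<And>j k. j \<le> k \<Longrightarrow> H k \<subseteq> H j" "\<And>x. x \<in> {0..<pi / 2} \<Longrightarrow> x \<in> S \<longleftrightarrow> (\<forall>k. x \<in> H k)"
proof -
  \<comment> \<open>Away from 0 the given sets are used. The slope 0 enters only if it belongs to
    \<open>S\<close>, through intervals that shrink to it, and these have half-length at most 1/2,
    so that only the translates by 0 and \<open>- pi / 2\<close> matter.\<close>
  define U where "U = (\<lambda>k::nat. (\<Inter>j\<le>k. G j) \<inter> {0<..<pi / 2} \<union> (if 0 \<in> S then {- (1 / (real k + 2))<..<1 / (real k + 2)} else {}))"
  define H where "H = (\<lambda>k. \<Union>z::int. (\<lambda>x. x + of_int z * (pi / 2)) -` U k)"
  have oU: "open (U k)" for k unfolding U_def using G by (auto intro!: open_Un open_Int open_INT)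
  show ?thesis
  proof (rule that[of H])
    show "open (H k)" for k unfolding H_def by (intro open_UN ballI open_vimage oU continuous_intros)
    show "x + of_int z * (pi / 2) \<in> H k" if xH: "x \<in> H k" for k x and z :: int
    proof -
      obtain z' :: int where "x + of_int z' * (pi / 2) \<in> U k" using xH unfolding H_def UN_iff vimage_eq by blast
      moreover have "x + of_int z' * (pi / 2) = (x + of_int z * (pi / 2)) + of_int (z' - z) * (pi / 2)"
        by (simp add: left_diff_distrib diff_divide_distrib)
      ultimately show ?thesis unfolding H_def by (simp only: UN_iff vimage_eq) blast
    qed
    show "H k \<subseteq> H j" if "j \<le> k" for j k
    proof -
      have le: "1 / (real k + 2) \<le> 1 / (real j + 2)" using that by (simp add: frac_le)
      have "{- (1 / (real k + 2))<..<1 / (real k + 2)} \<subseteq> {- (1 / (real j + 2))<..<1 / (real j + 2)}"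
      proof
        fix y assume "y \<in> {- (1 / (real k + 2))<..<1 / (real k + 2)}"
        then show "y \<in> {- (1 / (real j + 2))<..<1 / (real j + 2)}"
          using le unfolding greaterThanLessThan_iff by linarith
      qed
      moreover have "(\<Inter>i\<le>k. G i) \<subseteq> (\<Inter>i\<le>j. G i)" using that by (intro INF_superset_mono) auto
      ultimately have "U k \<subseteq> U j" unfolding U_def by (intro Un_mono Int_mono order_refl) (simp_all add: add.commute)
      then show ?thesis unfolding H_def by blast
    qed
    fix x :: real assume x: "x \<in> {0..<pi / 2}"
    then have x0: "0 \<le> x" "x < pi / 2" by auto
    have cases: "x \<in> (\<Inter>j\<le>k. G j) \<and> 0 < x \<or> (0 \<in> S \<and> (x < 1 / (real k + 2) \<or> pi / 2 - 1 / (real k + 2) < x))"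
      if xH: "x \<in> H k" for k
    proof -
      obtain z :: int where z: "x + of_int z * (pi / 2) \<in> U k" using xH unfolding H_def UN_iff vimage_eq by blast
      have k2: "1 / (real k + 2) \<le> 1 / 2" by (simp add: frac_le)
      define y where "y = x + of_int z * (pi / 2)"
      have y: "(y \<in> (\<Inter>j\<le>k. G j) \<and> 0 < y \<and> y < pi / 2) \<or> (0 \<in> S \<and> - (1 / (real k + 2)) < y \<and> y < 1 / (real k + 2))"
        using z unfolding U_def y_def[symmetric] by (cases "0 \<in> S") (simp_all add: add.commute)
      have "- 1 / 2 < y" "y < pi / 2" using y k2 pi_gt3 by linarith+
      then have b: "- 1 / 2 < x + of_int z * (pi / 2)" "x + of_int z * (pi / 2) < pi / 2" by (simp_all only: y_def)
      have "z = 0 \<or> z = - 1"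
      proof (rule ccontr)
        assume "\<not> ?thesis"
        then consider "1 \<le> z" | "z \<le> - 2" by linarith
        then show False
        proof cases
          case 1
          then have "1 * (pi / 2) \<le> of_int z * (pi / 2)" by (intro mult_right_mono) auto
          then show False using b x0 by linarith
        next
          case 2
          then have "of_int z * (pi / 2) \<le> - 2 * (pi / 2)" by (intro mult_right_mono) auto
          then show False using b x0 pi_gt3 by linarith
        qed
      qed
      then show ?thesis
      proof
        assume "z = 0"
        then have "y = x" by (simp add: y_def)
        then show ?thesis using y by blast
      next
        assume "z = - 1"
        then have "y = x - pi / 2" by (simp add: y_def)
        then have "y < 0" using x0 by linarith
        then have "\<not> (y \<in> (\<Inter>j\<le>k. G j) \<and> 0 < y \<and> y < pi / 2)" by (metis less_asym)
        then have y2: "0 \<in> S \<and> - (1 / (real k + 2)) < y \<and> y < 1 / (real k + 2)" using y by (simp only: simp_thms)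
        then have "pi / 2 - 1 / (real k + 2) < x" using \<open>y = x - pi / 2\<close> by linarith
        then show ?thesis using y2 by (simp only: simp_thms)
      qed
    qed
    show "x \<in> S \<longleftrightarrow> (\<forall>k. x \<in> H k)"
    proof
      assume xS: "x \<in> S"
      show "\<forall>k. x \<in> H k"
      proof
        fix k
        have "x \<in> U k"
          using xS x unfolding S U_def by (cases "x = 0") auto
        then have "x \<in> (\<lambda>x. x + of_int 0 * (pi / 2)) -` U k" by simp
        then show "x \<in> H k" unfolding H_def by blast
      qed
    next
      assume h: "\<forall>k. x \<in> H k"
      show "x \<in> S"
      proof (cases "x = 0")
        case True
        then show ?thesis using cases[of 0] h by blast
      next
        case False
        then have "0 < min x (pi / 2 - x)" using x by auto
        then obtain k0 :: nat where k0: "1 / Suc k0 < min x (pi / 2 - x)" using nat_approx_posE by blast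
        have "x \<in> G j" for j
        proof -
          define k where "k = max j k0"
          have "1 / (real k + 2) \<le> 1 / Suc k0" by (simp add: k_def frac_le)
          then have "\<not> (x < 1 / (real k + 2) \<or> pi / 2 - 1 / (real k + 2) < x)" using k0 by linarith
          then have "x \<in> (\<Inter>j\<le>k. G j)" using cases[of k] h by blast
          then show "x \<in> G j" by (simp add: k_def)
        qed
        then show ?thesis using x S by blast
      qed
    qed
  qed
qed

text \<open>A Whitney decomposition of each \<open>H k\<close>. A slope in \<open>S\<close> is
  covered once for every \<open>k\<close>. A slope outside some \<open>H K\<close> can meet enlarged
  arcs only for \<open>k < K\<close>, and there the arcs have length bounded below by the distance
  to the complement.\<close>

lemma dyadic_cover:
  assumes G: "\<And>k. open (G k)" and S: "S = (\<Inter>k::nat. G k) \<inter> {0..<pi / 2}"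
  obtains V :: "nat set" and c h :: "nat \<Rightarrow> real" where "\<And>j. 0 < h j \<and> h j \<le> 1 / 8"
    "\<And>s. s \<in> S \<Longrightarrow> infinite {j \<in> V. s \<in> {c j - h j..c j + h j}}"
    "\<And>s. s \<in> {0..<pi / 2} - S \<Longrightarrow> finite {j \<in> V. \<exists>z::int. s + of_int z * (pi / 2) \<in> {c j - 3 * h j<..<c j + 3 * h j}}"
proof -
  obtain H :: "nat \<Rightarrow> real set" where H: "\<And>k. open (H k)" "\<And>k x (z::int). x \<in> H k \<Longrightarrow> x + of_int z * (pi / 2) \<in> H k"
    "\<And>j k. j \<le> k \<Longrightarrow> H k \<subseteq> H j" "\<And>x. x \<in> {0..<pi / 2} \<Longrightarrow> x \<in> S \<longleftrightarrow> (\<forall>k. x \<in> H k)"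
    by (rule periodic_open_sets[OF G S]) (rule that; assumption)
  have per: "x \<in> H k" if "x + of_int z * (pi / 2) \<in> H k" for x k and z :: int
    using H(2)[OF that, of "- z"] by (simp add: algebra_simps)
  define C where "C = (\<lambda>l (i::int). (of_int i + 1 / 2) / 2 ^ l :: real)"
  define r where "r = (\<lambda>l::nat. 1 / 2 ^ Suc l :: real)"
  \<comment> \<open>Threefold enlargement inside \<open>H k\<close>, ninefold not, except at the
    coarsest level 2. The bound on \<open>i\<close> leaves finitely many arcs at each level and
    still reaches all of the interval of slopes.\<close>
  define valid where "valid = (\<lambda>(k, l, i). 2 \<le> l \<and> \<bar>i\<bar> \<le> 4 * 2 ^ l \<and> {C l i - 3 * r l<..<C l i + 3 * r l} \<subseteq> H k \<and>
     (l = 2 \<or> \<not> {C l i - 9 * r l<..<C l i + 9 * r l} \<subseteq> H k))"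
  define c where "c = (\<lambda>j. case from_nat j :: nat \<times> nat \<times> int of (k, l, i) \<Rightarrow> C l i)"
  \<comment> \<open>The maximum keeps \<open>h\<close> at most 1/8 for codes of invalid triples
    too.\<close>
  define h where "h = (\<lambda>j. case from_nat j :: nat \<times> nat \<times> int of (k, l, i) \<Rightarrow> r (max 2 l))"
  define V where "V = to_nat ` {x. valid x}"
  have ch: "c (to_nat (k :: nat, l :: nat, i :: int)) = C l i" "h (to_nat (k :: nat, l :: nat, i :: int)) = r (max 2 l)" for k l i
    by (simp_all add: c_def h_def)
  have near: "\<bar>s - C l \<lfloor>s * 2 ^ l\<rfloor>\<bar> \<le> r l" for s l
  proof -
    define i where "i = \<lfloor>s * 2 ^ l\<rfloor>"
    have "of_int i \<le> s * 2 ^ l" "s * 2 ^ l < of_int i + 1" unfolding i_def by linarith+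
    then have "of_int i / 2 ^ l \<le> s" "s < (of_int i + 1) / 2 ^ l" by (simp_all add: field_simps)
    moreover have "C l i = of_int i / 2 ^ l + r l" "(of_int i + 1) / 2 ^ l = of_int i / 2 ^ l + r l + r l"
      by (simp_all add: C_def r_def add_divide_distrib)
    ultimately show ?thesis unfolding i_def[symmetric] by linarith
  qed
  have r0: "0 < r l" for l by (simp add: r_def)
  show ?thesis
  proof (rule that[of h V c])
    show "0 < h j \<and> h j \<le> 1 / 8" for j
    proof -
      obtain k l i where kli: "(from_nat j :: nat \<times> nat \<times> int) = (k, l, i)" by (cases "from_nat j :: nat \<times> nat \<times> int") auto
      have "(2 :: real) ^ 3 \<le> 2 ^ Suc (max 2 l)" by (intro power_increasing) auto
      then have "r (max 2 l) \<le> 1 / 8" unfolding r_def by (simp add: field_simps)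
      then show ?thesis using r0[of "max 2 l"] by (simp add: h_def kli)
    qed
  next
    fix s assume s: "s \<in> S"
    then have s0: "s \<in> {0..<pi / 2}" using S by blast
    have "\<exists>l i. valid (k, l, i) \<and> \<bar>s - C l i\<bar> \<le> r l" for k
    proof -
      define i where "i = (\<lambda>l. \<lfloor>s * 2 ^ l\<rfloor>)"
      define P where "P = (\<lambda>l. 2 \<le> l \<and> {C l (i l) - 3 * r l<..<C l (i l) + 3 * r l} \<subseteq> H k)"
      have nr: "\<bar>s - C l (i l)\<bar> \<le> r l" for l unfolding i_def by (rule near)
      have "s \<in> H k" using H(4)[OF s0] s by blast
      then obtain d where d: "d > 0" "ball s d \<subseteq> H k" using H(1) openE by blast
      obtain l0 where l0: "2 / d < 2 ^ l0" using real_arch_pow[of 2 "2 / d"] by auto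
      define l1 where "l1 = max 2 l0"
      have "(2::real) ^ l0 \<le> 2 ^ l1" unfolding l1_def by (intro power_increasing) auto
      then have "2 / d < 2 ^ l1" using l0 by linarith
      then have "4 * r l1 < d" using d(1) by (simp add: r_def field_simps)
      then have "P l1"
        unfolding P_def
      proof (intro conjI subsetI)
        show "2 \<le> l1" by (simp add: l1_def)
        fix y assume "y \<in> {C l1 (i l1) - 3 * r l1<..<C l1 (i l1) + 3 * r l1}"
        then have "\<bar>s - y\<bar> < 4 * r l1" using nr[of l1] unfolding greaterThanLessThan_iff by linarith
        then have "y \<in> ball s d" using \<open>4 * r l1 < d\<close> by (simp add: dist_real_def)
        then show "y \<in> H k" using d(2) by blast
      qed
      define l where "l = (LEAST l. P l)"
      have Pl: "P l" unfolding l_def by (rule LeastI) (rule \<open>P l1\<close>)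
      have "valid (k, l, i l)"
        unfolding valid_def prod.case
      proof (intro conjI)
        show "2 \<le> l" "{C l (i l) - 3 * r l<..<C l (i l) + 3 * r l} \<subseteq> H k" using Pl by (auto simp: P_def)
        have "s < 2" using s0 pi_less_4 by simp
        then have "0 \<le> s * 2 ^ l" "s * 2 ^ l < 2 * 2 ^ l" using s0 by auto
        then have "0 \<le> i l" "real_of_int (i l) \<le> real_of_int (2 * 2 ^ l)" unfolding i_def by (simp, simp, linarith)
        then have "0 \<le> i l" "i l \<le> 2 * 2 ^ l" by (simp_all only: of_int_le_iff)
        then show "\<bar>i l\<bar> \<le> 4 * 2 ^ l" by simp
        show "l = 2 \<or> \<not> {C l (i l) - 9 * r l<..<C l (i l) + 9 * r l} \<subseteq> H k"
        proof (rule disjCI)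
          assume "\<not> \<not> {C l (i l) - 9 * r l<..<C l (i l) + 9 * r l} \<subseteq> H k"
          then have sub: "{C l (i l) - 9 * r l<..<C l (i l) + 9 * r l} \<subseteq> H k" by simp
          show "l = 2"
          proof (rule ccontr)
            assume "l \<noteq> 2"
            then have l2: "2 \<le> l - 1" "Suc (l - 1) = l" using Pl by (auto simp: P_def)
            have rs: "r m = 2 * r (Suc m)" for m by (simp add: r_def)
            have rr: "r (l - 1) = 2 * r l" using rs[of "l - 1"] unfolding l2(2) .
            \<comment> \<open>Origin of the 9: the tripled parent has radius \<open>6 * r l\<close>,
              and the two centres are at most \<open>3 * r l\<close> apart. A ninefold enlargement
              inside \<open>H k\<close> would contradict the minimality of \<open>l\<close>.\<close>
            have "{C (l - 1) (i (l - 1)) - 3 * r (l - 1)<..<C (l - 1) (i (l - 1)) + 3 * r (l - 1)} \<subseteq> {C l (i l) - 9 * r l<..<C l (i l) + 9 * r l}"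
            proof
              fix y assume "y \<in> {C (l - 1) (i (l - 1)) - 3 * r (l - 1)<..<C (l - 1) (i (l - 1)) + 3 * r (l - 1)}"
              then show "y \<in> {C l (i l) - 9 * r l<..<C l (i l) + 9 * r l}"
                using nr[of l] nr[of "l - 1"] unfolding rr greaterThanLessThan_iff by linarith
            qed
            then have "P (l - 1)" unfolding P_def using l2(1) sub by blast
            moreover have "l - 1 < l" using l2 by simp
            ultimately show False using not_less_Least[of "l - 1" P] by (simp add: l_def[symmetric])
          qed
        qed
      qed
      then show ?thesis using nr by blast
    qed
    then have "\<forall>k. \<exists>x. valid (k, fst x, snd x) \<and> \<bar>s - C (fst x) (snd x)\<bar> \<le> r (fst x)" by auto
    from choice[OF this] obtain f where f: "\<forall>k. valid (k, fst (f k), snd (f k)) \<and> \<bar>s - C (fst (f k)) (snd (f k))\<bar> \<le> r (fst (f k))"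
      by (elim exE)
    define l where "l = (\<lambda>k. fst (f k))"
    define i where "i = (\<lambda>k. snd (f k))"
    have li: "valid (k, l k, i k) \<and> \<bar>s - C (l k) (i k)\<bar> \<le> r (l k)" for k
      using f unfolding l_def i_def by blast
    have "range (\<lambda>k. to_nat (k, l k, i k)) \<subseteq> {j \<in> V. s \<in> {c j - h j..c j + h j}}"
    proof
      fix j assume "j \<in> range (\<lambda>k. to_nat (k, l k, i k))"
      then obtain k where j: "j = to_nat (k, l k, i k)" by blast
      have "2 \<le> l k" using li[of k] by (simp add: valid_def)
      then have "h j = r (l k)" "c j = C (l k) (i k)" by (simp_all add: j ch max_def)
      moreover have "j \<in> V" using li[of k] by (simp add: V_def j)
      ultimately show "j \<in> {j \<in> V. s \<in> {c j - h j..c j + h j}}" using li[of k] by auto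
    qed
    moreover have "inj (\<lambda>k. to_nat (k, l k, i k))" by (rule injI) simp
    ultimately show "infinite {j \<in> V. s \<in> {c j - h j..c j + h j}}"
      using range_inj_infinite infinite_super by blast
  next
    fix s assume s: "s \<in> {0..<pi / 2} - S"
    then obtain K where K: "s \<notin> H K" using H(4)[of s] by blast
    have "\<exists>L. \<forall>l i. \<forall>z::int. valid (k, l, i) \<longrightarrow> s + of_int z * (pi / 2) \<in> {C l i - 3 * r l<..<C l i + 3 * r l} \<longrightarrow> l \<le> L" for k
    proof (cases "s \<in> H k")
      case False
      have "\<not> (valid (k, l, i) \<and> s + of_int z * (pi / 2) \<in> {C l i - 3 * r l<..<C l i + 3 * r l})" for l i and z :: int
      proof
        assume *: "valid (k, l, i) \<and> s + of_int z * (pi / 2) \<in> {C l i - 3 * r l<..<C l i + 3 * r l}"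
        then have "{C l i - 3 * r l<..<C l i + 3 * r l} \<subseteq> H k" unfolding valid_def by simp
        then have "s + of_int z * (pi / 2) \<in> H k" using * by blast
        then show False using False per[of s z k] by simp
      qed
      then show ?thesis by blast
    next
      case True
      then obtain d where d: "d > 0" "ball s d \<subseteq> H k" using H(1) openE by blast
      obtain L where L: "6 / d < real L" using reals_Archimedean2 by blast
      have "l \<le> max 2 L" if v: "valid (k, l, i)" and z: "s + of_int z * (pi / 2) \<in> {C l i - 3 * r l<..<C l i + 3 * r l}" for l i and z :: int
      proof (rule ccontr)
        assume "\<not> ?thesis"
        then have l: "l \<noteq> 2" "L < l" by auto
        have "real L < 2 ^ l" using l(2) of_nat_less_two_power[of l, where ?'a = real] by linarith
        then have "6 / d < 2 ^ l" using L by linarith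
        \<comment> \<open>The translate of \<open>s\<close> is within \<open>3 * r l\<close> of the
          centre and the ninefold arc reaches \<open>9 * r l\<close>, so a small arc would have its
          ninefold enlargement inside \<open>H k\<close>.\<close>
        then have "12 * r l < d" using d(1) by (simp add: r_def field_simps)
        have "{C l i - 9 * r l<..<C l i + 9 * r l} \<subseteq> H k"
        proof
          fix y assume "y \<in> {C l i - 9 * r l<..<C l i + 9 * r l}"
          then have "\<bar>y - (s + of_int z * (pi / 2))\<bar> < d"
            using z \<open>12 * r l < d\<close> unfolding greaterThanLessThan_iff by linarith
          moreover have "s - (y + of_int (- z) * (pi / 2)) = - (y - (s + of_int z * (pi / 2)))" by simp
          ultimately have "y + of_int (- z) * (pi / 2) \<in> ball s d" unfolding mem_ball dist_real_def by linarith
          then have "y + of_int (- z) * (pi / 2) \<in> H k" using d(2) by (rule subsetD[rotated])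
          then show "y \<in> H k" by (rule per)
        qed
        then show False using v l by (simp add: valid_def)
      qed
      then show ?thesis by blast
    qed
    then have "\<forall>k. \<exists>L. \<forall>l i. \<forall>z::int. valid (k, l, i) \<longrightarrow> s + of_int z * (pi / 2) \<in> {C l i - 3 * r l<..<C l i + 3 * r l} \<longrightarrow> l \<le> L" ..
    from choice[OF this] obtain L where L0: "\<forall>k. \<forall>l i. \<forall>z::int. valid (k, l, i) \<longrightarrow> s + of_int z * (pi / 2) \<in> {C l i - 3 * r l<..<C l i + 3 * r l} \<longrightarrow> l \<le> L k"
      by (elim exE)
    have L: "\<And>k l i (z::int). valid (k, l, i) \<Longrightarrow> s + of_int z * (pi / 2) \<in> {C l i - 3 * r l<..<C l i + 3 * r l} \<Longrightarrow> l \<le> L k"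
      using L0 by blast
    have "{j \<in> V. \<exists>z::int. s + of_int z * (pi / 2) \<in> {c j - 3 * h j<..<c j + 3 * h j}} \<subseteq>
        to_nat ` (SIGMA k:{..<K}. SIGMA l:{..L k}. {- 4 * 2 ^ l..4 * 2 ^ l :: int})"
    proof
      fix j assume j: "j \<in> {j \<in> V. \<exists>z::int. s + of_int z * (pi / 2) \<in> {c j - 3 * h j<..<c j + 3 * h j}}"
      then obtain k l i where kli: "j = to_nat (k, l, i)" "valid (k, l, i)" by (auto simp: V_def)
      obtain z :: int where z: "s + of_int z * (pi / 2) \<in> {c j - 3 * h j<..<c j + 3 * h j}" using j by blast
      have "2 \<le> l" using kli by (simp add: valid_def)
      then have "h j = r l" "c j = C l i" by (simp_all add: kli ch max_def)
      with z have z': "s + of_int z * (pi / 2) \<in> {C l i - 3 * r l<..<C l i + 3 * r l}" by simp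
      have "l \<le> L k" by (rule L[OF kli(2) z'])
      moreover have "k < K"
      proof (rule ccontr)
        assume "\<not> k < K"
        then have "H k \<subseteq> H K" using H(3) by simp
        moreover have "{C l i - 3 * r l<..<C l i + 3 * r l} \<subseteq> H k" using kli(2) unfolding valid_def by simp
        ultimately have "s + of_int z * (pi / 2) \<in> H K" using z' by blast
        then show False using K per[of s z K] by simp
      qed
      moreover have "\<bar>i\<bar> \<le> 4 * 2 ^ l" using kli by (simp add: valid_def)
      ultimately show "j \<in> to_nat ` (SIGMA k:{..<K}. SIGMA l:{..L k}. {- 4 * 2 ^ l..4 * 2 ^ l :: int})"
        unfolding kli(1) by (intro imageI) auto
    qed
    then show "finite {j \<in> V. \<exists>z::int. s + of_int z * (pi / 2) \<in> {c j - 3 * h j<..<c j + 3 * h j}}"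
      by (rule finite_subset) (intro finite_imageI finite_SigmaI finite_lessThan finite_atMost finite_atLeastAtMost_int)
  qed
qed

section \<open>Summation of the building blocks\<close>

lemma average_mono_AE:
  assumes f: "integrable lebesgue f" and g: "integrable lebesgue g" and le: "AE x in lebesgue. f x \<le> g x"
    and ab: "0 < a" "0 < b"
  shows "average f (open_rect s p a b) \<le> average g (open_rect s p a b)"
  unfolding average_def set_lebesgue_integral_def measure_open_rect[OF ab]
proof (intro divide_right_mono integral_mono_AE)
  show "integrable lebesgue (\<lambda>x. indicator (open_rect s p a b) x *\<^sub>R f x)" by (rule integrable_mult_indicator[OF _ f]) simp
  show "integrable lebesgue (\<lambda>x. indicator (open_rect s p a b) x *\<^sub>R g x)" by (rule integrable_mult_indicator[OF _ g]) simp
  show "AE x in lebesgue. indicator (open_rect s p a b) x *\<^sub>R f x \<le> indicator (open_rect s p a b) x *\<^sub>R g x"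
    using le by eventually_elim (simp add: indicator_def)
qed (use ab in simp)

lemma AE_eventually_not_in:
  fixes W :: "nat \<Rightarrow> (real ^ 2) set"
  assumes W: "\<And>j. W j \<in> lmeasurable" "\<And>j. measure lebesgue (W j) \<le> (1 / 2) ^ j"
  shows "AE x in lebesgue. eventually (\<lambda>j. x \<notin> W j) sequentially"
proof -
  have "summable (\<lambda>j. measure lebesgue (W j))"
    using W(2) by (intro summable_comparison_test'[OF summable_geometric[of "1 / 2 :: real"]]) auto
  then have "AE x in lebesgue. eventually (\<lambda>j. x \<in> space lebesgue - W j) sequentially"
  proof (rule borel_cantelli_AE1[rotated 2])
    show "W j \<in> sets lebesgue" for j using W(1) by (rule fmeasurableD)
    show "emeasure lebesgue (W j) < \<infinity>" for j using W(1)[of j] by (simp only: fmeasurable_def mem_Collect_eq)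
  qed
  then show ?thesis by eventually_elim simp
qed

text \<open>Block \<open>j\<close> has mass and errors at most \<open>e j\<close> and acts on a disc
  of radius \<open>j + 1\<close>. For a slope in \<open>S\<close> infinitely many blocks give
  averages above \<open>2 ^ j\<close> at almost every point. For other slopes the finitely many
  blocks whose outer arc is met, together with any initial segment, are handled by continuity, and
  the rest by domination by \<open>e j\<close>.\<close>

theorem gdelta_imp_R_set:
  assumes SG: "S \<subseteq> {0..<pi / 2}" and oG: "\<And>k. open (G k)" and S: "S = (\<Inter>k::nat. G k) \<inter> {0..<pi / 2}"
  shows "R_set S"
proof -
  obtain V :: "nat set" and c h :: "nat \<Rightarrow> real" where h: "\<And>j. 0 < h j \<and> h j \<le> 1 / 8"
    and inf: "\<And>s. s \<in> S \<Longrightarrow> infinite {j \<in> V. s \<in> {c j - h j..c j + h j}}"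
    and fin: "\<And>s. s \<in> {0..<pi / 2} - S \<Longrightarrow> finite {j \<in> V. \<exists>z::int. s + of_int z * (pi / 2) \<in> {c j - 3 * h j<..<c j + 3 * h j}}"
    by (rule dyadic_cover[OF oG S]) (rule that; assumption)
  define e where "e = (\<lambda>j::nat. (1 / 2 :: real) ^ j)"
  have e: "0 < e j" "e j \<le> 1" for j by (simp_all add: e_def power_le_one)
  have e_sum: "summable e" "(\<Sum>j. e j) = 2" unfolding e_def using sums_unique[OF geometric_sums[of "1 / 2 :: real"]] by (simp_all add: summable_geometric)
  define props where "props = (\<lambda>j (F :: real ^ 2 \<Rightarrow> real). F \<in> borel_measurable borel \<and> (\<forall>x. 0 \<le> F x) \<and> integrable lborel F \<and> (\<integral>x. F x \<partial>lborel) \<le> e j \<and>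
     (AE x in lborel. isCont F x) \<and>
     (\<forall>s. j \<in> V \<and> s \<in> {c j - h j..c j + h j} \<longrightarrow> mostly_heavy F (e j) (real j + 1) s) \<and>
     (\<forall>s. \<not> (j \<in> V \<and> (\<exists>z::int. s + of_int z * (pi / 2) \<in> {c j - 3 * h j<..<c j + 3 * h j})) \<longrightarrow>
       mostly_small F (e j) s))"
  have "\<exists>F. props j F" for j
  proof (cases "j \<in> V")
    case True
    have M: "0 < real j + 1" by simp
    have hj: "0 < h j" "h j \<le> 1 / 8" using h[of j] by auto
    show ?thesis
    proof (rule building_block[OF hj e M, where c = "c j"])
      fix F :: "real ^ 2 \<Rightarrow> real"
      assume "F \<in> borel_measurable borel" "\<And>x. 0 \<le> F x" "integrable lborel F" "(\<integral>x. F x \<partial>lborel) \<le> e j"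
        "AE x in lborel. isCont F x"
        "\<And>s. s \<in> {c j - h j..c j + h j} \<Longrightarrow> mostly_heavy F (e j) (real j + 1) s"
        "\<And>s. (\<And>k::int. s + of_int k * (pi / 2) \<notin> {c j - 3 * h j<..<c j + 3 * h j}) \<Longrightarrow> mostly_small F (e j) s"
      then have "props j F" unfolding props_def using True by blast
      then show ?thesis by (rule exI[where x = F])
    qed
  next
    \<comment> \<open>Indices that code no arc receive the zero function.\<close>
    case False
    have a0: "average (\<lambda>_. 0) R = 0" for R by (simp add: average_def)
    have "props j (\<lambda>_. 0)"
      unfolding props_def mostly_small_def using False e[of j] by (auto simp: a0 intro!: bexI[of _ "{}"])
    then show ?thesis by (rule exI[where x = "\<lambda>_. 0"])
  qed
  then have "\<forall>j. \<exists>F. props j F" by (rule allI)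
  from choice[OF this] obtain F where F0: "\<forall>j. props j (F j)" by (elim exE)
  have F: "props j (F j)" for j using F0 by (rule spec)
  have Fm [measurable]: "F j \<in> borel_measurable borel" and F0: "0 \<le> F j x" and Fi: "integrable lborel (F j)"
    and Fe: "(\<integral>x. F j x \<partial>lborel) \<le> e j" and Fc: "AE x in lborel. isCont (F j) x" for j x
    using F[of j] unfolding props_def by simp_all
  have Fil: "integrable lebesgue (F j)" for j using Fi[of j] Fm[of j] by (simp add: integrable_completion)
  have Fel: "(\<integral>x. F j x \<partial>lebesgue) = (\<integral>x. F j x \<partial>lborel)" for j using Fm[of j] by (simp add: integral_completion)
  define f where "f = (\<lambda>x. \<Sum>j. F j x)"
  have summ: "AE x in lebesgue. summable (\<lambda>j. F j x)"
  proof (rule AE_completion)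
    have "(\<integral>\<^sup>+x. (\<Sum>j. ennreal (F j x)) \<partial>lborel) = (\<Sum>j. \<integral>\<^sup>+x. ennreal (F j x) \<partial>lborel)"
      by (rule nn_integral_suminf) measurable
    also have "\<dots> \<le> (\<Sum>j. ennreal (e j))"
      using nn_integral_eq_integral[OF Fi] F0 Fe by (intro suminf_le) (auto intro!: ennreal_leI)
    also have "\<dots> = ennreal 2" using e_sum e by (subst suminf_ennreal2) (auto intro: less_imp_le)
    finally have "(\<integral>\<^sup>+x. (\<Sum>j. ennreal (F j x)) \<partial>lborel) \<noteq> \<infinity>" by (auto simp: top_unique)
    then have "AE x in lborel. (\<Sum>j. ennreal (F j x)) \<noteq> \<infinity>" by (intro nn_integral_PInf_AE) measurable
    then show "AE x in lborel. summable (\<lambda>j. F j x)"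
      by eventually_elim (use F0 in \<open>auto intro!: summable_suminf_not_top\<close>)
  qed
  have summ_int: "summable (\<lambda>j. \<integral>x. F j x \<partial>lebesgue)"
    unfolding Fel using Fe F0 by (intro summable_comparison_test'[OF e_sum(1)]) (auto simp: abs_of_nonneg integral_nonneg_AE)
  have fi: "integrable lebesgue f"
    unfolding f_def using summ summ_int F0 by (intro integrable_suminf Fil) auto
  have ge: "AE x in lebesgue. F j x \<le> f x" for j
    using summ
  proof eventually_elim
    case (elim x)
    have "sum (\<lambda>j. F j x) {j} \<le> f x" unfolding f_def using elim F0 by (intro sum_le_suminf) auto
    then show ?case by simp
  qed
  have "AE x in lebesgue. upper_derivative s f x = \<infinity>" if s: "s \<in> S" for s
  proof -
    define A where "A = {j \<in> V. s \<in> {c j - h j..c j + h j}}"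
    have "\<exists>W\<in>lmeasurable. measure lebesgue W \<le> e j \<and> (j \<in> A \<longrightarrow> (\<forall>x\<in>ball 0 (real j + 1) - W. heavy (F j) (e j) (1 / e j) s x))" for j
    proof (cases "j \<in> A")
      case True
      then show ?thesis using F[of j] unfolding props_def mostly_heavy_def A_def by blast
    next
      case False
      then show ?thesis using e[of j] by (intro bexI[of _ "{}"]) auto
    qed
    then obtain W where W: "\<And>j. W j \<in> lmeasurable" "\<And>j. measure lebesgue (W j) \<le> e j"
      "\<And>j x. j \<in> A \<Longrightarrow> x \<in> ball 0 (real j + 1) - W j \<Longrightarrow> heavy (F j) (e j) (1 / e j) s x"
      by metis
    have "AE x in lebesgue. eventually (\<lambda>j. x \<notin> W j) sequentially"
      using W(1,2) unfolding e_def by (rule AE_eventually_not_in)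
    then show ?thesis
    proof eventually_elim
      case (elim x)
      show ?case
        unfolding upper_derivative_eq_PInf_iff
      proof
        fix m :: nat
        obtain k :: nat where k: "norm x < k" using reals_Archimedean2 by blast
        obtain q where q: "\<And>j. q \<le> j \<Longrightarrow> x \<notin> W j" using elim unfolding eventually_sequentially by blast
        obtain j where j: "j \<in> A" "max (Suc m) (max k q) < j"
          using inf[OF s, folded A_def] unfolding infinite_nat_iff_unbounded by blast
        have "x \<in> ball 0 (real j + 1) - W j" using k j q by (auto simp: max_def split: if_splits)
        from W(3)[OF j(1) this] obtain p a b where R: "0 < a" "0 < b" "a + b < e j" "x \<in> open_rect s p a b"
          "1 / e j < average (F j) (open_rect s p a b)" unfolding heavy_def by blast
        have pw: "real (Suc m) \<le> 2 ^ j"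
        proof -
          have "real (Suc m) \<le> real j" using j by simp
          then show ?thesis using of_nat_less_two_power[of j, where ?'a = real] by linarith
        qed
        have ej: "1 / e j = 2 ^ j" by (simp add: e_def power_one_over)
        have "e j = 1 / 2 ^ j" by (simp add: e_def power_one_over)
        also have "\<dots> \<le> 1 / Suc m" using pw by (intro divide_left_mono) auto
        finally have "e j \<le> 1 / Suc m" .
        moreover have "real m \<le> 1 / e j"
        proof -
          have "real m \<le> real (Suc m)" by simp
          then show ?thesis unfolding ej using pw by linarith
        qed
        moreover have "average (F j) (open_rect s p a b) \<le> average f (open_rect s p a b)"
          by (rule average_mono_AE[OF Fil fi ge R(1,2)])
        ultimately have "a + b < 1 / Suc m" "m < average f (open_rect s p a b)" using R by linarith+
        then show "heavy f (1 / real (Suc m)) (real m) s x" unfolding heavy_def using R by blast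
      qed
    qed
  qed
  moreover have "differentiates s f" if s: "s \<in> {0..<pi / 2} - S" for s
  proof -
    define E where "E = {j \<in> V. \<exists>z::int. s + of_int z * (pi / 2) \<in> {c j - 3 * h j<..<c j + 3 * h j}}"
    have finE: "finite E" unfolding E_def by (rule fin[OF s])
    have "\<exists>W\<in>lmeasurable. measure lebesgue W \<le> e j \<and> (j \<notin> E \<longrightarrow> (\<forall>x p a b. x \<notin> W \<longrightarrow> 0 < a \<longrightarrow> 0 < b \<longrightarrow> a + b < 1 \<longrightarrow>
          x \<in> open_rect s p a b \<longrightarrow> average (F j) (open_rect s p a b) \<le> e j))" for j
    proof (cases "j \<in> E")
      case False
      then have "\<not> (j \<in> V \<and> (\<exists>z::int. s + of_int z * (pi / 2) \<in> {c j - 3 * h j<..<c j + 3 * h j}))" unfolding E_def by blast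
      then show ?thesis using F[of j] unfolding props_def mostly_small_def by blast
    next
      case True
      then show ?thesis using e[of j] by (intro bexI[of _ "{}"]) auto
    qed
    then obtain W where W: "\<And>j. W j \<in> lmeasurable" "\<And>j. measure lebesgue (W j) \<le> e j"
      "\<And>j x p a b. j \<notin> E \<Longrightarrow> x \<notin> W j \<Longrightarrow> 0 < a \<Longrightarrow> 0 < b \<Longrightarrow> a + b < 1 \<Longrightarrow>
          x \<in> open_rect s p a b \<Longrightarrow> average (F j) (open_rect s p a b) \<le> e j"
      by metis
    have "AE x in lebesgue. eventually (\<lambda>j. x \<notin> W j) sequentially"
      using W(1,2) unfolding e_def by (rule AE_eventually_not_in)
    moreover have "AE x in lebesgue. \<forall>j. isCont (F j) x"
      unfolding AE_all_countable using AE_completion[OF Fc] by blast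
    ultimately show ?thesis
      unfolding differentiates_def using summ
    proof eventually_elim
      case (elim x)
      have tend: "(average (F j) \<longlongrightarrow> F j x) (shrinking_rects s x)" for j
        using elim by (intro isCont_tendsto_average Fil) auto
      obtain q where q: "\<And>j. q \<le> j \<Longrightarrow> x \<notin> W j" using elim unfolding eventually_sequentially by blast
      obtain q' where q': "\<And>j. j \<in> E \<Longrightarrow> j < q'" using finE by (metis finite_nat_set_iff_bounded)
      have small: "eventually (\<lambda>R. average (F j) R \<le> e j) (shrinking_rects s x)" if "max q q' \<le> j" for j
      proof -
        have "j \<notin> E" "x \<notin> W j" using q q'[of j] that by auto
        then show ?thesis unfolding eventually_shrinking_rects using W(3) by (intro exI[of _ 1]) auto
      qed
      \<comment> \<open>The value at a continuity point is a limit of averages bounded by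
        \<open>e j\<close>. Nontriviality of the filter is essential here.\<close>
      have Fx: "F j x \<le> e j" if "max q q' \<le> j" for j
        by (rule tendsto_upperbound[OF tend small[OF that] shrinking_rects_neq_bot])
      show "(average f \<longlongrightarrow> f x) (shrinking_rects s x)"
      proof (rule tendstoI)
        fix r :: real assume r: "0 < r"
        obtain k0 where k0: "(1 / 2 :: real) ^ k0 < r / 8" using real_arch_pow_inv[of "r / 8" "1 / 2 :: real"] r by auto
        define k where "k = max k0 (max q q')"
        have tail: "(\<Sum>j. e (j + k)) \<le> r / 4" "summable (\<lambda>j. e (j + k))"
        proof -
          have "(\<lambda>j. (1 / 2 :: real) ^ k * (1 / 2) ^ j) sums ((1 / 2) ^ k * 2)"
            using geometric_sums[of "1 / 2 :: real"] by (intro sums_mult) simp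
          then have "(\<lambda>j. e (j + k)) sums ((1 / 2) ^ k * 2)" by (simp add: e_def power_add mult.commute)
          then have s: "summable (\<lambda>j. e (j + k))" "(\<Sum>j. e (j + k)) = (1 / 2) ^ k * 2" by (simp_all only: sums_iff)
          have "(1 / 2 :: real) ^ k \<le> (1 / 2) ^ k0" by (intro power_decreasing) (auto simp: k_def)
          then show "(\<Sum>j. e (j + k)) \<le> r / 4" unfolding s(2) using k0 by linarith
          show "summable (\<lambda>j. e (j + k))" by (rule s(1))
        qed
        \<comment> \<open>Domination by the geometric series, used twice: for the values at
          \<open>x\<close> and for the averages over one small rectangle, uniformly in the
          rectangle.\<close>
        have split_le: "\<bar>suminf g - (\<Sum>j<k. g j)\<bar> \<le> r / 4"
          if "summable g" "\<And>j. 0 \<le> g j" "\<And>j. k \<le> j \<Longrightarrow> g j \<le> e j" for g :: "nat \<Rightarrow> real"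
        proof -
          have "suminf g = (\<Sum>j. g (j + k)) + (\<Sum>j<k. g j)" by (rule suminf_split_initial_segment[OF that(1)])
          moreover have "(\<Sum>j. g (j + k)) \<le> (\<Sum>j. e (j + k))"
            using that tail(2) by (intro suminf_le) (auto simp: summable_iff_shift)
          moreover have "0 \<le> (\<Sum>j. g (j + k))" using that by (intro suminf_nonneg) (auto simp: summable_iff_shift)
          ultimately show ?thesis using tail(1) by linarith
        qed
        have fx: "\<bar>f x - (\<Sum>j<k. F j x)\<bar> \<le> r / 4"
          unfolding f_def using elim F0 Fx by (intro split_le) (auto simp: k_def)
        have avg: "\<bar>average f R - (\<Sum>j<k. average (F j) R)\<bar> \<le> r / 4"
          if R: "R = open_rect s p a b" "0 < a" "0 < b" "a + b < 1" "x \<in> R" for R p a b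
        proof -
          have Ri: "integrable lebesgue (\<lambda>y. indicator R y *\<^sub>R F j y)" for j
            using R by (intro integrable_mult_indicator Fil) simp
          have le: "(\<integral>y. indicator R y *\<^sub>R F j y \<partial>lebesgue) \<le> (\<integral>y. F j y \<partial>lebesgue)" for j
            using F0 by (intro integral_mono Ri Fil) (auto simp: indicator_def)
          have nn: "0 \<le> (\<integral>y. indicator R y *\<^sub>R F j y \<partial>lebesgue)" for j
            using F0 by (intro integral_nonneg_AE) auto
          have su: "summable (\<lambda>j. \<integral>y. indicator R y *\<^sub>R F j y \<partial>lebesgue)"
            using le nn by (intro summable_comparison_test'[OF summ_int]) auto
          have ax: "AE y in lebesgue. summable (\<lambda>j. norm (indicator R y *\<^sub>R F j y))"
            using summ by eventually_elim (use F0 in \<open>auto simp: indicator_def\<close>)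
          have sn: "summable (\<lambda>j. \<integral>y. norm (indicator R y *\<^sub>R F j y) \<partial>lebesgue)"
            using su F0 by simp
          have "(\<integral>y. (\<Sum>j. indicator R y *\<^sub>R F j y) \<partial>lebesgue) = (\<Sum>j. \<integral>y. indicator R y *\<^sub>R F j y \<partial>lebesgue)"
            by (rule integral_suminf[OF Ri ax sn])
          moreover have "(\<Sum>j. indicator R y *\<^sub>R F j y) = indicator R y *\<^sub>R f y" for y
            by (simp add: f_def indicator_def)
          ultimately have "average f R = (\<Sum>j. (\<integral>y. indicator R y *\<^sub>R F j y \<partial>lebesgue)) / measure lebesgue R"
            by (simp add: average_def set_lebesgue_integral_def)
          also have "\<dots> = (\<Sum>j. average (F j) R)"
            unfolding average_def set_lebesgue_integral_def by (rule suminf_divide[OF su, symmetric])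
          finally have e1: "average f R = (\<Sum>j. average (F j) R)" .
          show ?thesis
            unfolding e1
          proof (rule split_le)
            show "summable (\<lambda>j. average (F j) R)"
              unfolding average_def set_lebesgue_integral_def by (rule summable_divide[OF su])
            show "0 \<le> average (F j) R" for j
              unfolding average_def set_lebesgue_integral_def using nn by simp
            show "average (F j) R \<le> e j" if "k \<le> j" for j
            proof -
              have "j \<notin> E" "x \<notin> W j" using q q'[of j] that by (auto simp: k_def)
              then show ?thesis using W(3) R by blast
            qed
          qed
        qed
        have "((\<lambda>R. \<Sum>j<k. average (F j) R) \<longlongrightarrow> (\<Sum>j<k. F j x)) (shrinking_rects s x)"
          by (intro tendsto_sum tend)
        then have "eventually (\<lambda>R. dist (\<Sum>j<k. average (F j) R) (\<Sum>j<k. F j x) < r / 4) (shrinking_rects s x)"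
          using r by (intro tendstoD) auto
        moreover have "eventually (\<lambda>R. \<bar>average f R - (\<Sum>j<k. average (F j) R)\<bar> \<le> r / 4) (shrinking_rects s x)"
          unfolding eventually_shrinking_rects using avg by (intro exI[of _ 1]) auto
        ultimately show "eventually (\<lambda>R. dist (average f R) (f x) < r) (shrinking_rects s x)"
        proof eventually_elim
          case (elim R)
          then show ?case using fx r unfolding dist_real_def by linarith
        qed
      qed
    qed
  qed
  ultimately show ?thesis unfolding R_set_def using SG fi by blast
qed

theorem theorem1:
  fixes S :: "real set"
  assumes "S \<subseteq> {0..<pi / 2}"
  shows "R_set S \<longleftrightarrow>
    (\<exists>G :: nat \<Rightarrow> real set. (\<forall>k. open (G k)) \<and> S = (\<Inter>k. G k) \<inter> {0..<pi / 2})"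
  using R_set_imp_gdelta gdelta_imp_R_set[OF assms] by blast

end
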